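(* Let $\Omega\subset\mathbb{R}^N$ be a bounded smooth domain, $r>N$. (i) Let $q\in(0,1)$ and $a\in L^r(\Omega)$ satisfy $(H_0)$ and $(H_1')$, and assume $\Omega_+$ contains a tubular neighborhood of $\partial\Omega$, i.e. $\Omega\setminus\overline{\Omega_\sigma}\subset\Omega_+$ for some $\sigma>0$. Then every nontrivial nonnegative solution $u$ of $(P_{a,q})$ is positive on $\partial\Omega$. Consequently, every nontrivial nonnegative solution $u$ of $(P_{a,q})$ either belongs to $\mathcal{P}^\circ$ or has a nonempty dead core $\{x\in\Omega:u(x)=0\}$. (ii) Let $b_1\in L^\infty(\Omega)$, $b_2\in\mathcal{C}(\overline\Omega)$ with $b_1,b_2\ge0$, $b_1,b_2\not\equiv0$, and $\mathrm{supp}\,b_1\cap\{x\in\Omega:b_2(x)>0\}=\emptyset$. For $\delta>0$ set $a_\delta:=b_1-\delta b_2$ and $G:=\{x\in\Omega:b_2(x)>0\}$. Then for every $\overline q\in(0,1)$ and $\sigma>0$ there exists $\delta_0=\delta_0(\sigma,\overline q)>0$ such that, for every $\delta\ge\delta_0$ and every $q\in(0,\overline q]$, every nontrivial nonnegative solution of $(P_{a_\delta,q})$ vanishes identically in $G_\sigma$.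
   Context: $(P_{a,q})$ denotes $-\Delta u=a(x)u^q$ in $\Omega$, $\partial u/\partial\nu=0$ on $\partial\Omega$. A nonnegative solution is $u\in W^{2,r}(\Omega)$, $u\ge0$, satisfying the equation a.e. and the boundary condition; nontrivial means $u\not\equiv0$. $\mathcal{P}^\circ:=\{u\in\mathcal{C}^1(\overline\Omega):u>0\text{ on }\overline\Omega\}$. $(H_0)$: $a$ changes sign and $\int_\Omega a<0$. $\Omega_+$ is the largest open subset of $\Omega$ where $a>0$ a.e.; $(H_1')$: $\Omega_+$ is connected and $|(\mathrm{supp}\,a^+)\setminus\Omega_+|=0$. For an open set $G\subseteq\Omega$ and $\sigma>0$, $G_\sigma:=\{x\in G:\mathrm{dist}(x,\partial G)>\sigma\}$. *)

theory Defs
  imports "HOL-Analysis.Analysis"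
begin

definition pd :: "'n::finite \<Rightarrow> (real^'n \<Rightarrow> real) \<Rightarrow> real^'n \<Rightarrow> real" where
  "pd i f x = deriv (\<lambda>t. f (x + t *\<^sub>R axis i 1)) 0"

definition grad :: "(real^'n::finite \<Rightarrow> real) \<Rightarrow> real^'n \<Rightarrow> real^'n" where
  "grad f x = (\<chi> i. pd i f x)"

fun Ck :: "nat \<Rightarrow> (real^'n::finite \<Rightarrow> real) \<Rightarrow> bool" where
  "Ck 0 f = continuous_on UNIV f"
| "Ck (Suc k) f = (continuous_on UNIV f \<and>
      (\<forall>i x. (\<lambda>t. f (x + t *\<^sub>R axis i 1)) differentiable (at 0)) \<and>
      (\<forall>i. Ck k (pd i f)))"

definition smooth_fun :: "(real^'n::finite \<Rightarrow> real) \<Rightarrow> bool" where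
  "smooth_fun f \<longleftrightarrow> (\<forall>k. Ck k f)"

definition defining_function :: "(real^'n::finite) set \<Rightarrow> (real^'n \<Rightarrow> real) \<Rightarrow> bool" where
  "defining_function \<Omega> \<rho> \<longleftrightarrow> smooth_fun \<rho> \<and> \<Omega> = {x. \<rho> x < 0} \<and>
     (\<forall>x. \<rho> x = 0 \<longrightarrow> grad \<rho> x \<noteq> 0)"

definition smooth_bounded_domain :: "(real^'n::finite) set \<Rightarrow> bool" where
  "smooth_bounded_domain \<Omega> \<longleftrightarrow> open \<Omega> \<and> connected \<Omega> \<and> \<Omega> \<noteq> {} \<and> bounded \<Omega> \<and>
     (\<exists>\<rho>. defining_function \<Omega> \<rho>)"

text \<open>Outward unit normal (independent of the choice of defining function).\<close>
definition outer_normal :: "(real^'n::finite) set \<Rightarrow> real^'n \<Rightarrow> real^'n" where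
  "outer_normal \<Omega> x = (SOME \<nu>. \<exists>\<rho>. defining_function \<Omega> \<rho> \<and>
       \<nu> = (1 / norm (grad \<rho> x)) *\<^sub>R grad \<rho> x)"

definition inner_set :: "(real^'n::finite) set \<Rightarrow> real \<Rightarrow> (real^'n) set" where
  "inner_set G \<sigma> = {x \<in> G. infdist x (frontier G) > \<sigma>}"

definition Lp_on :: "(real^'n::finite) set \<Rightarrow> real \<Rightarrow> (real^'n \<Rightarrow> real) \<Rightarrow> bool" where
  "Lp_on \<Omega> p f \<longleftrightarrow> f \<in> borel_measurable (lebesgue_on \<Omega>) \<and>
     set_integrable lebesgue \<Omega> (\<lambda>x. \<bar>f x\<bar> powr p)"

definition Linf_on :: "(real^'n::finite) set \<Rightarrow> (real^'n \<Rightarrow> real) \<Rightarrow> bool" where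
  "Linf_on \<Omega> f \<longleftrightarrow> f \<in> borel_measurable (lebesgue_on \<Omega>) \<and>
     (\<exists>C. AE x in lebesgue. x \<in> \<Omega> \<longrightarrow> \<bar>f x\<bar> \<le> C)"

definition test_fun :: "(real^'n::finite) set \<Rightarrow> (real^'n \<Rightarrow> real) \<Rightarrow> bool" where
  "test_fun \<Omega> \<phi> \<longleftrightarrow> smooth_fun \<phi> \<and> compact (closure {x. \<phi> x \<noteq> 0}) \<and>
     closure {x. \<phi> x \<noteq> 0} \<subseteq> \<Omega>"

definition weak_pd :: "(real^'n::finite) set \<Rightarrow> 'n \<Rightarrow> (real^'n \<Rightarrow> real) \<Rightarrow> (real^'n \<Rightarrow> real) \<Rightarrow> bool" where
  "weak_pd \<Omega> i u v \<longleftrightarrow> (\<forall>\<phi>. test_fun \<Omega> \<phi> \<longrightarrow>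
     (LINT x:\<Omega>|lebesgue. u x * pd i \<phi> x) = - (LINT x:\<Omega>|lebesgue. v x * \<phi> x))"

definition W2p_derivs :: "(real^'n::finite) set \<Rightarrow> real \<Rightarrow> (real^'n \<Rightarrow> real)
    \<Rightarrow> ('n \<Rightarrow> real^'n \<Rightarrow> real) \<Rightarrow> ('n \<Rightarrow> 'n \<Rightarrow> real^'n \<Rightarrow> real) \<Rightarrow> bool" where
  "W2p_derivs \<Omega> p u D D2 \<longleftrightarrow> Lp_on \<Omega> p u \<and>
     (\<forall>i. Lp_on \<Omega> p (D i) \<and> weak_pd \<Omega> i u (D i) \<and>
        (\<forall>j. Lp_on \<Omega> p (D2 i j) \<and> weak_pd \<Omega> j (D i) (D2 i j)))"

definition C1_closure_grad :: "(real^'n::finite) set \<Rightarrow> (real^'n \<Rightarrow> real) \<Rightarrow> (real^'n \<Rightarrow> real^'n) \<Rightarrow> bool" where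
  "C1_closure_grad \<Omega> u g \<longleftrightarrow> continuous_on (closure \<Omega>) u \<and> continuous_on (closure \<Omega>) g \<and>
     (\<forall>x\<in>\<Omega>. (u has_derivative (\<lambda>h. g x \<bullet> h)) (at x))"

definition P_interior :: "(real^'n::finite) set \<Rightarrow> (real^'n \<Rightarrow> real) \<Rightarrow> bool" where
  "P_interior \<Omega> u \<longleftrightarrow> (\<exists>g. C1_closure_grad \<Omega> u g) \<and> (\<forall>x\<in>closure \<Omega>. u x > 0)"

text \<open>Nonnegative solution of -\<Delta>u = a u^q in \<Omega>, du/d\<nu> = 0 on \<partial>\<Omega>, in W^{2,r}(\<Omega>).
  Since r > N, W^{2,r}(\<Omega>) \<subseteq> C^1(closure \<Omega>), and u denotes its C^1 representative.\<close>
definition nonneg_solution :: "(real^'n::finite) set \<Rightarrow> real \<Rightarrow> (real^'n \<Rightarrow> real) \<Rightarrow> real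
    \<Rightarrow> (real^'n \<Rightarrow> real) \<Rightarrow> bool" where
  "nonneg_solution \<Omega> r a q u \<longleftrightarrow>
     (\<exists>D D2. W2p_derivs \<Omega> r u D D2 \<and>
        (AE x in lebesgue. x \<in> \<Omega> \<longrightarrow> - (\<Sum>i\<in>UNIV. D2 i i x) = a x * u x powr q)) \<and>
     (\<exists>g. C1_closure_grad \<Omega> u g \<and> (\<forall>x\<in>frontier \<Omega>. g x \<bullet> outer_normal \<Omega> x = 0)) \<and>
     (\<forall>x\<in>closure \<Omega>. u x \<ge> 0)"

definition nontrivial :: "(real^'n::finite) set \<Rightarrow> (real^'n \<Rightarrow> real) \<Rightarrow> bool" where
  "nontrivial \<Omega> u \<longleftrightarrow> (\<exists>x\<in>\<Omega>. u x \<noteq> 0)"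

definition ess_supp :: "(real^'n::finite) set \<Rightarrow> (real^'n \<Rightarrow> real) \<Rightarrow> (real^'n) set" where
  "ess_supp \<Omega> f = \<Omega> - \<Union>{U. open U \<and> (AE x in lebesgue. x \<in> U \<inter> \<Omega> \<longrightarrow> f x = 0)}"

definition H0 :: "(real^'n::finite) set \<Rightarrow> (real^'n \<Rightarrow> real) \<Rightarrow> bool" where
  "H0 \<Omega> a \<longleftrightarrow> {x\<in>\<Omega>. a x > 0} \<notin> null_sets lebesgue \<and> {x\<in>\<Omega>. a x < 0} \<notin> null_sets lebesgue \<and>
     (LINT x:\<Omega>|lebesgue. a x) < 0"

definition Omega_plus :: "(real^'n::finite) set \<Rightarrow> (real^'n \<Rightarrow> real) \<Rightarrow> (real^'n) set" where
  "Omega_plus \<Omega> a = \<Union>{U. open U \<and> U \<subseteq> \<Omega> \<and> (AE x in lebesgue. x \<in> U \<longrightarrow> a x > 0)}"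

definition H1' :: "(real^'n::finite) set \<Rightarrow> (real^'n \<Rightarrow> real) \<Rightarrow> bool" where
  "H1' \<Omega> a \<longleftrightarrow> connected (Omega_plus \<Omega> a) \<and>
     ess_supp \<Omega> (\<lambda>x. max (a x) 0) - Omega_plus \<Omega> a \<in> null_sets lebesgue"

end

theory Submission
  imports Defs
begin

text \<open>
  Everything rests on comparison with explicit barriers.  A weak solution is turned into a viscosity
  one: if a smooth function touches it from below at a point, the Laplacian of that function there is
  at most the essential supremum of the weak Laplacian nearby.

  (i) On \<open>\<Omega>\<^sub>+\<close> the solution is superharmonic; it cannot vanish there, since otherwise it would be
  subharmonic in \<open>\<Omega>\<close> and zero near \<open>\<partial>\<Omega>\<close>.  Positivity spreads through the connected set \<open>\<Omega>\<^sub>+\<close>, and a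
  barrier \<open>exp (-\<alpha>\<rho>) - 1\<close> built from a defining function \<open>\<rho>\<close> carries it to \<open>\<partial>\<Omega>\<close>, because the
  Neumann condition rules out a boundary minimum of the difference.

  (ii) With \<open>M = max u\<close> and \<open>\<mu> = \<delta> M\<^bsup>q-1\<^esup>\<close> the function \<open>w = (1 - u/M) / \<mu>\<close> satisfies \<open>\<Delta>w \<le> \<parallel>b1\<parallel>/\<delta>\<close> in \<open>\<Omega>\<close>
  and is bounded below on a ball in \<open>G\<close>, uniformly as long as \<open>\<mu>\<close> stays bounded.  For large \<open>\<delta>\<close> the
  spreading argument of (i) would make \<open>w\<close> positive on the closure of \<open>\<Omega>\<close>, contradicting \<open>min w = 0\<close>; so
  \<open>\<mu>\<close> is large.  Then \<open>C |x - x\<^sub>1|\<^bsup>2/(1-q)\<^esup>\<close> is a supersolution around every \<open>x\<^sub>1\<close> in \<open>G\<^sub>\<sigma>\<close>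
  dominating \<open>u\<close>, which forces \<open>u(x\<^sub>1) = 0\<close>.
\<close>

section \<open>Smooth functions and bumps\<close>

text \<open>Solutions have second derivatives only almost everywhere, so at a minimum of the
  difference with a barrier their Laplacian cannot be evaluated. Contact from below puts the second
  derivatives on the barrier instead.

  For q < 1 the nonlinearity is not Lipschitz at 0: where a is negative no strong maximum principle
  holds for u, and dead cores are exactly its failure. Positivity is therefore propagated only for
  functions whose Laplacian is bounded above by a small constant: u itself on
  \<open>Omega_plus\<close>, and in (ii) the gap between u and its maximum.

  In (ii) no bound on M uniform in \<delta> and q is at hand. With v = u/M the equation becomes
  -\<Delta>v = M^(q-1) a v^q, so the strength of absorption is governed by \<mu> alone. Dividing 1 -
  v by \<mu> gives \<Delta>w = (b1/\<delta> - b2) v^q: for large \<delta> the b1 term is small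
  uniformly in q, while the b2 term keeps its order as long as v \<ge> 1/2. For this all spreading
  constants must be fixed before the function is.\<close>

text \<open>The functions exp(-1/t) p(1/t), extended by 0, are closed under differentiation, whereas
  exp(-1/t) alone is not. Carrying the polynomial along turns smoothness into an induction on the
  order.\<close>

definition exp_tail :: "real poly \<Rightarrow> real \<Rightarrow> real" where
  "exp_tail p t = (if t > 0 then poly p (1 / t) * exp (- (1 / t)) else 0)"

lemma exp_tail_tendsto_0: "((\<lambda>t. poly p (1 / t) * exp (- (1 / t))) \<longlongrightarrow> (0::real)) (at_right 0)"
proof -
  have "((\<lambda>s. \<Sum>i\<le>degree p. coeff p i * (s ^ i / exp s)) \<longlongrightarrow> (\<Sum>i\<le>degree p. coeff p i * 0)) (at_top :: real filter)"
    by (intro tendsto_sum tendsto_mult tendsto_const tendsto_power_div_exp_0)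
  moreover have "(\<Sum>i\<le>degree p. coeff p i * (s ^ i / exp s)) = poly p s * exp (- s)" for s :: real
    by (simp add: poly_altdef sum_distrib_right exp_minus divide_inverse mult.assoc)
  ultimately have "((\<lambda>s. poly p s * exp (- s)) \<longlongrightarrow> 0) (at_top :: real filter)"
    by simp
  moreover have "filterlim (\<lambda>t::real. 1 / t) at_top (at_right 0)"
    using filterlim_inverse_at_top_right by (simp add: inverse_eq_divide)
  ultimately show ?thesis
    by (rule filterlim_compose)
qed

text \<open>With s = 1/t one has ds/dt = -s^2, so p(s) exp(-s) has derivative s^2 (p(s) - p'(s))
  exp(-s).\<close>

lemma exp_tail_has_derivative:
  "(exp_tail p has_real_derivative exp_tail (monom 1 2 * (p - pderiv p)) t) (at t)"
proof -
  consider "t > 0" | "t < 0" | "t = 0" by linarith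
  then show ?thesis
  proof cases
    case 1
    have "((\<lambda>t. poly p (1 / t) * exp (- (1 / t))) has_real_derivative
        exp_tail (monom 1 2 * (p - pderiv p)) t) (at t)"
      using 1 by (auto intro!: derivative_eq_intros DERIV_chain'[OF _ poly_DERIV]
          simp: exp_tail_def poly_monom field_simps power2_eq_square)
    then show ?thesis
      using 1 by (rule_tac has_field_derivative_transform_within_open[where S = "{0<..}"])
        (auto simp: exp_tail_def)
  next
    case 2
    then show ?thesis
      by (rule_tac has_field_derivative_transform_within_open[where f = "\<lambda>_. 0" and S = "{..<0}"])
        (auto simp: exp_tail_def)
  next
    case 3
    \<comment> \<open>For h > 0 division by h multiplies the polynomial by its argument 1/h, so the
      quotient belongs to \<open>pCons 0 p\<close> and the same limit applies.\<close>
    have r: "((\<lambda>h. exp_tail p h / h) \<longlongrightarrow> 0) (at_right 0)"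
      by (rule Lim_transform_eventually[OF exp_tail_tendsto_0[of "pCons 0 p"]])
        (auto simp: exp_tail_def eventually_at_right_field intro!: exI[of _ 1])
    have l: "((\<lambda>h. exp_tail p h / h) \<longlongrightarrow> 0) (at_left 0)"
      by (rule Lim_transform_eventually[OF tendsto_const])
        (auto simp: exp_tail_def eventually_at_left_field intro!: exI[of _ "-1"])
    have "((\<lambda>h. exp_tail p h / h) \<longlongrightarrow> 0) (at 0)"
      using l r by (simp add: filterlim_at_split)
    then show ?thesis
      using 3 by (simp add: DERIV_def exp_tail_def)
  qed
qed

section \<open>Partial derivatives and closure properties of \<open>Ck\<close>\<close>

lemma pd_eqI:
  "((\<lambda>t. f (x + t *\<^sub>R axis i 1)) has_real_derivative D) (at 0) \<Longrightarrow> pd i f x = D"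
  unfolding pd_def by (rule DERIV_imp_deriv)

lemma Ck_imp_continuous: "Ck k f \<Longrightarrow> continuous_on UNIV f"
  by (cases k) auto

lemma Ck_Suc_has_pd:
  assumes "Ck (Suc k) f"
  shows "((\<lambda>t. f (x + t *\<^sub>R axis i 1)) has_real_derivative pd i f x) (at 0)"
  using assms unfolding pd_def by (simp add: DERIV_deriv_iff_real_differentiable)

lemma Ck_Suc_has_pd_line:
  assumes "Ck (Suc k) f"
  shows "((\<lambda>t. f (x + t *\<^sub>R axis i 1)) has_real_derivative pd i f (x + s *\<^sub>R axis i 1)) (at s)"
proof -
  have "((\<lambda>t. f ((x + s *\<^sub>R axis i 1) + t *\<^sub>R axis i 1)) has_real_derivative
      pd i f (x + s *\<^sub>R axis i 1)) (at 0)"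
    by (rule Ck_Suc_has_pd[OF assms])
  then have "((\<lambda>t. f (x + (t + s) *\<^sub>R axis i 1)) has_real_derivative
      pd i f (x + s *\<^sub>R axis i 1)) (at 0)"
    by (simp add: algebra_simps)
  then show ?thesis
    using DERIV_shift[of "\<lambda>t. f (x + t *\<^sub>R axis i 1)" _ 0 s] by simp
qed

text \<open>\<open>Ck\<close> recurses through \<open>pd\<close>, a \<open>deriv\<close> that has a
  value even where no derivative exists. Exhibiting the derivatives \<open>D\<close> settles
  existence and identity at once.\<close>

lemma Ck_SucI:
  assumes "continuous_on UNIV f"
    and "\<And>i x. ((\<lambda>t. f (x + t *\<^sub>R axis i 1)) has_real_derivative D i x) (at 0)"
    and "\<And>i. Ck k (D i)"
  shows "Ck (Suc k) f"
proof -
  have "pd i f = D i" for i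
    using pd_eqI[OF assms(2)] by blast
  then show ?thesis
    using assms by (auto simp: real_differentiable_def)
qed

lemma Ck_SucD: "Ck (Suc k) f \<Longrightarrow> Ck k f"
  by (induction k arbitrary: f) auto

lemma Ck_const: "Ck k (\<lambda>_. c)"
proof (induction k arbitrary: c)
  case (Suc k)
  show ?case by (rule Ck_SucI[where D = "\<lambda>_ _. 0"]) (use Suc in \<open>auto intro: continuous_intros\<close>)
qed auto

lemma Ck_add:
  assumes "Ck k f" "Ck k g"
  shows "Ck k (\<lambda>x. f x + g x)"
  using assms
proof (induction k arbitrary: f g)
  case (Suc k)
  show ?case
  proof (rule Ck_SucI[where D = "\<lambda>i x. pd i f x + pd i g x"])
    show "((\<lambda>t. f (x + t *\<^sub>R axis i 1) + g (x + t *\<^sub>R axis i 1)) has_real_derivative pd i f x + pd i g x) (at 0)"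
      for i x by (intro DERIV_add Ck_Suc_has_pd[OF Suc.prems(1)] Ck_Suc_has_pd[OF Suc.prems(2)])
  qed (use Suc in \<open>auto intro: continuous_intros\<close>)
qed (auto intro: continuous_intros)

lemma Ck_mult:
  assumes "Ck k f" "Ck k g"
  shows "Ck k (\<lambda>x. f x * g x)"
  using assms
proof (induction k arbitrary: f g)
  case (Suc k)
  show ?case
  proof (rule Ck_SucI[where D = "\<lambda>i x. pd i f x * g x + pd i g x * f x"])
    show "((\<lambda>t. f (x + t *\<^sub>R axis i 1) * g (x + t *\<^sub>R axis i 1)) has_real_derivative
        pd i f x * g x + pd i g x * f x) (at 0)"
      for i x using DERIV_mult[OF Ck_Suc_has_pd[OF Suc.prems(1)] Ck_Suc_has_pd[OF Suc.prems(2)], of x i x i]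
      by simp
    show "Ck k (\<lambda>x. pd i f x * g x + pd i g x * f x)" for i
      using Suc.prems Ck_SucD by (intro Ck_add Suc.IH) auto
  qed (use Suc in \<open>auto intro: continuous_intros\<close>)
qed (auto intro: continuous_intros)

lemma Ck_prod:
  assumes "finite S" "\<And>j. j \<in> S \<Longrightarrow> Ck k (f j)"
  shows "Ck k (\<lambda>x. \<Prod>j\<in>S. f j x)"
  using assms by (induction S rule: finite_induct) (auto intro: Ck_const Ck_mult)

lemma Ck_shift: "Ck k f \<Longrightarrow> Ck k (\<lambda>x. f (x - c))"
proof (induction k arbitrary: f)
  case 0
  then show ?case by (auto intro!: continuous_intros continuous_on_compose2[of UNIV f])
next
  case (Suc k)
  show ?case
  proof (rule Ck_SucI[where D = "\<lambda>i x. pd i f (x - c)"])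
    show "((\<lambda>t. f (x + t *\<^sub>R axis i 1 - c)) has_real_derivative pd i f (x - c)) (at 0)" for i x
      using Ck_Suc_has_pd[OF Suc.prems, of "x - c" i] by (simp add: algebra_simps)
    show "continuous_on UNIV (\<lambda>x. f (x - c))"
      using Ck_imp_continuous[OF Suc.prems] by (auto intro!: continuous_intros continuous_on_compose2[of UNIV f])
  qed (use Suc in auto)
qed

lemma pd_shift: "pd i (\<lambda>x. f (x - c)) x = pd i f (x - c)"
  unfolding pd_def by (simp add: algebra_simps)

lemma continuous_exp_tail: "continuous_on S (exp_tail p)"
  by (intro continuous_at_imp_continuous_on ballI DERIV_isCont[OF exp_tail_has_derivative])

text \<open>The induction generalises \<open>p\<close>, since each differentiation changes the
  polynomial. The affine argument covers both signs of a coordinate.\<close>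

lemma Ck_exp_tail:
  fixes j :: "'n::finite"
  shows "Ck k (\<lambda>x::real^'n. exp_tail p (c + s * x $ j))"
proof (induction k arbitrary: p)
  case 0
  show ?case
    unfolding Ck.simps
    by (rule continuous_on_compose2[OF continuous_exp_tail]) (auto intro!: continuous_intros)
next
  case (Suc k)
  let ?p = "monom 1 2 * (p - pderiv p)"
  show ?case
  proof (rule Ck_SucI[where D = "\<lambda>i x. (if i = j then s else 0) * exp_tail ?p (c + s * x $ j)"])
    fix i and x :: "real^'n"
    have "((\<lambda>t. c + s * (x + t *\<^sub>R axis i 1) $ j) has_real_derivative (if i = j then s else 0)) (at 0)"
      by (auto intro!: derivative_eq_intros simp: axis_def)
    then show "((\<lambda>t. exp_tail p (c + s * (x + t *\<^sub>R axis i 1) $ j)) has_real_derivative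
        (if i = j then s else 0) * exp_tail ?p (c + s * x $ j)) (at 0)"
      using DERIV_chain2[where f = "exp_tail p" and g = "\<lambda>t. c + s * (x + t *\<^sub>R axis i 1) $ j" and x = 0,
          OF exp_tail_has_derivative]
      by (simp add: mult.commute)
  next
    show "continuous_on UNIV (\<lambda>x::real^'n. exp_tail p (c + s * x $ j))"
      by (rule continuous_on_compose2[OF continuous_exp_tail]) (auto intro!: continuous_intros)
    show "Ck k (\<lambda>x::real^'n. (if i = j then s else 0) * exp_tail ?p (c + s * x $ j))" for i
      by (rule Ck_mult[OF Ck_const Suc.IH])
  qed
qed

section \<open>A smooth bump with compact support\<close>

text \<open>A coordinate factor is positive exactly for |x_j| < \<eta>, so the support is a cube,
  and smoothness needs only the product rule and never a derivative of the norm. The factors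
  \<open>1 *\<close> and \<open>(-1) *\<close> fit the shape of \<open>Ck_exp_tail\<close>. The mass
  is not normalised to 1.\<close>

definition bump :: "real \<Rightarrow> real^'n::finite \<Rightarrow> real" where
  "bump \<eta> x = (\<Prod>j\<in>UNIV. exp_tail 1 (\<eta> + 1 * x $ j) * exp_tail 1 (\<eta> + (-1) * x $ j))"

lemma smooth_bump: "smooth_fun (bump \<eta>)"
  unfolding smooth_fun_def bump_def[abs_def]
  by (rule allI, rule Ck_prod, simp, rule Ck_mult; rule Ck_exp_tail)

lemma bump_nonneg: "bump \<eta> x \<ge> 0"
  unfolding bump_def by (auto intro!: prod_nonneg simp: exp_tail_def)

lemma bump_pos: "\<eta> > 0 \<Longrightarrow> bump \<eta> 0 > 0"
  unfolding bump_def by (auto intro!: prod_pos simp: exp_tail_def)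

lemma bump_support:
  fixes x :: "real^'n::finite"
  assumes "bump \<eta> x \<noteq> 0"
  shows "norm x \<le> real CARD('n) * \<eta>"
proof -
  have "\<bar>x $ j\<bar> \<le> \<eta>" for j
    using assms unfolding bump_def by (auto simp: exp_tail_def split: if_splits dest: spec[of _ j])
  then have "(\<Sum>j\<in>UNIV. \<bar>x $ j\<bar>) \<le> (\<Sum>j\<in>(UNIV::'n set). \<eta>)"
    by (intro sum_mono)
  then show ?thesis
    using norm_le_l1_cart[of x] by simp
qed

text \<open>The increment is built up one coordinate at a time. Each step is a one-dimensional mean
  value whose intermediate point is close to x, where continuity lets the partial derivative be
  replaced by its value at x.\<close>

lemma Ck_Suc_0_has_derivative:
  fixes f :: "real^'n::finite \<Rightarrow> real"
  assumes f: "Ck (Suc 0) f"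
  shows "(f has_derivative (\<lambda>h. grad f x \<bullet> h)) (at x)"
proof -
  let ?h = "\<lambda>S h. \<Sum>i\<in>S. (h $ i) *\<^sub>R axis i (1::real)"
  have norm_h: "norm (?h S h) \<le> real CARD('n) * norm h" for S :: "'n set" and h
  proof -
    have "norm (?h S h) \<le> (\<Sum>i\<in>S. norm h)"
      by (rule sum_norm_le) (simp add: component_le_norm_cart)
    also have "\<dots> \<le> real CARD('n) * norm h"
      by (simp add: card_mono mult_right_mono)
    finally show ?thesis .
  qed
  have key: "\<exists>d>0. \<forall>h. norm h < d \<longrightarrow>
      \<bar>f (x + ?h S h) - f x - (\<Sum>i\<in>S. pd i f x * h $ i)\<bar> \<le> e * card S * norm h"
    if e: "e > 0" and fin: "finite S" for e :: real and S
    using fin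
  proof (induction S rule: finite_induct)
    case empty
    show ?case by (auto intro: exI[of _ 1])
  next
    case (insert j S)
    then obtain d where d: "d > 0" and *: "\<And>h. norm h < d \<Longrightarrow>
      \<bar>f (x + ?h S h) - f x - (\<Sum>i\<in>S. pd i f x * h $ i)\<bar> \<le> e * card S * norm h" by blast
    have "continuous_on UNIV (pd j f)" using f by simp
    then have "continuous (at x) (pd j f)" by (simp add: continuous_on_eq_continuous_at)
    then obtain d' where d': "d' > 0" and **: "\<And>y. dist y x < d' \<Longrightarrow> \<bar>pd j f y - pd j f x\<bar> < e"
      using e unfolding continuous_at_eps_delta dist_real_def by blast
    \<comment> \<open>The intermediate point is at distance at most (CARD + 1) |h| from x: the
      coordinates already moved contribute at most CARD |h|, the present one at most |h|.\<close>
    let ?d = "min d (d' / (real CARD('n) + 1))"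
    show ?case
    proof (intro exI conjI allI impI)
      show "?d > 0" using d d' by auto
      fix h :: "real^'n" assume h: "norm h < ?d"
      define y where "y = x + ?h S h"
      obtain \<theta> where \<theta>: "\<bar>\<theta>\<bar> \<le> \<bar>h $ j\<bar>"
        "f (y + h $ j *\<^sub>R axis j 1) - f y = h $ j * pd j f (y + \<theta> *\<^sub>R axis j 1)"
      proof -
        have D: "((\<lambda>t. f (y + t *\<^sub>R axis j 1)) has_real_derivative pd j f (y + s *\<^sub>R axis j 1)) (at s)" for s
          by (rule Ck_Suc_has_pd_line[OF f])
        consider "h $ j > 0" | "h $ j < 0" | "h $ j = 0" by linarith
        then show thesis
        proof cases
          case 1
          then obtain z where "0 < z" "z < h $ j"
              "f (y + h $ j *\<^sub>R axis j 1) - f (y + 0 *\<^sub>R axis j 1) = (h $ j - 0) * pd j f (y + z *\<^sub>R axis j 1)"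
            using MVT2[OF _ D, of 0 "h $ j"] by blast
          then show thesis using that[of z] by auto
        next
          case 2
          then obtain z where "h $ j < z" "z < 0"
              "f (y + 0 *\<^sub>R axis j 1) - f (y + h $ j *\<^sub>R axis j 1) = (0 - h $ j) * pd j f (y + z *\<^sub>R axis j 1)"
            using MVT2[OF _ D, of "h $ j" 0] by blast
          then show thesis using that[of z] by auto
        next
          case 3
          then show thesis using that[of 0] by auto
        qed
      qed
      have "dist (y + \<theta> *\<^sub>R axis j 1) x \<le> norm (?h S h) + \<bar>\<theta>\<bar>"
        unfolding y_def dist_norm using norm_triangle_ineq[of "?h S h" "\<theta> *\<^sub>R axis j 1"] by simp
      also have "\<dots> \<le> (real CARD('n) + 1) * norm h"
        using norm_h[of h S] \<theta>(1) component_le_norm_cart[of h j] by (simp add: algebra_simps)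
      also have "\<dots> < d'" using h by (simp add: field_simps)
      finally have "\<bar>pd j f (y + \<theta> *\<^sub>R axis j 1) - pd j f x\<bar> < e" by (rule **)
      then have A: "\<bar>h $ j * (pd j f (y + \<theta> *\<^sub>R axis j 1) - pd j f x)\<bar> \<le> norm h * e"
        unfolding abs_mult by (intro mult_mono) (auto simp: component_le_norm_cart)
      have B: "\<bar>f y - f x - (\<Sum>i\<in>S. pd i f x * h $ i)\<bar> \<le> e * card S * norm h"
        unfolding y_def using h by (intro *) auto
      have xy: "x + ?h (insert j S) h = y + h $ j *\<^sub>R axis j 1"
        using insert.hyps by (simp add: y_def algebra_simps)
      have "f (x + ?h (insert j S) h) - f x - (\<Sum>i\<in>insert j S. pd i f x * h $ i) =
          (f y - f x - (\<Sum>i\<in>S. pd i f x * h $ i)) + h $ j * (pd j f (y + \<theta> *\<^sub>R axis j 1) - pd j f x)"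
        unfolding xy using insert.hyps \<theta>(2) by (simp add: algebra_simps)
      then show "\<bar>f (x + ?h (insert j S) h) - f x - (\<Sum>i\<in>insert j S. pd i f x * h $ i)\<bar>
          \<le> e * card (insert j S) * norm h"
        using A B insert.hyps by (simp add: algebra_simps)
    qed
  qed
  show ?thesis
    unfolding has_derivative_at_alt
  proof (intro conjI allI impI)
    show "bounded_linear (\<lambda>h. grad f x \<bullet> h)" by (rule bounded_linear_inner_right)
    fix e :: real assume e: "e > 0"
    let ?e = "e / real CARD('n)"
    obtain d where d: "d > 0" and *: "\<And>h. norm h < d \<Longrightarrow>
      \<bar>f (x + ?h UNIV h) - f x - (\<Sum>i\<in>UNIV. pd i f x * h $ i)\<bar> \<le> ?e * real CARD('n) * norm h"
      using key[of ?e UNIV] e by auto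
    have "norm (f y - f x - grad f x \<bullet> (y - x)) \<le> e * norm (y - x)" if "norm (y - x) < d" for y
    proof -
      have "?h UNIV (y - x) = y - x"
        using basis_expansion[of "y - x"] by (simp add: scalar_mult_eq_scaleR)
      then show ?thesis
        using *[OF that] by (simp add: inner_vec_def grad_def)
    qed
    then show "\<exists>d>0. \<forall>y. norm (y - x) < d \<longrightarrow> norm (f y - f x - grad f x \<bullet> (y - x)) \<le> e * norm (y - x)"
      using d by blast
  qed
qed

section \<open>From weak to viscosity inequalities\<close>

text \<open>A gradient is required near x, but its derivative A, the Hessian, only at x. This is
  enough for a second-order expansion at x, and it passes through scaling and the chain rule without
  any theory of C^2 functions.\<close>

definition jet2 :: "(real^'n \<Rightarrow> real) \<Rightarrow> (real^'n \<Rightarrow> real^'n) \<Rightarrow> (real^'n \<Rightarrow> real^'n) \<Rightarrow> real^'n::finite \<Rightarrow> bool" where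
  "jet2 \<psi> g A x \<longleftrightarrow>
     (\<forall>\<^sub>F y in nhds x. (\<psi> has_derivative (\<lambda>h. g y \<bullet> h)) (at y)) \<and> (g has_derivative A) (at x)"

definition trace_op :: "(real^'n \<Rightarrow> real^'n::finite) \<Rightarrow> real" where
  "trace_op A = (\<Sum>i\<in>UNIV. A (axis i 1) $ i)"

text \<open>The inequality \<open>\<Delta>w \<le> f\<close> on \<open>U\<close> in the viscosity sense.\<close>
definition lap_le :: "(real^'n::finite) set \<Rightarrow> (real^'n \<Rightarrow> real) \<Rightarrow> (real^'n \<Rightarrow> real) \<Rightarrow> bool" where
  "lap_le U w f \<longleftrightarrow> (\<forall>x\<in>U. \<forall>\<psi> g A. jet2 \<psi> g A x \<longrightarrow>
     (\<forall>\<^sub>F y in nhds x. w x - \<psi> x \<le> w y - \<psi> y) \<longrightarrow> trace_op A \<le> f x)"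

text \<open>Both derivatives fall on the test function, so the gradient of u does not appear.
  Integrability is included because the integrals would otherwise be default values.\<close>

definition weak_lap :: "(real^'n::finite) set \<Rightarrow> (real^'n \<Rightarrow> real) \<Rightarrow> (real^'n \<Rightarrow> real) \<Rightarrow> bool" where
  "weak_lap \<Omega> u F \<longleftrightarrow> continuous_on \<Omega> u \<and> set_integrable lebesgue \<Omega> u \<and> set_integrable lebesgue \<Omega> F \<and>
     (\<forall>\<phi>. test_fun \<Omega> \<phi> \<longrightarrow>
       (LINT x:\<Omega>|lebesgue. u x * (\<Sum>i\<in>UNIV. pd i (pd i \<phi>) x)) = (LINT x:\<Omega>|lebesgue. F x * \<phi> x))"

text \<open>The mean value theorem along the segment, applied to \<psi> minus its quadratic
  expansion, leaves only the linearisation error of g at x. The lower bound suffices because contact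
  is from below.\<close>

lemma jet2_lower_expansion:
  fixes x :: "real^'n::finite"
  assumes "jet2 \<psi> g A x" "\<kappa> > 0"
  obtains d where "d > 0" "\<And>y. norm (y - x) < d \<Longrightarrow>
    \<psi> y \<ge> \<psi> x + g x \<bullet> (y - x) + ((y - x) \<bullet> A (y - x)) / 2 - \<kappa> * (norm (y - x))\<^sup>2"
proof -
  from assms(1) obtain d1 where d1: "d1 > 0" "\<And>y. dist y x < d1 \<Longrightarrow> (\<psi> has_derivative (\<lambda>h. g y \<bullet> h)) (at y)"
    unfolding jet2_def eventually_nhds_metric by blast
  have gA: "(g has_derivative A) (at x)" using assms(1) by (simp add: jet2_def)
  then have bl: "bounded_linear A" by (rule has_derivative_bounded_linear)
  from gA assms(2) obtain d2 where d2: "d2 > 0"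
    "\<And>y. norm (y - x) < d2 \<Longrightarrow> norm (g y - g x - A (y - x)) \<le> \<kappa> * norm (y - x)"
    unfolding has_derivative_at_alt by blast
  show thesis
  proof (rule that[of "min d1 d2"])
    show "min d1 d2 > 0" using d1 d2 by simp
    fix y assume y: "norm (y - x) < min d1 d2"
    define h where "h = y - x"
    define k where "k t = \<psi> (x + t *\<^sub>R h) - t * (g x \<bullet> h) - t\<^sup>2 / 2 * (h \<bullet> A h)" for t
    have D: "(k has_real_derivative (g (x + t *\<^sub>R h) \<bullet> h - g x \<bullet> h - t * (h \<bullet> A h))) (at t)"
      if "0 \<le> t" "t \<le> 1" for t
    proof -
      have "norm (t *\<^sub>R h) \<le> 1 * norm h" unfolding norm_scaleR using that by (intro mult_right_mono) auto
      then have "dist (x + t *\<^sub>R h) x < d1" using y by (simp add: dist_norm h_def)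
      then have "((\<lambda>t. \<psi> (x + t *\<^sub>R h)) has_derivative (\<lambda>s. g (x + t *\<^sub>R h) \<bullet> (s *\<^sub>R h))) (at t)"
        by (intro has_derivative_compose[OF _ d1(2), where f = "\<lambda>t. x + t *\<^sub>R h"])
          (auto intro!: derivative_eq_intros)
      then have "((\<lambda>t. \<psi> (x + t *\<^sub>R h)) has_real_derivative (g (x + t *\<^sub>R h) \<bullet> h)) (at t)"
        by (simp add: has_field_derivative_def mult_commute_abs)
      then show ?thesis unfolding k_def by (auto intro!: derivative_eq_intros)
    qed
    obtain z where z: "0 < z" "z < 1" "k 1 - k 0 = (1 - 0) * (g (x + z *\<^sub>R h) \<bullet> h - g x \<bullet> h - z * (h \<bullet> A h))"
      using MVT2[of 0 1 k, OF _ D] by auto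
    have zh: "norm (z *\<^sub>R h) \<le> 1 * norm h" unfolding norm_scaleR using z by (intro mult_right_mono) auto
    then have "norm (g (x + z *\<^sub>R h) - g x - A (z *\<^sub>R h)) \<le> \<kappa> * norm (z *\<^sub>R h)"
      using d2(2)[of "x + z *\<^sub>R h"] y by (simp add: h_def)
    also have "\<dots> \<le> \<kappa> * norm h" using zh assms(2) by auto
    finally have "\<bar>(g (x + z *\<^sub>R h) - g x - A (z *\<^sub>R h)) \<bullet> h\<bar> \<le> (\<kappa> * norm h) * norm h"
      using Cauchy_Schwarz_ineq2[of "g (x + z *\<^sub>R h) - g x - A (z *\<^sub>R h)" h]
      by (meson mult_right_mono norm_ge_zero order_trans)
    moreover have "(g (x + z *\<^sub>R h) - g x - A (z *\<^sub>R h)) \<bullet> h = k 1 - k 0"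
      using z(3) bl by (simp add: inner_diff_left inner_diff_right linear_simps(5) bounded_linear.linear linear_cmul inner_commute)
    ultimately have "k 1 - k 0 \<ge> - \<kappa> * (norm h)\<^sup>2" by (simp add: power2_eq_square)
    then show "\<psi> y \<ge> \<psi> x + g x \<bullet> (y - x) + ((y - x) \<bullet> A (y - x)) / 2 - \<kappa> * (norm (y - x))\<^sup>2"
      by (simp add: k_def h_def)
  qed
qed

text \<open>The even function m(z + t e) + m(z - t e) has derivative 0 at t = 0, so its second-order
  Maclaurin expansion has no linear term.\<close>

lemma second_difference:
  fixes m :: "real^'n::finite \<Rightarrow> real"
  assumes m: "Ck (Suc (Suc 0)) m" and h: "h > 0"
  obtains t where "0 < t" "t < h"
    "m (z + h *\<^sub>R axis i 1) + m (z - h *\<^sub>R axis i 1) - 2 * m z =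
      h\<^sup>2 / 2 * (pd i (pd i m) (z + t *\<^sub>R axis i 1) + pd i (pd i m) (z + (-t) *\<^sub>R axis i 1))"
proof -
  let ?e = "axis i (1::real)"
  have m': "Ck (Suc 0) (pd i m)" using m by simp
  define D where "D = (\<lambda>k::nat. \<lambda>t. if k = 0 then m (z + t *\<^sub>R ?e) + m (z + (-t) *\<^sub>R ?e)
    else if k = 1 then pd i m (z + t *\<^sub>R ?e) - pd i m (z + (-t) *\<^sub>R ?e)
    else pd i (pd i m) (z + t *\<^sub>R ?e) + pd i (pd i m) (z + (-t) *\<^sub>R ?e))"
  have neg: "((\<lambda>t. f (z + (-t) *\<^sub>R ?e)) has_real_derivative - pd i f (z + (-t) *\<^sub>R ?e)) (at t)"
    if "Ck (Suc 0) f" for f and t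
    using DERIV_chain2[where f = "\<lambda>t. f (z + t *\<^sub>R ?e)" and g = uminus and x = t,
        OF Ck_Suc_has_pd_line[OF that] DERIV_minus[OF DERIV_ident]] by simp
  have 0: "(D 0 has_real_derivative D 1 t) (at t)" for t
    using DERIV_add[OF Ck_Suc_has_pd_line[OF m] neg[OF Ck_SucD[OF m]]] by (simp add: D_def)
  have 1: "(D 1 has_real_derivative D 2 t) (at t)" for t
    using DERIV_diff[OF Ck_Suc_has_pd_line[OF m'] neg[OF m']] by (simp add: D_def)
  have "\<forall>k t. k < 2 \<and> 0 \<le> t \<and> t \<le> h \<longrightarrow> (D k has_real_derivative D (Suc k) t) (at t)"
  proof (intro allI impI)
    fix k :: nat and t assume "k < 2 \<and> 0 \<le> t \<and> t \<le> h"
    then have "k = 0 \<or> k = 1" by auto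
    then show "(D k has_real_derivative D (Suc k) t) (at t)"
      using 0[of t] 1[of t] by (auto simp: numeral_2_eq_2)
  qed
  then obtain t where t: "0 < t" "t < h" "D 0 h = (\<Sum>k<2. D k 0 / fact k * h ^ k) + D 2 t / fact 2 * h ^ 2"
    using Maclaurin[OF h, of 2 D "D 0"] by auto
  then show thesis
    by (intro that[OF t(1,2)]) (simp add: D_def numeral_2_eq_2 lessThan_Suc)
qed

section \<open>Integration against a mollifier\<close>

lemma lborel_integral_translate:
  fixes f :: "'a::euclidean_space \<Rightarrow> real"
  assumes "f \<in> borel_measurable borel"
  shows "integral\<^sup>L lborel (\<lambda>y. f (c + y)) = integral\<^sup>L lborel f"
proof -
  have "integral\<^sup>L (distr lborel borel ((+) c)) f = integral\<^sup>L lborel (\<lambda>y. f (c + y))"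
    using assms by (intro integral_distr) auto
  then show ?thesis by (simp add: lborel_distr_plus)
qed

lemma lborel_integrable_translate:
  fixes f :: "'a::euclidean_space \<Rightarrow> real"
  assumes "integrable lborel f"
  shows "integrable lborel (\<lambda>y. f (c + y))"
proof -
  have "f \<in> borel_measurable borel" using borel_measurable_integrable[OF assms] by simp
  then have "integrable (distr lborel borel ((+) c)) f \<longleftrightarrow> integrable lborel (\<lambda>y. f (c + y))"
    by (intro integrable_distr_eq) auto
  then show ?thesis using assms by (simp add: lborel_distr_plus)
qed

lemma integral_pos_at:
  fixes m :: "'a::euclidean_space \<Rightarrow> real"
  assumes "continuous_on UNIV m" "\<And>x. m x \<ge> 0" "m 0 > 0" "integrable lborel m"
  shows "integral\<^sup>L lborel m > 0"
proof -
  have "continuous (at 0) m" using assms(1) by (simp add: continuous_on_eq_continuous_at)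
  then obtain d where d: "d > 0" "\<And>y. dist y 0 < d \<Longrightarrow> \<bar>m y - m 0\<bar> < m 0 / 2"
    using assms(3) unfolding continuous_at_eps_delta dist_real_def by (meson half_gt_zero)
  have *: "indicator (ball 0 d) y * (m 0 / 2) \<le> m y" for y
    using d(2)[of y] assms(2)[of y] by (auto simp: indicator_def dist_commute abs_if split: if_splits)
  have "0 < measure lborel (ball (0::'a) d) * (m 0 / 2)"
    using assms(3) content_ball_pos[OF d(1), of 0] by simp
  also have "\<dots> = (\<integral>y. indicator (ball (0::'a) d) y * (m 0 / 2) \<partial>lborel)"
    by simp
  also have "\<dots> \<le> integral\<^sup>L lborel m"
    using * assms(4)
    by (intro integral_mono integrable_mult_left integrable_real_indicator)
      (auto simp: emeasure_lborel_ball_finite[unfolded infinity_ennreal_def])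
  finally show ?thesis .
qed

lemma integrable_mult_support:
  fixes k m :: "'a::euclidean_space \<Rightarrow> real"
  assumes "continuous_on (cball 0 r) k" "continuous_on UNIV m" "\<And>y. m y \<noteq> 0 \<Longrightarrow> norm y \<le> r"
  shows "integrable lborel (\<lambda>y. k y * m y)"
proof -
  have "integrable lborel (\<lambda>y. indicator (cball 0 r) y *\<^sub>R (k y * m y))"
    using assms by (intro borel_integrable_compact continuous_intros) (auto intro: continuous_on_subset)
  moreover have "(\<lambda>y. indicator (cball 0 r) y *\<^sub>R (k y * m y)) = (\<lambda>y. k y * m y)"
    using assms(3) by (auto simp: indicator_def fun_eq_iff)
  ultimately show ?thesis by simp
qed

text \<open>On the sphere of radius R the function exceeds its central value by \<kappa> R^2.
  Averaging moves values by less than a third of this gap (times the mass of the bump), so the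
  averaged function cannot have its minimum over the closed ball on the sphere. The radius 2R leaves
  room for the shifts.\<close>

lemma mollified_has_interior_min:
  fixes q :: "real^'n::finite \<Rightarrow> real"
  assumes R: "R > 0" and \<kappa>: "\<kappa> > 0" and q: "continuous_on (cball x0 (2 * R)) q"
    and min: "\<And>x. x \<in> cball x0 (2 * R) \<Longrightarrow> q x \<ge> q x0 + \<kappa> * (dist x x0)\<^sup>2"
  obtains \<eta> x1 where "\<eta> > 0" "real CARD('n) * \<eta> \<le> R" "x1 \<in> ball x0 R"
    "\<And>x. x \<in> cball x0 R \<Longrightarrow> (\<integral>y. q (x1 + y) * bump \<eta> y \<partial>lborel) \<le> (\<integral>y. q (x + y) * bump \<eta> y \<partial>lborel)"
proof -
  let ?\<epsilon> = "\<kappa> * R\<^sup>2 / 3"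
  have \<epsilon>: "?\<epsilon> > 0" using R \<kappa> by simp
  have uc: "uniformly_continuous_on (cball x0 (2 * R)) q"
    using q by (rule compact_uniformly_continuous) simp
  then obtain d where d: "d > 0" "\<And>a b. a \<in> cball x0 (2 * R) \<Longrightarrow> b \<in> cball x0 (2 * R) \<Longrightarrow> dist a b < d \<Longrightarrow> \<bar>q a - q b\<bar> < ?\<epsilon>"
    using \<epsilon> unfolding uniformly_continuous_on_def dist_real_def by (metis dist_commute)
  \<comment> \<open>The support of the bump then has radius at most R, so shifts stay in the domain
    of q, and less than the modulus of continuity d.\<close>
  define \<eta> where "\<eta> = min (d / 2) R / real CARD('n)"
  have \<eta>: "\<eta> > 0" using d R by (simp add: \<eta>_def)
  let ?r = "real CARD('n) * \<eta>"
  have r: "?r \<le> R" "?r < d" "?r > 0" using d R \<eta> by (auto simp: \<eta>_def)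
  let ?m = "bump \<eta> :: real^'n \<Rightarrow> real"
  have mc: "continuous_on UNIV ?m" using smooth_bump[of \<eta>] unfolding smooth_fun_def using Ck_imp_continuous by blast
  define I where "I = integral\<^sup>L lborel ?m"
  have mi: "integrable lborel ?m"
    using integrable_mult_support[of ?r "\<lambda>_. 1" ?m] mc bump_support by auto
  have I: "I > 0" unfolding I_def
    using mc bump_nonneg bump_pos[OF \<eta>] mi by (rule integral_pos_at)
  define f where "f x = (\<integral>y. q (x + y) * ?m y \<partial>lborel)" for x
  have in_ball: "x + y \<in> cball x0 (2 * R)" if "x \<in> cball x0 R" "norm y \<le> ?r" for x y
  proof -
    have "dist x0 (x + y) \<le> dist x0 x + norm y"
      using norm_triangle_ineq4[of "x0 - x" y] by (simp add: dist_norm algebra_simps)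
    then show ?thesis using that r by auto
  qed
  have qi: "integrable lborel (\<lambda>y. q (x + y) * ?m y)" if "x \<in> cball x0 R" for x
  proof (rule integrable_mult_support[of ?r])
    show "continuous_on (cball 0 ?r) (\<lambda>y. q (x + y))"
      by (rule continuous_on_compose2[OF q]) (auto intro!: continuous_intros in_ball[OF that] simp del: cball_translation image_add_cball)
  qed (fact mc, rule bump_support)
  have diff: "f x \<le> f x' + e * I" if "x \<in> cball x0 R" "x' \<in> cball x0 R"
    "\<And>y. norm y \<le> ?r \<Longrightarrow> q (x + y) \<le> q (x' + y) + e" for x x' e
  proof -
    have "f x \<le> (\<integral>y. q (x' + y) * ?m y + e * ?m y \<partial>lborel)"
      unfolding f_def
    proof (rule integral_mono[OF qi[OF that(1)]])
      show "integrable lborel (\<lambda>y. q (x' + y) * ?m y + e * ?m y)"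
        using qi[OF that(2)] mi by simp
      show "q (x + y) * ?m y \<le> q (x' + y) * ?m y + e * ?m y" for y
        using that(3)[OF bump_support[of \<eta> y]] bump_nonneg[of \<eta> y]
        by (cases "?m y = 0") (auto simp: distrib_right[symmetric] intro: mult_right_mono)
    qed
    also have "\<dots> = f x' + e * I"
      unfolding f_def I_def using qi[OF that(2)] mi by (subst Bochner_Integration.integral_add) auto
    finally show ?thesis .
  qed
  have const: "(\<integral>y. c * ?m y \<partial>lborel) = c * I" for c
    by (simp add: I_def)
  have up: "f x \<le> c * I" if "x \<in> cball x0 R" "\<And>y. norm y \<le> ?r \<Longrightarrow> q (x + y) \<le> c" for x c
    unfolding f_def const[symmetric]
  proof (rule integral_mono[OF qi[OF that(1)]])
    show "q (x + y) * ?m y \<le> c * ?m y" for y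
      using that(2)[OF bump_support[of \<eta> y]] bump_nonneg[of \<eta> y]
      by (cases "?m y = 0") (auto intro: mult_right_mono)
  qed (use mi in simp)
  have low: "f x \<ge> c * I" if "x \<in> cball x0 R" "\<And>y. norm y \<le> ?r \<Longrightarrow> q (x + y) \<ge> c" for x c
    unfolding f_def const[symmetric]
  proof (rule integral_mono[OF _ qi[OF that(1)]])
    show "c * ?m y \<le> q (x + y) * ?m y" for y
      using that(2)[OF bump_support[of \<eta> y]] bump_nonneg[of \<eta> y]
      by (cases "?m y = 0") (auto intro: mult_right_mono)
  qed (use mi in simp)
  have cf: "continuous_on (cball x0 R) f"
    unfolding continuous_on_iff
  proof (intro ballI allI impI)
    fix x and e :: real assume x: "x \<in> cball x0 R" and e: "e > 0"
    then have "e / (2 * I) > 0" using I by simp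
    then obtain s where s: "s > 0" "\<And>a b. a \<in> cball x0 (2 * R) \<Longrightarrow> b \<in> cball x0 (2 * R) \<Longrightarrow> dist a b < s \<Longrightarrow> \<bar>q a - q b\<bar> < e / (2 * I)"
      using uc unfolding uniformly_continuous_on_def dist_real_def by (metis dist_commute)
    show "\<exists>s>0. \<forall>x'\<in>cball x0 R. dist x' x < s \<longrightarrow> dist (f x') (f x) < e"
    proof (intro exI[of _ s] conjI ballI impI)
      fix x' assume x': "x' \<in> cball x0 R" "dist x' x < s"
      have *: "\<bar>q (x + y) - q (x' + y)\<bar> < e / (2 * I)" if "norm y \<le> ?r" for y
        using x' in_ball[OF x that] in_ball[OF x'(1) that] by (intro s(2)) (auto simp: dist_commute)
      have "f x \<le> f x' + e / (2 * I) * I" using * by (intro diff x x'(1)) (smt (verit))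
      moreover have "f x' \<le> f x + e / (2 * I) * I" using * by (intro diff x x'(1)) (smt (verit))
      moreover have "e / (2 * I) * I = e / 2" using I by simp
      ultimately show "dist (f x') (f x) < e" using e by (simp add: dist_real_def)
    qed (rule s)
  qed
  obtain x1 where x1: "x1 \<in> cball x0 R" "\<And>x. x \<in> cball x0 R \<Longrightarrow> f x1 \<le> f x"
    using continuous_attains_inf[OF compact_cball _ cf] R by (auto simp: cball_eq_empty)
  have close: "\<bar>q (x + y) - q x\<bar> < ?\<epsilon>" if "x \<in> cball x0 R" "norm y \<le> ?r" for x y
    using in_ball[OF that] in_ball[OF that(1), of 0] that r by (intro d(2)) (auto simp: dist_norm)
  have x0: "x0 \<in> cball x0 R" using R by simp
  have "x1 \<in> ball x0 R"
  proof (rule ccontr)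
    assume "x1 \<notin> ball x0 R"
    then have e: "dist x1 x0 = R" using x1(1) by (auto simp: dist_commute)
    have "q x1 \<ge> q x0 + 3 * ?\<epsilon>" using min[of x1] e R by (auto simp: dist_commute)
    then have "f x1 \<ge> (q x0 + 2 * ?\<epsilon>) * I"
      using close[OF x1(1)] by (intro low[OF x1(1)]) (smt (verit))
    moreover have "f x0 \<le> (q x0 + ?\<epsilon>) * I"
      using close[OF x0] by (intro up[OF x0]) (smt (verit))
    moreover have "(q x0 + ?\<epsilon>) * I < (q x0 + 2 * ?\<epsilon>) * I"
      using I \<epsilon> by (intro mult_strict_right_mono) auto
    ultimately show False using x1(2)[OF x0] by linarith
  qed
  then show thesis using that \<eta> r(1) x1(2) unfolding f_def by blast
qed

section \<open>Test functions and limits of second differences\<close>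

lemma pd_eq_0:
  fixes f :: "real^'n::finite \<Rightarrow> real"
  assumes "open S" "x \<in> S" "\<And>y. y \<in> S \<Longrightarrow> f y = 0"
  shows "pd i f x = 0"
proof (rule pd_eqI)
  let ?l = "\<lambda>t. x + t *\<^sub>R axis i (1::real)"
  have "open (?l -` S)"
    by (intro open_vimage assms(1) continuous_intros)
  moreover have "0 \<in> ?l -` S" using assms(2) by simp
  ultimately show "((\<lambda>t. f (?l t)) has_real_derivative 0) (at 0)"
    by (rule has_field_derivative_transform_within_open[OF DERIV_const]) (simp add: assms(3))
qed

lemma pd_support: "{x. pd i f x \<noteq> 0} \<subseteq> closure {x. f x \<noteq> 0}"
proof
  fix x assume x: "x \<in> {x. pd i f x \<noteq> 0}"
  show "x \<in> closure {x. f x \<noteq> 0}"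
  proof (rule ccontr)
    assume "x \<notin> closure {x. f x \<noteq> 0}"
    then have 1: "x \<in> - closure {x. f x \<noteq> 0}" by simp
    have 0: "f y = 0" if "y \<in> - closure {x. f x \<noteq> 0}" for y
      using that closure_subset[of "{x. f x \<noteq> 0}"] by auto
    have "pd i f x = 0" by (rule pd_eq_0[OF open_Compl[OF closed_closure] 1 0])
    then show False using x by simp
  qed
qed

text \<open>Makes a partial derivative admissible in a weak derivative, so that integration by parts
  can be repeated.\<close>

lemma test_fun_pd:
  assumes "test_fun \<Omega> \<phi>"
  shows "test_fun \<Omega> (pd i \<phi>)"
proof -
  have sub: "closure {x. pd i \<phi> x \<noteq> 0} \<subseteq> closure {x. \<phi> x \<noteq> 0}"
    using pd_support[of i \<phi>] by (rule closure_minimal) simp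
  have "Ck k (pd i \<phi>)" for k
    using assms unfolding test_fun_def smooth_fun_def by (auto dest: spec[of _ "Suc k"])
  moreover have "bounded {x. pd i \<phi> x \<noteq> 0}"
    using assms pd_support[of i \<phi>] unfolding test_fun_def by (meson bounded_subset compact_imp_bounded)
  ultimately show ?thesis
    using assms sub unfolding test_fun_def smooth_fun_def by (auto simp: compact_closure)
qed

lemma bounded_of_compact_support:
  fixes f :: "'a::euclidean_space \<Rightarrow> real"
  assumes "continuous_on UNIV f" "\<And>x. f x \<noteq> 0 \<Longrightarrow> x \<in> S" "compact S"
  shows "\<exists>B\<ge>0. \<forall>x. \<bar>f x\<bar> \<le> B"
proof -
  have "compact (f ` S)" using assms by (intro compact_continuous_image continuous_on_subset[OF assms(1)]) auto
  then obtain B where B: "\<And>x. x \<in> S \<Longrightarrow> \<bar>f x\<bar> \<le> B"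
    using compact_imp_bounded[of "f ` S"] unfolding bounded_iff by auto
  then have "\<bar>f x\<bar> \<le> max 0 B" for x
    using assms(2)[of x] B[of x] by (cases "f x = 0") (auto simp: le_max_iff_disj)
  then show ?thesis by (intro exI[of _ "max 0 B"]) auto
qed

lemma integrable_mult_bounded:
  fixes v k :: "'a \<Rightarrow> real"
  assumes "integrable M v" "k \<in> borel_measurable M" "\<And>x. \<bar>k x\<bar> \<le> B"
  shows "integrable M (\<lambda>x. v x * k x)"
proof (rule Bochner_Integration.integrable_bound)
  show "integrable M (\<lambda>x. v x * B)" using assms(1) by simp
  show "(\<lambda>x. v x * k x) \<in> borel_measurable M" using assms by measurable
  have "\<bar>v x\<bar> * \<bar>k x\<bar> \<le> \<bar>v x\<bar> * B" for x by (intro mult_left_mono assms) auto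
  moreover have "\<bar>v x\<bar> * B \<le> \<bar>v x * B\<bar>" for x by (simp add: abs_mult mult_left_mono)
  ultimately show "AE x in M. norm (v x * k x) \<le> norm (v x * B)"
    by (auto simp: abs_mult intro: order_trans)
qed

text \<open>Divide by h^2 and let h tend to 0. \<open>second_difference\<close> supplies both the
  pointwise limit and the uniform bound for dominated convergence; the bound is finite because the
  second derivatives have compact support.\<close>

lemma mean_second_difference_limit:
  fixes m v :: "real^'n::finite \<Rightarrow> real"
  assumes m: "smooth_fun m" and mr: "\<And>y. m y \<noteq> 0 \<Longrightarrow> norm y \<le> r"
    and v: "integrable lborel v"
    and R: "R > 0" and le: "\<And>h. 0 < h \<Longrightarrow> h < R \<Longrightarrow>
      h\<^sup>2 * T \<le> (\<integral>z. v z * (\<Sum>i\<in>UNIV. m (z - x + h *\<^sub>R axis i 1) + m (z - x - h *\<^sub>R axis i 1) - 2 * m (z - x)) \<partial>lborel)"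
  shows "T \<le> (\<integral>z. v z * (\<Sum>i\<in>UNIV. pd i (pd i m) (z - x)) \<partial>lborel)"
proof -
  have m2: "Ck (Suc (Suc 0)) m" and mS: "\<And>k. Ck k m" using m by (auto simp: smooth_fun_def)
  have c2: "continuous_on UNIV (pd i (pd i m))" for i
    using m2 by simp
  have cm: "continuous_on UNIV m" using mS Ck_imp_continuous by blast
  have "\<exists>B. B \<ge> 0 \<and> (\<forall>y. \<bar>pd i (pd i m) y\<bar> \<le> B)" for i
  proof -
    have s: "{y. m y \<noteq> 0} \<subseteq> cball 0 r" using mr by auto
    have "{y. pd i m y \<noteq> 0} \<subseteq> cball 0 r"
      using pd_support[of i m] closure_minimal[OF s] by auto
    then have "{y. pd i (pd i m) y \<noteq> 0} \<subseteq> cball 0 r"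
      using pd_support[of i "pd i m"] closure_minimal[of _ "cball 0 r"] by blast
    then show ?thesis by (intro bounded_of_compact_support[OF c2 _ compact_cball[of 0 r]]) auto
  qed
  then obtain B where B: "\<And>i. B i \<ge> 0" "\<And>i y. \<bar>pd i (pd i m) y\<bar> \<le> B i" by metis
  \<comment> \<open>The summand 2 gives \<open>h n < R\<close> also for n = 0.\<close>
  define h where "h n = R / (real n + 2)" for n :: nat
  have h: "0 < h n" "h n < R" for n using R by (auto simp: h_def field_simps add_strict_increasing)
  have h0: "h \<longlonglongrightarrow> 0" unfolding h_def by real_asymp
  define s where "s n z = (\<Sum>i\<in>UNIV. m (z - x + h n *\<^sub>R axis i 1) + m (z - x - h n *\<^sub>R axis i 1) - 2 * m (z - x)) / (h n)\<^sup>2" for n z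
  have each: "\<bar>(m (z + h n *\<^sub>R axis i 1) + m (z - h n *\<^sub>R axis i 1) - 2 * m z) / (h n)\<^sup>2\<bar> \<le> B i"
    (is "\<bar>?d / _\<bar> \<le> _") for z n i
  proof -
    obtain t where "?d = (h n)\<^sup>2 / 2 * (pd i (pd i m) (z + t *\<^sub>R axis i 1) + pd i (pd i m) (z + (-t) *\<^sub>R axis i 1))"
      using second_difference[OF m2 h(1)] by metis
    then have "?d / (h n)\<^sup>2 = (pd i (pd i m) (z + t *\<^sub>R axis i 1) + pd i (pd i m) (z + (-t) *\<^sub>R axis i 1)) / 2"
      using h(1)[of n] by simp
    then show ?thesis using B(2)[of i "z + t *\<^sub>R axis i 1"] B(2)[of i "z + (-t) *\<^sub>R axis i 1"]
      by (simp only: abs_le_iff) (simp add: field_simps)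
  qed
  have lim: "(\<lambda>n. (m (z + h n *\<^sub>R axis i 1) + m (z - h n *\<^sub>R axis i 1) - 2 * m z) / (h n)\<^sup>2) \<longlonglongrightarrow> pd i (pd i m) z"
    for z i
  proof -
    have "\<exists>t. 0 < t \<and> t < h n \<and> m (z + h n *\<^sub>R axis i 1) + m (z - h n *\<^sub>R axis i 1) - 2 * m z =
        (h n)\<^sup>2 / 2 * (pd i (pd i m) (z + t *\<^sub>R axis i 1) + pd i (pd i m) (z + (-t) *\<^sub>R axis i 1))" for n
      using second_difference[OF m2 h(1)] by metis
    then obtain t where t: "\<And>n. 0 < t n" "\<And>n. t n < h n"
      "\<And>n. m (z + h n *\<^sub>R axis i 1) + m (z - h n *\<^sub>R axis i 1) - 2 * m z =
        (h n)\<^sup>2 / 2 * (pd i (pd i m) (z + t n *\<^sub>R axis i 1) + pd i (pd i m) (z + (- t n) *\<^sub>R axis i 1))"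
      by metis
    have t0: "t \<longlonglongrightarrow> 0"
      by (rule tendsto_sandwich[OF _ _ tendsto_const h0])
        (use t(1,2) in \<open>auto intro!: always_eventually less_imp_le\<close>)
    have c: "isCont (pd i (pd i m)) z" using c2 by (simp add: continuous_on_eq_continuous_at)
    have "(\<lambda>n. z + t n *\<^sub>R axis i 1) \<longlonglongrightarrow> z + 0 *\<^sub>R axis i 1"
      by (intro tendsto_intros t0)
    then have 1: "(\<lambda>n. pd i (pd i m) (z + t n *\<^sub>R axis i 1)) \<longlonglongrightarrow> pd i (pd i m) z"
      by (intro isCont_tendsto_compose[OF c]) simp
    have "(\<lambda>n. z + (- t n) *\<^sub>R axis i 1) \<longlonglongrightarrow> z + (- 0) *\<^sub>R axis i 1"
      by (intro tendsto_intros t0)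
    then have 2: "(\<lambda>n. pd i (pd i m) (z + (- t n) *\<^sub>R axis i 1)) \<longlonglongrightarrow> pd i (pd i m) z"
      by (intro isCont_tendsto_compose[OF c]) simp
    have "(\<lambda>n. (pd i (pd i m) (z + t n *\<^sub>R axis i 1) + pd i (pd i m) (z + (- t n) *\<^sub>R axis i 1)) / 2)
        \<longlonglongrightarrow> (pd i (pd i m) z + pd i (pd i m) z) / 2"
      by (intro tendsto_intros 1 2) simp
    moreover have "(pd i (pd i m) (z + t n *\<^sub>R axis i 1) + pd i (pd i m) (z + (- t n) *\<^sub>R axis i 1)) / 2 =
        (m (z + h n *\<^sub>R axis i 1) + m (z - h n *\<^sub>R axis i 1) - 2 * m z) / (h n)\<^sup>2" for n
      using h(1)[of n] unfolding t(3) by simp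
    moreover have "(a + a) / 2 = a" for a :: real by simp
    ultimately show ?thesis by (simp only:)
  qed
  have "(\<lambda>n. \<integral>z. v z * s n z \<partial>lborel) \<longlonglongrightarrow> (\<integral>z. v z * (\<Sum>i\<in>UNIV. pd i (pd i m) (z - x)) \<partial>lborel)"
  proof (rule integral_dominated_convergence[where w = "\<lambda>z. \<bar>v z\<bar> * (\<Sum>i\<in>UNIV. B i)"])
    have "continuous_on UNIV (\<lambda>z. \<Sum>i\<in>UNIV. pd i (pd i m) (z - x))"
      by (auto intro!: continuous_intros continuous_on_compose2[OF c2])
    then show "(\<lambda>z. v z * (\<Sum>i\<in>UNIV. pd i (pd i m) (z - x))) \<in> borel_measurable lborel"
      using v by (intro borel_measurable_times) (auto intro: borel_measurable_continuous_onI)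
    have "continuous_on UNIV (s n)" for n
      unfolding s_def using h(1)[of n] by (auto intro!: continuous_intros continuous_on_compose2[OF cm])
    then show "(\<lambda>z. v z * s n z) \<in> borel_measurable lborel" for n
      using v by (intro borel_measurable_times) (auto intro: borel_measurable_continuous_onI)
    show "integrable lborel (\<lambda>z. \<bar>v z\<bar> * (\<Sum>i\<in>UNIV. B i))" using v by simp
    show "AE z in lborel. (\<lambda>n. v z * s n z) \<longlonglongrightarrow> v z * (\<Sum>i\<in>UNIV. pd i (pd i m) (z - x))"
      unfolding s_def sum_divide_distrib by (intro AE_I2 tendsto_intros lim)
    have "\<bar>s n z\<bar> \<le> (\<Sum>i\<in>UNIV. B i)" for n z
      unfolding s_def sum_divide_distrib by (rule order_trans[OF sum_abs sum_mono[OF each]])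
    then show "AE z in lborel. norm (v z * s n z) \<le> \<bar>v z\<bar> * (\<Sum>i\<in>UNIV. B i)" for n
      by (auto simp: abs_mult intro!: mult_left_mono)
  qed
  moreover have "T \<le> (\<integral>z. v z * s n z \<partial>lborel)" for n
    using le[OF h[of n]] h(1)[of n] by (simp add: s_def field_simps)
  ultimately show ?thesis
    by (intro LIMSEQ_le_const) auto
qed

text \<open>The right side does not depend on the base point a, so averaging the second difference
  against the bump merely multiplies it by the mass of the bump. The mixed terms cancel without
  symmetry of A.\<close>

lemma quadratic_second_difference:
  fixes A :: "'a::real_inner \<Rightarrow> 'a"
  assumes "bounded_linear A"
  shows "(c \<bullet> (a + e) + ((a + e) \<bullet> A (a + e)) / 2 - 2 * \<kappa> * ((a + e) \<bullet> (a + e))) +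
    (c \<bullet> (a - e) + ((a - e) \<bullet> A (a - e)) / 2 - 2 * \<kappa> * ((a - e) \<bullet> (a - e))) -
    2 * (c \<bullet> a + (a \<bullet> A a) / 2 - 2 * \<kappa> * (a \<bullet> a)) = e \<bullet> A e - 4 * \<kappa> * (e \<bullet> e)"
proof -
  interpret bounded_linear A by fact
  show ?thesis
    by (simp add: add diff inner_add_left inner_add_right inner_diff_left inner_diff_right
        inner_commute[of e a] field_simps)
qed

text \<open>
  After subtracting a quadratic polynomial the contact becomes a strict minimum, which survives
  mollification.  At the minimum of the mollified difference the second differences are nonnegative,
  and in the limit they become the weak Laplacian tested with the mollifier.
\<close>
lemma weak_lap_touching:
  fixes x0 :: "real^'n::finite"
  assumes \<Omega>: "open \<Omega>" "x0 \<in> \<Omega>" and wl: "weak_lap \<Omega> u F" and jet: "jet2 \<psi> g A x0"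
    and touch: "\<forall>\<^sub>F y in nhds x0. u x0 - \<psi> x0 \<le> u y - \<psi> y"
    and R0: "R0 > 0" and F: "AE x in lebesgue. x \<in> ball x0 R0 \<longrightarrow> F x \<le> K"
  shows "trace_op A \<le> K"
proof -
  have bl: "bounded_linear A" using jet by (auto simp: jet2_def dest: has_derivative_bounded_linear)
  interpret A: bounded_linear A by (rule bl)
  have "trace_op A - 4 * \<kappa> * real CARD('n) \<le> K" if \<kappa>: "\<kappa> > 0" for \<kappa>
  proof -
    obtain d1 where d1: "d1 > 0" "\<And>y. norm (y - x0) < d1 \<Longrightarrow>
      \<psi> y \<ge> \<psi> x0 + g x0 \<bullet> (y - x0) + ((y - x0) \<bullet> A (y - x0)) / 2 - \<kappa> * (norm (y - x0))\<^sup>2"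
      using jet2_lower_expansion[OF jet \<kappa>] by blast
    obtain d2 where d2: "d2 > 0" "\<And>y. dist y x0 < d2 \<Longrightarrow> u x0 - \<psi> x0 \<le> u y - \<psi> y"
      using touch unfolding eventually_nhds_metric by blast
    obtain d3 where d3: "d3 > 0" "ball x0 d3 \<subseteq> \<Omega>" using \<Omega> openE by blast
    define R where "R = min (min d1 d2) (min d3 R0) / 3"
    have R: "R > 0" using d1 d2 d3 R0 by (simp add: R_def)
    have R3: "2 * R < d1" "2 * R < d2" "2 * R < d3" "2 * R < R0"
      using d1(1) d2(1) d3(1) R0 by (auto simp: R_def)
    have B\<Omega>: "cball x0 (2 * R) \<subseteq> \<Omega>" using R3 d3 by (auto simp: subset_iff)
    \<comment> \<open>Of the coefficient 2 \<kappa>, one \<kappa> absorbs the Taylor error of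
      \<psi>, the other makes the minimum strict. The price is 4 \<kappa> per direction, removed at
      the end by letting \<kappa> tend to 0.\<close>
    define P where "P z = g x0 \<bullet> (z - x0) + ((z - x0) \<bullet> A (z - x0)) / 2 - 2 * \<kappa> * (norm (z - x0))\<^sup>2" for z
    \<comment> \<open>Extension by zero makes the mollification an integral over the whole space,
      where translation invariance is available.\<close>
    define v where "v z = indicator \<Omega> z * u z" for z
    have uc: "continuous_on \<Omega> u" and ui: "set_integrable lebesgue \<Omega> u" and Fi: "set_integrable lebesgue \<Omega> F"
      and weak: "\<And>\<phi>. test_fun \<Omega> \<phi> \<Longrightarrow>
       (LINT x:\<Omega>|lebesgue. u x * (\<Sum>i\<in>UNIV. pd i (pd i \<phi>) x)) = (LINT x:\<Omega>|lebesgue. F x * \<phi> x)"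
      using wl by (auto simp: weak_lap_def)
    have vm: "v \<in> borel_measurable borel"
      using borel_measurable_continuous_on_indicator[OF _ uc] \<Omega>(1) by (simp add: v_def[abs_def])
    have vi: "integrable lborel v"
      using ui vm unfolding set_integrable_def by (simp add: integrable_completion v_def[abs_def])
    have Pc: "continuous_on S P" for S
      unfolding P_def by (intro continuous_intros bounded_linear.continuous_on[OF bl]) auto
    define q where "q z = v z - P z" for z
    have qc: "continuous_on (cball x0 (2 * R)) q"
    proof -
      have "continuous_on (cball x0 (2 * R)) (\<lambda>z. u z - P z)"
        by (intro continuous_intros Pc continuous_on_subset[OF uc B\<Omega>])
      then show ?thesis
        by (rule continuous_on_eq) (use B\<Omega> in \<open>auto simp: q_def v_def\<close>)
    qed
    have "q x \<ge> q x0 + \<kappa> * (dist x x0)\<^sup>2" if "x \<in> cball x0 (2 * R)" for x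
      using d1(2)[of x] d2(2)[of x] that R3 subsetD[OF B\<Omega> that] \<Omega>(2)
      by (simp add: q_def v_def P_def dist_norm norm_minus_commute)
    then obtain \<eta> x1 where \<eta>: "\<eta> > 0" "real CARD('n) * \<eta> \<le> R" and x1: "x1 \<in> ball x0 R"
      and min: "\<And>x. x \<in> cball x0 R \<Longrightarrow> (\<integral>y. q (x1 + y) * bump \<eta> y \<partial>lborel) \<le> (\<integral>y. q (x + y) * bump \<eta> y \<partial>lborel)"
      using mollified_has_interior_min[OF R \<kappa> qc] by blast
    let ?m = "bump \<eta> :: real^'n \<Rightarrow> real"
    let ?r = "real CARD('n) * \<eta>"
    have mS: "smooth_fun ?m" by (rule smooth_bump)
    then have mc: "continuous_on UNIV ?m" unfolding smooth_fun_def using Ck_imp_continuous by blast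
    have mm: "?m \<in> borel_measurable borel" using mc by (rule borel_measurable_continuous_onI)
    obtain B where B: "\<And>y. \<bar>?m y\<bar> \<le> B"
      using bounded_of_compact_support[OF mc _ compact_cball[of 0 ?r]] bump_support[of \<eta>] by auto
    define I where "I = integral\<^sup>L lborel ?m"
    have mi: "integrable lborel ?m"
      using integrable_mult_support[of ?r "\<lambda>_. 1" ?m] mc bump_support by auto
    have I: "I > 0" unfolding I_def
      using mc bump_nonneg bump_pos[OF \<eta>(1)] mi by (rule integral_pos_at)
    \<comment> \<open>Translation moves the shift from v to the bump, so that the second differences
      fall on a smooth function.\<close>
    have shift: "(\<integral>y. v (c + y) * ?m y \<partial>lborel) = (\<integral>z. v z * ?m (z - c) \<partial>lborel)" for c
      using lborel_integral_translate[of "\<lambda>z. v z * ?m (z - c)" c] vm mm by simp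
    have vmi: "integrable lborel (\<lambda>z. v z * ?m (z - c))" for c
      using vi mm B by (intro integrable_mult_bounded[where B = B]) auto
    have vmi': "integrable lborel (\<lambda>y. v (c + y) * ?m y)" for c
      using lborel_integrable_translate[OF vmi, of c c] by simp
    have Pmi: "integrable lborel (\<lambda>y. P (c + y) * ?m y)" for c
      by (rule integrable_mult_support[of ?r, OF _ mc bump_support])
        (auto intro!: continuous_on_compose2[OF Pc[of UNIV]] continuous_intros)
    define R1 where "R1 = R - dist x0 x1"
    have R1: "R1 > 0" using x1 by (simp add: R1_def)
    have step: "h\<^sup>2 * ((A (axis i 1) $ i - 4 * \<kappa>) * I) \<le>
        (\<integral>z. v z * (?m (z - x1 + h *\<^sub>R axis i 1) + ?m (z - x1 - h *\<^sub>R axis i 1) - 2 * ?m (z - x1)) \<partial>lborel)"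
      if h: "0 < h" "h < R1" for h i
    proof -
      let ?e = "h *\<^sub>R axis i (1::real) :: real^'n"
      have ne: "norm ?e = h" using h by simp
      have in1: "x1 + ?e \<in> cball x0 R"
        using h ne norm_triangle_ineq4[of "x0 - x1" ?e] by (simp add: R1_def dist_norm algebra_simps)
      have in2: "x1 - ?e \<in> cball x0 R"
        using h ne norm_triangle_ineq[of "x0 - x1" ?e] by (simp add: R1_def dist_norm algebra_simps)
      define J where "J c = (\<integral>y. v (c + y) * ?m y \<partial>lborel)" for c
      define JP where "JP c = (\<integral>y. P (c + y) * ?m y \<partial>lborel)" for c
      have J: "(\<integral>y. q (c + y) * ?m y \<partial>lborel) = J c - JP c" for c
        unfolding q_def J_def JP_def left_diff_distrib using vmi' Pmi by (rule Bochner_Integration.integral_diff)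
      have "2 * (J x1 - JP x1) \<le> (J (x1 + ?e) - JP (x1 + ?e)) + (J (x1 - ?e) - JP (x1 - ?e))"
        using add_mono[OF min[OF in1] min[OF in2]] unfolding J by (simp only: mult_2)
      moreover have "JP (x1 + ?e) + JP (x1 - ?e) - 2 * JP x1 = h\<^sup>2 * ((A (axis i 1) $ i - 4 * \<kappa>) * I)"
      proof -
        have "P (x1 + ?e + y) + P (x1 - ?e + y) - 2 * P (x1 + y) = h\<^sup>2 * (A (axis i 1) $ i - 4 * \<kappa>)" for y
        proof -
          define a where "a = x1 + y - x0"
          have "x1 + ?e + y - x0 = a + ?e" "x1 - ?e + y - x0 = a - ?e" "x1 + y - x0 = a"
            by (simp_all add: a_def)
          then have "P (x1 + ?e + y) + P (x1 - ?e + y) - 2 * P (x1 + y) = ?e \<bullet> A ?e - 4 * \<kappa> * (?e \<bullet> ?e)"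
            unfolding P_def power2_norm_eq_inner by (simp only: quadratic_second_difference[OF bl])
          moreover have "?e \<bullet> A ?e = h\<^sup>2 * A (axis i 1) $ i"
            by (simp add: A.scaleR inner_axis' power2_eq_square)
          moreover have "?e \<bullet> ?e = h\<^sup>2" using ne by (simp only: power2_norm_eq_inner[symmetric])
          ultimately show ?thesis by (simp only: right_diff_distrib mult_ac)
        qed
        then have *: "h\<^sup>2 * (A (axis i 1) $ i - 4 * \<kappa>) * ?m y =
            P (x1 + ?e + y) * ?m y + P (x1 - ?e + y) * ?m y - 2 * (P (x1 + y) * ?m y)" for y
          by (metis (no_types, lifting) distrib_right left_diff_distrib mult.assoc)
        have "h\<^sup>2 * ((A (axis i 1) $ i - 4 * \<kappa>) * I) = (\<integral>y. h\<^sup>2 * (A (axis i 1) $ i - 4 * \<kappa>) * ?m y \<partial>lborel)"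
          by (simp add: I_def)
        also have "\<dots> = JP (x1 + ?e) + JP (x1 - ?e) - 2 * JP x1"
          unfolding * JP_def using Pmi
          by (simp add: Bochner_Integration.integral_diff Bochner_Integration.integral_add
              Bochner_Integration.integrable_add integrable_mult_right)
        finally show ?thesis by simp
      qed
      moreover have "J (x1 + ?e) + J (x1 - ?e) - 2 * J x1 =
        (\<integral>z. v z * (?m (z - x1 + ?e) + ?m (z - x1 - ?e) - 2 * ?m (z - x1)) \<partial>lborel)"
      proof -
        have "(\<integral>z. v z * (?m (z - x1 + ?e) + ?m (z - x1 - ?e) - 2 * ?m (z - x1)) \<partial>lborel) =
          (\<integral>z. v z * ?m (z - (x1 + ?e)) + v z * ?m (z - (x1 - ?e)) - 2 * (v z * ?m (z - x1)) \<partial>lborel)"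
          by (rule Bochner_Integration.integral_cong) (simp_all add: algebra_simps)
        also have "\<dots> = J (x1 + ?e) + J (x1 - ?e) - 2 * J x1"
          unfolding J_def shift using vmi
          by (simp only: Bochner_Integration.integral_diff Bochner_Integration.integral_add integral_mult_right_zero
              Bochner_Integration.integrable_add integrable_mult_right)
        finally show ?thesis by simp
      qed
      ultimately show ?thesis by (simp only: diff_le_eq algebra_simps)
    qed
    have "(trace_op A - 4 * \<kappa> * real CARD('n)) * I \<le> (\<integral>z. v z * (\<Sum>i\<in>UNIV. pd i (pd i ?m) (z - x1)) \<partial>lborel)"
    proof (rule mean_second_difference_limit[OF mS bump_support vi R1])
      fix h assume h: "0 < h" "h < R1"
      have "h\<^sup>2 * ((trace_op A - 4 * \<kappa> * real CARD('n)) * I) = (\<Sum>i\<in>UNIV. h\<^sup>2 * ((A (axis i 1) $ i - 4 * \<kappa>) * I))"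
        by (simp add: trace_op_def sum_distrib_left[symmetric] sum_distrib_right[symmetric] sum_subtractf)
      also have "\<dots> \<le> (\<Sum>i\<in>UNIV. \<integral>z. v z * (?m (z - x1 + h *\<^sub>R axis i 1) + ?m (z - x1 - h *\<^sub>R axis i 1) - 2 * ?m (z - x1)) \<partial>lborel)"
        by (intro sum_mono step h)
      also have "\<dots> = (\<integral>z. v z * (\<Sum>i\<in>UNIV. ?m (z - x1 + h *\<^sub>R axis i 1) + ?m (z - x1 - h *\<^sub>R axis i 1) - 2 * ?m (z - x1)) \<partial>lborel)"
        unfolding sum_distrib_left
      proof (rule Bochner_Integration.integral_sum[symmetric])
        fix i
        have "integrable lborel (\<lambda>z. v z * ?m (z - (x1 - h *\<^sub>R axis i 1)) + v z * ?m (z - (x1 + h *\<^sub>R axis i 1)) - 2 * (v z * ?m (z - x1)))"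
          by (intro Bochner_Integration.integrable_add Bochner_Integration.integrable_diff integrable_mult_right vmi)
        then show "integrable lborel (\<lambda>z. v z * (?m (z - x1 + h *\<^sub>R axis i 1) + ?m (z - x1 - h *\<^sub>R axis i 1) - 2 * ?m (z - x1)))"
          by (rule back_subst[of "integrable lborel"]) (auto simp: algebra_simps)
      qed
      finally show "h\<^sup>2 * ((trace_op A - 4 * \<kappa> * real CARD('n)) * I) \<le>
        (\<integral>z. v z * (\<Sum>i\<in>UNIV. ?m (z - x1 + h *\<^sub>R axis i 1) + ?m (z - x1 - h *\<^sub>R axis i 1) - 2 * ?m (z - x1)) \<partial>lborel)" .
    qed
    also have "\<dots> \<le> K * I"
    proof -
      \<comment> \<open>The bump centred at the minimum point is an admissible test function
        supported where F is at most K; testing with it replaces the Laplacian by F.\<close>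
      define \<phi> where "\<phi> z = ?m (z - x1)" for z
      have supp: "{z. \<phi> z \<noteq> 0} \<subseteq> cball x1 ?r"
        using bump_support by (auto simp: \<phi>_def dist_norm norm_minus_commute)
      have ball: "cball x1 ?r \<subseteq> ball x0 (2 * R)"
      proof
        fix z assume "z \<in> cball x1 ?r"
        then show "z \<in> ball x0 (2 * R)"
          using x1 \<eta>(2) dist_triangle[of x0 z x1] by simp
      qed
      have cl: "closure {z. \<phi> z \<noteq> 0} \<subseteq> cball x1 ?r" by (rule closure_minimal[OF supp]) simp
      have "test_fun \<Omega> \<phi>"
        unfolding test_fun_def
      proof (intro conjI)
        show "smooth_fun \<phi>" using mS Ck_shift unfolding smooth_fun_def \<phi>_def[abs_def] by blast
        show "compact (closure {z. \<phi> z \<noteq> 0})"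
          using bounded_subset[OF bounded_cball supp] by (simp add: compact_closure)
        show "closure {z. \<phi> z \<noteq> 0} \<subseteq> \<Omega>" using cl ball B\<Omega> by (force simp: subset_iff)
      qed
      note w = weak[OF this]
      have "pd i \<phi> = (\<lambda>z. pd i ?m (z - x1))" for i
        unfolding \<phi>_def[abs_def] using pd_shift by (rule ext)
      then have pd2: "pd i (pd i \<phi>) z = pd i (pd i ?m) (z - x1)" for i z
        by (simp add: pd_shift)
      have mSi: "continuous_on UNIV (pd i (pd i ?m))" for i
        using mS[unfolded smooth_fun_def, rule_format, of "Suc (Suc 0)"] by simp
      have "continuous_on UNIV (\<lambda>z. \<Sum>i\<in>UNIV. pd i (pd i ?m) (z - x1))"
        by (auto intro!: continuous_intros continuous_on_compose2[OF mSi])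
      then have meas: "(\<lambda>z. v z * (\<Sum>i\<in>UNIV. pd i (pd i ?m) (z - x1))) \<in> borel_measurable lborel"
        using vm by (intro borel_measurable_times) (simp_all add: borel_measurable_continuous_onI)
      have "(\<integral>z. v z * (\<Sum>i\<in>UNIV. pd i (pd i ?m) (z - x1)) \<partial>lborel) =
          (\<integral>z. v z * (\<Sum>i\<in>UNIV. pd i (pd i ?m) (z - x1)) \<partial>lebesgue)"
        using integral_completion[OF meas] by simp
      also have "\<dots> = (LINT x:\<Omega>|lebesgue. u x * (\<Sum>i\<in>UNIV. pd i (pd i \<phi>) x))"
        by (simp add: set_lebesgue_integral_def pd2 v_def mult.assoc)
      also have "\<dots> = (\<integral>z. (indicator \<Omega> z * F z) * \<phi> z \<partial>lebesgue)"
        unfolding w by (simp add: set_lebesgue_integral_def mult.assoc)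
      also have "\<dots> \<le> (\<integral>z. K * \<phi> z \<partial>lebesgue)"
      proof (rule integral_mono_AE)
        have \<phi>m: "\<phi> \<in> borel_measurable borel" unfolding \<phi>_def[abs_def] using mm by simp
        show "integrable lebesgue (\<lambda>z. (indicator \<Omega> z * F z) * \<phi> z)"
        proof (rule integrable_mult_bounded[where B = B])
          show "integrable lebesgue (\<lambda>z. indicator \<Omega> z * F z)" using Fi by (simp add: set_integrable_def)
          show "\<phi> \<in> borel_measurable lebesgue" using \<phi>m by (auto intro: measurable_completion)
          show "\<bar>\<phi> z\<bar> \<le> B" for z using B by (simp add: \<phi>_def)
        qed
        have "integrable lborel (\<lambda>z. K * \<phi> z)"
          unfolding \<phi>_def using lborel_integrable_translate[OF mi, of "- x1"] by simp
        then show "integrable lebesgue (\<lambda>z. K * \<phi> z)"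
          using \<phi>m by (simp add: integrable_completion)
        show "AE z in lebesgue. indicator \<Omega> z * F z * \<phi> z \<le> K * \<phi> z"
          using F
        proof eventually_elim
          case (elim z)
          show ?case
          proof (cases "\<phi> z = 0")
            case False
            then have "z \<in> ball x0 (2 * R)" using supp ball by auto
            then have "z \<in> ball x0 R0" "z \<in> \<Omega>" using R3 B\<Omega> by auto
            then show ?thesis using elim bump_nonneg[of \<eta> "z - x1"] by (auto simp: \<phi>_def intro: mult_right_mono)
          qed simp
        qed
      qed
      also have "\<dots> = K * I"
      proof -
        have "(\<integral>z. \<phi> z \<partial>lebesgue) = (\<integral>z. \<phi> z \<partial>lborel)"
          using mm unfolding \<phi>_def by (intro integral_completion) auto
        also have "\<dots> = I"
          unfolding I_def \<phi>_def using lborel_integral_translate[of ?m "- x1"] mm by simp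
        finally show ?thesis by simp
      qed
      finally show ?thesis .
    qed
    finally show ?thesis using I by simp
  qed
  then have "trace_op A \<le> K + e" if "e > 0" for e
    using that \<open>\<And>\<kappa>. \<kappa> > 0 \<Longrightarrow> _\<close>[of "e / (4 * real CARD('n))"] by simp
  then show ?thesis by (rule field_le_epsilon)
qed

section \<open>Barriers and propagation of positivity\<close>

text \<open>Continuity turns the variable bound f into the constant f(x) + e on a small ball around
  the contact point, which is the form \<open>weak_lap_touching\<close> needs.\<close>

lemma lap_le_of_weak_lap:
  assumes "open \<Omega>" "weak_lap \<Omega> u F" "open U" "U \<subseteq> \<Omega>" "continuous_on U f"
    and F: "AE x in lebesgue. x \<in> U \<longrightarrow> F x \<le> f x"
  shows "lap_le U u f"
  unfolding lap_le_def
proof (intro ballI allI impI)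
  fix x \<psi> g A
  assume x: "x \<in> U" and jet: "jet2 \<psi> g A x" and touch: "\<forall>\<^sub>F y in nhds x. u x - \<psi> x \<le> u y - \<psi> y"
  have "trace_op A \<le> f x + e" if e: "e > 0" for e
  proof -
    have "isCont f x" using assms(3,5) x by (simp add: continuous_on_eq_continuous_at)
    then obtain d where d: "d > 0" "\<And>y. dist y x < d \<Longrightarrow> \<bar>f y - f x\<bar> < e"
      using e unfolding continuous_at_eps_delta dist_real_def by blast
    obtain d' where d': "d' > 0" "ball x d' \<subseteq> U" using assms(3) x openE by blast
    have "AE y in lebesgue. y \<in> ball x (min d d') \<longrightarrow> F y \<le> f x + e"
      using F
    proof eventually_elim
      case (elim y)
      show ?case
      proof
        assume "y \<in> ball x (min d d')"
        then have "dist y x < d" "y \<in> U" using d'(2) by (auto simp: dist_commute)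
        then show "F y \<le> f x + e" using elim d(2)[of y] by (auto simp: abs_if split: if_splits)
      qed
    qed
    then show ?thesis
      using weak_lap_touching[OF assms(1) _ assms(2) jet touch] x assms(4) d(1) d'(1) by (meson min_less_iff_conj subsetD)
  qed
  then show "trace_op A \<le> f x" by (rule field_le_epsilon)
qed

section \<open>Calculus of viscosity inequalities and jets\<close>

lemma lap_leD:
  assumes "lap_le U w f" "x \<in> U" "jet2 \<psi> g A x" "\<forall>\<^sub>F y in nhds x. w x - \<psi> x \<le> w y - \<psi> y"
  shows "trace_op A \<le> f x"
  using assms unfolding lap_le_def by blast

lemma lap_le_mono:
  assumes "lap_le U w f" "V \<subseteq> U" "\<And>x. x \<in> V \<Longrightarrow> f x \<le> f' x"
  shows "lap_le V w f'"
  using assms unfolding lap_le_def by (meson order_trans subsetD)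

lemma jet2_cmult:
  assumes "jet2 \<psi> g A x"
  shows "jet2 (\<lambda>y. c * \<psi> y) (\<lambda>y. c *\<^sub>R g y) (\<lambda>h. c *\<^sub>R A h) x"
  unfolding jet2_def
proof
  have "\<forall>\<^sub>F y in nhds x. (\<psi> has_derivative (\<lambda>h. g y \<bullet> h)) (at y)" using assms by (simp add: jet2_def)
  then show "\<forall>\<^sub>F y in nhds x. ((\<lambda>y. c * \<psi> y) has_derivative (\<lambda>h. c *\<^sub>R g y \<bullet> h)) (at y)"
  proof eventually_elim
    case (elim y)
    then show ?case using has_derivative_mult_right[OF elim, of c] by simp
  qed
  show "((\<lambda>y. c *\<^sub>R g y) has_derivative (\<lambda>h. c *\<^sub>R A h)) (at x)"
    using assms by (auto simp: jet2_def intro: has_derivative_scaleR_right)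
qed

lemma trace_op_cmult: "trace_op (\<lambda>h. c *\<^sub>R A h) = c * trace_op A"
  by (simp add: trace_op_def sum_distrib_left)

lemma lap_le_affine:
  assumes "lap_le U w f" "\<alpha> > 0"
  shows "lap_le U (\<lambda>x. \<alpha> * w x + \<beta>) (\<lambda>x. \<alpha> * f x)"
  unfolding lap_le_def
proof (intro ballI allI impI)
  fix x \<psi> g A
  assume x: "x \<in> U" and jet: "jet2 \<psi> g A x"
    and touch: "\<forall>\<^sub>F y in nhds x. \<alpha> * w x + \<beta> - \<psi> x \<le> \<alpha> * w y + \<beta> - \<psi> y"
  have "\<forall>\<^sub>F y in nhds x. w x - (1 / \<alpha>) * \<psi> x \<le> w y - (1 / \<alpha>) * \<psi> y"
    using touch
  proof eventually_elim
    case (elim y)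
    then have "(1 / \<alpha>) * (\<alpha> * w x - \<psi> x) \<le> (1 / \<alpha>) * (\<alpha> * w y - \<psi> y)"
      using assms(2) by (intro mult_left_mono) auto
    then show ?case using assms(2) by (simp add: right_diff_distrib)
  qed
  then have "(1 / \<alpha>) * trace_op A \<le> f x"
    using lap_leD[OF assms(1) x jet2_cmult[OF jet, of "1 / \<alpha>"]] by (simp only: trace_op_cmult)
  then show "trace_op A \<le> \<alpha> * f x" using assms(2) by (simp add: field_simps)
qed

text \<open>The rank-one term of the Hessian gives the barriers their strict sign: its trace is F''
  |grad s|^2.\<close>

lemma jet2_chain:
  assumes jet: "jet2 s g A x"
    and F: "\<forall>\<^sub>F t in nhds (s x). (F has_real_derivative F' t) (at t)"
    and F': "(F' has_real_derivative F'') (at (s x))"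
  shows "jet2 (\<lambda>y. F (s y)) (\<lambda>y. F' (s y) *\<^sub>R g y)
    (\<lambda>h. F' (s x) *\<^sub>R A h + (F'' * (g x \<bullet> h)) *\<^sub>R g x) x"
  unfolding jet2_def
proof
  have s: "\<forall>\<^sub>F y in nhds x. (s has_derivative (\<lambda>h. g y \<bullet> h)) (at y)" and g: "(g has_derivative A) (at x)"
    using jet by (auto simp: jet2_def)
  have sx: "(s has_derivative (\<lambda>h. g x \<bullet> h)) (at x)"
    using s by (rule eventually_nhds_x_imp_x)
  then have "isCont s x" by (rule has_derivative_continuous)
  then have "filterlim s (nhds (s x)) (nhds x)"
    unfolding isCont_def using tendsto_at_iff_tendsto_nhds by blast
  then have "\<forall>\<^sub>F y in nhds x. (F has_real_derivative F' (s y)) (at (s y))"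
    by (rule eventually_compose_filterlim[OF F])
  with s show "\<forall>\<^sub>F y in nhds x. ((\<lambda>y. F (s y)) has_derivative (\<lambda>h. F' (s y) *\<^sub>R g y \<bullet> h)) (at y)"
  proof eventually_elim
    case (elim y)
    then show ?case
      using has_derivative_compose[OF elim(1), of F "\<lambda>t. F' (s y) * t"]
      by (simp add: has_field_derivative_def)
  qed
  have "((\<lambda>y. F' (s y)) has_derivative (\<lambda>h. F'' * (g x \<bullet> h))) (at x)"
    using has_derivative_compose[OF sx, of F' "\<lambda>t. F'' * t"] F' by (simp add: has_field_derivative_def)
  then show "((\<lambda>y. F' (s y) *\<^sub>R g y) has_derivative
      (\<lambda>h. F' (s x) *\<^sub>R A h + (F'' * (g x \<bullet> h)) *\<^sub>R g x)) (at x)"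
    using g by (rule has_derivative_scaleR)
qed

lemma trace_op_chain:
  "trace_op (\<lambda>h. a *\<^sub>R A h + (b * (v \<bullet> h)) *\<^sub>R v) = a * trace_op A + b * (v \<bullet> v)"
proof -
  have "(\<Sum>i\<in>UNIV. b * v $ i * v $ i) = b * (v \<bullet> v)"
    by (simp add: inner_vec_def sum_distrib_left mult.assoc)
  then show ?thesis
    by (simp add: trace_op_def sum.distrib sum_distrib_left inner_axis)
qed

text \<open>Where the gradient of s stays away from 0, a large \<alpha> lets \<alpha> |grad s|^2
  dominate the Laplacian of s, so the barrier becomes strictly subharmonic. Subtracting 1 makes it
  vanish on s = 0. It is applied with s = R^2 - |z - x|^2 and with s = -\<rho>.\<close>

lemma jet2_exp_barrier:
  assumes "jet2 s g A x"
  obtains g' A' where "jet2 (\<lambda>y. \<kappa> * (exp (\<alpha> * s y) - 1)) g' A' x"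
    "trace_op A' = \<kappa> * \<alpha> * exp (\<alpha> * s x) * (trace_op A + \<alpha> * (g x \<bullet> g x))"
proof -
  have D: "((\<lambda>t. \<kappa> * (exp (\<alpha> * t) - 1)) has_real_derivative \<kappa> * \<alpha> * exp (\<alpha> * t)) (at t)" for t
    by (auto intro!: derivative_eq_intros)
  have D': "((\<lambda>t. \<kappa> * \<alpha> * exp (\<alpha> * t)) has_real_derivative \<kappa> * \<alpha> * \<alpha> * exp (\<alpha> * t)) (at t)" for t
    by (auto intro!: derivative_eq_intros)
  show thesis
    by (rule that[OF jet2_chain[OF assms always_eventually[OF allI[OF D]] D']])
      (simp only: trace_op_chain, simp add: algebra_simps)
qed

text \<open>The constant c and the factor k stay explicit; later comparison functions are written as
  \<open>0 + 1 * ...\<close> and the like in order to match this shape.\<close>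

lemma jet2_sqnorm:
  fixes x0 :: "real^'n::finite"
  shows "jet2 (\<lambda>y. c + k * (norm (y - x0))\<^sup>2) (\<lambda>y. (2 * k) *\<^sub>R (y - x0)) (\<lambda>h. (2 * k) *\<^sub>R h) x"
  unfolding jet2_def power2_norm_eq_inner
proof
  show "\<forall>\<^sub>F y in nhds x. ((\<lambda>y. c + k * ((y - x0) \<bullet> (y - x0))) has_derivative (\<lambda>h. ((2 * k) *\<^sub>R (y - x0)) \<bullet> h)) (at y)"
    by (intro always_eventually allI) (auto intro!: derivative_eq_intros simp: inner_commute algebra_simps)
  show "((\<lambda>y. (2 * k) *\<^sub>R (y - x0)) has_derivative (\<lambda>h. (2 * k) *\<^sub>R h)) (at x)"
    by (auto intro!: derivative_eq_intros)
qed

lemma trace_op_id: "trace_op (\<lambda>h::real^'n::finite. c *\<^sub>R h) = c * real CARD('n)"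
  by (simp add: trace_op_def axis_def)

section \<open>Quantitative spreading of positivity\<close>

text \<open>A Hopf barrier on the annulus between the radii r and R: zero on the outer sphere, at
  most m on the inner one, with Laplacian at least 2e in between, so a viscosity bound by e excludes
  an interior minimum of the difference. The constants depend only on the radii, m and the
  dimension, hence their place before x, U and w.\<close>

lemma positivity_spreads_in_ball:
  fixes r R' R m :: real
  assumes "0 < r" "r < R'" "R' < R" "0 < m"
  shows "\<exists>c>0. \<exists>e>0. \<forall>(x::real^'n::finite) U w. cball x R \<subseteq> U \<longrightarrow> continuous_on U w \<longrightarrow>
    (\<forall>y\<in>U. 0 \<le> w y) \<longrightarrow> lap_le U w (\<lambda>_. e) \<longrightarrow> (\<forall>y\<in>cball x r. m \<le> w y) \<longrightarrow> (\<forall>y\<in>cball x R'. c \<le> w y)"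
proof -
  define N where "N = real CARD('n)"
  have N: "N > 0" by (simp add: N_def)
  \<comment> \<open>For |z - x| \<ge> r the gradient term 4 \<alpha> |z - x|^2 is then at least 4N,
    twice the loss 2N from the Laplacian of -|z - x|^2.\<close>
  define \<alpha> where "\<alpha> = N / r\<^sup>2"
  have \<alpha>: "\<alpha> > 0" using assms N by (simp add: \<alpha>_def)
  define E where "E = exp (\<alpha> * R\<^sup>2) - 1"
  have E: "E > 0" using assms \<alpha> by (simp add: E_def)
  define \<kappa> where "\<kappa> = m / E"
  have \<kappa>: "\<kappa> > 0" using E assms by (simp add: \<kappa>_def)
  define c where "c = min m (\<kappa> * (exp (\<alpha> * (R\<^sup>2 - R'\<^sup>2)) - 1))"
  \<comment> \<open>Half of the guaranteed lower bound for the Laplacian of the barrier, so that the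
    contradiction is strict.\<close>
  define e where "e = \<kappa> * \<alpha> * N"
  have "R'\<^sup>2 < R\<^sup>2" using assms by (intro power_strict_mono) auto
  then have c: "c > 0" using assms \<kappa> \<alpha> by (simp add: c_def)
  have e: "e > 0" using \<kappa> \<alpha> N by (simp add: e_def)
  show ?thesis
  proof (rule exI[of _ c], rule conjI[OF c], rule exI[of _ e], rule conjI[OF e], intro allI impI ballI)
    fix x :: "real^'n" and U w y
    assume U: "cball x R \<subseteq> U" and wc: "continuous_on U w" and w0: "\<forall>y\<in>U. 0 \<le> w y"
      and lap: "lap_le U w (\<lambda>_. e)" and wm: "\<forall>y\<in>cball x r. m \<le> w y" and y: "y \<in> cball x R'"
    define s where "s z = R\<^sup>2 + (-1) * (norm (z - x))\<^sup>2" for z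
    define \<psi> where "\<psi> z = \<kappa> * (exp (\<alpha> * s z) - 1)" for z
    show "c \<le> w y"
    proof (cases "dist x y < r")
      case True
      then have "m \<le> w y" using wm by auto
      then show ?thesis by (simp add: c_def min.coboundedI1)
    next
      case False
      define S where "S = cball x R - ball x r"
      have yS: "y \<in> S" using y False assms by (auto simp: S_def)
      have cS: "compact S" by (auto simp: S_def intro: compact_diff)
      have "continuous_on S (\<lambda>z. w z - \<psi> z)"
        unfolding \<psi>_def s_def using U
        by (intro continuous_intros continuous_on_subset[OF wc]) (auto simp: S_def)
      then obtain z where z: "z \<in> S" "\<And>v. v \<in> S \<Longrightarrow> w z - \<psi> z \<le> w v - \<psi> v"
        using continuous_attains_inf[OF cS] yS by blast
      have zU: "z \<in> U" using z(1) U by (auto simp: S_def)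
      have "0 \<le> w z - \<psi> z"
      proof -
        consider "dist x z = R" | "dist x z = r" | "r < dist x z" "dist x z < R"
          using z(1) by (fastforce simp: S_def)
        then show ?thesis
        proof cases
          case 1
          then have "\<psi> z = 0" by (simp add: \<psi>_def s_def dist_norm norm_minus_commute)
          then show ?thesis using w0 zU by simp
        next
          case 2
          have "exp (\<alpha> * s z) \<le> exp (\<alpha> * R\<^sup>2)" using \<alpha> by (simp add: s_def)
          then have "\<psi> z \<le> \<kappa> * E" using \<kappa> by (simp add: \<psi>_def E_def)
          then have "\<psi> z \<le> m" using E by (simp add: \<kappa>_def)
          moreover have "m \<le> w z" using wm 2 by auto
          ultimately show ?thesis by simp
        next
          case 3
          let ?V = "ball x R - cball x r"
          have "open ?V" "z \<in> ?V" using 3 by auto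
          then have "\<forall>\<^sub>F v in nhds z. v \<in> ?V" by (rule eventually_nhds_in_open)
          then have touch: "\<forall>\<^sub>F v in nhds z. w z - \<psi> z \<le> w v - \<psi> v"
            by eventually_elim (rule z(2), auto simp: S_def)
          obtain g' A' where jet: "jet2 \<psi> g' A' z"
            and tr: "trace_op A' = \<kappa> * \<alpha> * exp (\<alpha> * s z) *
              (trace_op (\<lambda>h::real^'n. (2 * (-1)) *\<^sub>R h) + \<alpha> * (((2 * (-1)) *\<^sub>R (z - x)) \<bullet> ((2 * (-1)) *\<^sub>R (z - x))))"
            unfolding \<psi>_def s_def
            by (rule jet2_exp_barrier[OF jet2_sqnorm[of "R\<^sup>2" "-1" x z], of \<kappa> \<alpha>])
          have "r\<^sup>2 \<le> (norm (z - x))\<^sup>2" using 3 assms by (intro power_mono) (auto simp: dist_norm norm_minus_commute)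
          then have "4 * N \<le> \<alpha> * (4 * (norm (z - x))\<^sup>2)" using assms N by (simp add: \<alpha>_def field_simps)
          moreover have "trace_op A' = \<kappa> * \<alpha> * exp (\<alpha> * s z) * (- 2 * N + \<alpha> * (4 * (norm (z - x))\<^sup>2))"
            unfolding tr trace_op_id by (simp add: N_def power2_norm_eq_inner)
          ultimately have "trace_op A' \<ge> \<kappa> * \<alpha> * exp (\<alpha> * s z) * (2 * N)"
            using \<kappa> \<alpha> by (simp add: mult_left_mono)
          moreover have "s z \<ge> 0" using 3 assms by (auto simp: s_def dist_norm norm_minus_commute intro: power_mono)
          then have "\<kappa> * \<alpha> * exp (\<alpha> * s z) * (2 * N) \<ge> \<kappa> * \<alpha> * 1 * (2 * N)"
            using \<kappa> \<alpha> N by (intro mult_right_mono mult_left_mono) auto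
          moreover have "2 * e = \<kappa> * \<alpha> * 1 * (2 * N)" by (simp add: e_def)
          ultimately have "trace_op A' \<ge> 2 * e" by linarith
          moreover have "trace_op A' \<le> e" by (rule lap_leD[OF lap zU jet touch])
          ultimately show ?thesis using e by linarith
        qed
      qed
      then have "\<psi> y \<le> w y" using z(2)[OF yS] by linarith
      moreover have "\<kappa> * (exp (\<alpha> * (R\<^sup>2 - R'\<^sup>2)) - 1) \<le> \<psi> y"
      proof -
        have "(norm (y - x))\<^sup>2 \<le> R'\<^sup>2" using y by (intro power_mono) (auto simp: dist_norm norm_minus_commute)
        then show ?thesis unfolding \<psi>_def s_def using \<kappa> \<alpha> by (simp add: mult_left_mono)
      qed
      ultimately show ?thesis by (simp add: c_def)
    qed
  qed
qed

text \<open>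
  The constants must not depend on \<open>w\<close>, so the connectedness argument runs over the set of points
  around which the whole class of admissible \<open>w\<close> has a common positive lower bound.
\<close>
lemma positivity_spreads:
  fixes U :: "(real^'n::finite) set"
  assumes U: "open U" "connected U" and x0: "x0 \<in> U" "r0 > 0" and m: "m > 0" and K: "compact K" "K \<subseteq> U"
  shows "\<exists>c>0. \<exists>e>0. \<forall>w. continuous_on U w \<longrightarrow> (\<forall>y\<in>U. 0 \<le> w y) \<longrightarrow> lap_le U w (\<lambda>_. e) \<longrightarrow>
    (\<forall>y\<in>ball x0 r0 \<inter> U. m \<le> w y) \<longrightarrow> (\<forall>y\<in>K. c \<le> w y)"
proof -
  define Cl where "Cl e = {w. continuous_on U w \<and> (\<forall>y\<in>U. 0 \<le> w y) \<and> lap_le U w (\<lambda>_. e) \<and>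
    (\<forall>y\<in>ball x0 r0 \<inter> U. m \<le> w y)}" for e
  have Cl_mono: "Cl e \<subseteq> Cl e'" if "e \<le> e'" for e e'
    using that lap_le_mono[of U _ "\<lambda>_. e" U "\<lambda>_. e'"] unfolding Cl_def by blast
  define good where "good B \<longleftrightarrow> (\<exists>c>0. \<exists>e>0. \<forall>w\<in>Cl e. \<forall>y\<in>B. c \<le> w y)" for B
  define S where "S = {x\<in>U. \<exists>\<rho>>0. good (ball x \<rho>)}"
  have good_sub: "good B'" if "good B" "B' \<subseteq> B" for B B'
    using that unfolding good_def by (meson subsetD)
  have "S = U"
  proof -
    have oS: "open S"
      unfolding open_contains_ball
    proof
      fix x assume "x \<in> S"
      then obtain \<rho> where \<rho>: "x \<in> U" "\<rho> > 0" "good (ball x \<rho>)" by (auto simp: S_def)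
      obtain d where d: "d > 0" "ball x d \<subseteq> U" using U(1) \<rho>(1) openE by blast
      have "ball x (min d (\<rho> / 2)) \<subseteq> S"
      proof
        fix y assume y: "y \<in> ball x (min d (\<rho> / 2))"
        have "ball y (\<rho> / 2) \<subseteq> ball x \<rho>"
        proof
          fix z assume "z \<in> ball y (\<rho> / 2)"
          then show "z \<in> ball x \<rho>" using y dist_triangle[of x z y] by simp
        qed
        then have "good (ball y (\<rho> / 2))" using good_sub[OF \<rho>(3)] by blast
        then show "y \<in> S" using y d \<rho>(2) unfolding S_def by (auto intro!: exI[of _ "\<rho> / 2"])
      qed
      then show "\<exists>e>0. ball x e \<subseteq> S" using d \<rho> by (intro exI[of _ "min d (\<rho> / 2)"]) auto
    qed
    \<comment> \<open>S is relatively closed in U: the known bound near a point y of S is spread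
      from y over a ball that contains a neighbourhood of x.\<close>
    have step: "x \<in> S" if x: "x \<in> U" and lim: "\<And>d. d > 0 \<Longrightarrow> \<exists>y\<in>S. dist x y < d" for x
    proof -
      obtain d where d: "d > 0" "ball x d \<subseteq> U" using U(1) x openE by blast
      \<comment> \<open>With |x - y| < R the ball of radius 2R about y stays inside U, and the ball
        of radius R/2 about x lies in the one of radius 3R/2 about y.\<close>
      define R where "R = d / 4"
      have R: "R > 0" using d by (simp add: R_def)
      obtain y where y: "y \<in> S" "dist x y < R" using lim[OF R] by blast
      obtain \<rho> where \<rho>: "\<rho> > 0" "good (ball y \<rho>)" using y(1) by (auto simp: S_def)
      then obtain c e where ce: "c > 0" "e > 0" "\<forall>w\<in>Cl e. \<forall>z\<in>ball y \<rho>. c \<le> w z" by (auto simp: good_def)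
      define r where "r = min (\<rho> / 2) R"
      have r: "0 < r" "r < 3 / 2 * R" "3 / 2 * R < 2 * R" using \<rho> R by (auto simp: r_def)
      obtain c' e' where ce': "c' > 0" "e' > 0" "\<forall>(x::real^'n) U w. cball x (2 * R) \<subseteq> U \<longrightarrow> continuous_on U w \<longrightarrow>
    (\<forall>y\<in>U. 0 \<le> w y) \<longrightarrow> lap_le U w (\<lambda>_. e') \<longrightarrow> (\<forall>y\<in>cball x r. c \<le> w y) \<longrightarrow> (\<forall>y\<in>cball x (3 / 2 * R). c' \<le> w y)"
        using positivity_spreads_in_ball[OF r ce(1)] by blast
      have cb: "cball y (2 * R) \<subseteq> U"
      proof
        fix z assume "z \<in> cball y (2 * R)"
        then have "z \<in> ball x d" using y(2) dist_triangle[of x z y] d(1) by (simp add: R_def)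
        then show "z \<in> U" using d(2) by blast
      qed
      have "good (ball x (R / 2))"
        unfolding good_def
      proof (rule exI[of _ c'], rule conjI[OF ce'(1)], rule exI[of _ "min e e'"], intro conjI ballI)
        fix w z assume w: "w \<in> Cl (min e e')" and z: "z \<in> ball x (R / 2)"
        have "w \<in> Cl e" "w \<in> Cl e'"
          using w subsetD[OF Cl_mono[of "min e e'" e]] subsetD[OF Cl_mono[of "min e e'" e']] by auto
        have "cball y r \<subseteq> ball y \<rho>" using \<rho> by (auto simp: r_def)
        then have "\<forall>z\<in>cball y r. c \<le> w z" using ce(3) \<open>w \<in> Cl e\<close> by blast
        then have "\<forall>z\<in>cball y (3 / 2 * R). c' \<le> w z"
          using \<open>w \<in> Cl e'\<close> unfolding Cl_def by (intro ballI ce'(3)[rule_format, OF cb]) auto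
        moreover have "z \<in> cball y (3 / 2 * R)"
          using z y(2) dist_triangle[of y z x] by (simp add: dist_commute)
        ultimately show "c' \<le> w z" by blast
      qed (use ce ce' in auto)
      then show ?thesis using x R unfolding S_def by (auto intro!: exI[of _ "R / 2"])
    qed
    have oUS: "open (U - S)"
      unfolding open_contains_ball
    proof
      fix x assume x: "x \<in> U - S"
      obtain d where d: "d > 0" "ball x d \<subseteq> U" using U(1) x openE by blast
      obtain d' where d': "d' > 0" "\<And>y. y \<in> S \<Longrightarrow> \<not> dist x y < d'" using step[of x] x by blast
      have "ball x (min d d') \<subseteq> U - S" using d d' by auto
      then show "\<exists>e>0. ball x e \<subseteq> U - S" using d d' by (intro exI[of _ "min d d'"]) auto
    qed
    have "x0 \<in> S"
    proof -
      obtain d where d: "d > 0" "ball x0 d \<subseteq> U" using U(1) x0 openE by blast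
      have "good (ball x0 (min d r0))"
        unfolding good_def
        by (rule exI[of _ m], rule conjI[OF m], rule exI[of _ 1], use d(2) in \<open>auto simp: Cl_def subset_iff\<close>)
      then show ?thesis using x0 d unfolding S_def by (auto intro!: exI[of _ "min d r0"])
    qed
    moreover have "S \<subseteq> U" by (auto simp: S_def)
    ultimately show ?thesis
      using connectedD[OF U(2) oS oUS] x0 by blast
  qed
  then have "\<forall>x\<in>K. \<exists>\<rho>>0. good (ball x \<rho>)" using K(2) by (auto simp: S_def)
  then obtain \<rho> where \<rho>: "\<And>x. x \<in> K \<Longrightarrow> \<rho> x > 0 \<and> good (ball x (\<rho> x))" by metis
  obtain T where T: "finite T" "T \<subseteq> K" "K \<subseteq> (\<Union>x\<in>T. ball x (\<rho> x))"
    using compactE_image[OF K(1), of K "\<lambda>x. ball x (\<rho> x)"] \<rho> by (metis (no_types, lifting) UN_iff centre_in_ball open_ball subsetI)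
  have "good (\<Union>x\<in>T. ball x (\<rho> x))"
    using T(1,2)
  proof (induction T rule: finite_induct)
    case empty
    show ?case by (auto simp: good_def intro: exI[of _ 1])
  next
    case (insert x T)
    obtain c e where ce: "c > 0" "e > 0" "\<forall>w\<in>Cl e. \<forall>z\<in>(\<Union>x\<in>T. ball x (\<rho> x)). c \<le> w z"
      using insert by (auto simp: good_def)
    obtain c' e' where ce': "c' > 0" "e' > 0" "\<forall>w\<in>Cl e'. \<forall>z\<in>ball x (\<rho> x). c' \<le> w z"
      using \<rho>[of x] insert.prems by (auto simp: good_def)
    show ?case
      unfolding good_def
    proof (rule exI[of _ "min c c'"], rule conjI, use ce(1) ce'(1) in simp, rule exI[of _ "min e e'"], intro conjI ballI)
      fix w z assume w: "w \<in> Cl (min e e')" and z: "z \<in> (\<Union>x\<in>insert x T. ball x (\<rho> x))"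
      have "w \<in> Cl e" "w \<in> Cl e'"
          using w subsetD[OF Cl_mono[of "min e e'" e]] subsetD[OF Cl_mono[of "min e e'" e']] by auto
      then show "min c c' \<le> w z" using z ce(3) ce'(3) by (auto simp: min_le_iff_disj)
    qed (use ce ce' in auto)
  qed
  then have "good K" using good_sub T(3) by blast
  then show ?thesis unfolding good_def Cl_def by (simp only: Ball_def mem_Collect_eq imp_conjL)
qed

section \<open>The Neumann boundary\<close>

lemma defining_function_zero_on_frontier:
  assumes "open \<Omega>" "defining_function \<Omega> \<rho>" "x \<in> frontier \<Omega>"
  shows "\<rho> x = 0"
proof -
  have c: "continuous_on UNIV \<rho>" and \<Omega>: "\<Omega> = {x. \<rho> x < 0}"
    using assms(2) Ck_imp_continuous unfolding defining_function_def smooth_fun_def by blast+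
  have "closed {x. \<rho> x \<le> 0}"
    by (rule closed_Collect_le[OF c continuous_on_const])
  then have "closure \<Omega> \<subseteq> {x. \<rho> x \<le> 0}" unfolding \<Omega> by (intro closure_minimal) auto
  moreover have "x \<in> closure \<Omega>" "x \<notin> \<Omega>"
    using assms(1,3) by (auto simp: frontier_def interior_open)
  ultimately show ?thesis using \<Omega> by force
qed

lemma defining_function_nonpos_on_closure:
  assumes "open \<Omega>" "defining_function \<Omega> \<rho>" "x \<in> closure \<Omega>"
  shows "\<rho> x \<le> 0" "\<rho> x = 0 \<Longrightarrow> x \<in> frontier \<Omega>" "\<rho> x < 0 \<longleftrightarrow> x \<in> \<Omega>"
  using defining_function_zero_on_frontier[OF assms(1,2), of x] assms
  unfolding defining_function_def by (auto simp: frontier_def interior_open) (cases "\<rho> x < 0"; simp)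

lemma smooth_fun_has_derivative:
  assumes "smooth_fun \<rho>"
  shows "(\<rho> has_derivative (\<lambda>h. grad \<rho> x \<bullet> h)) (at x)"
  using assms unfolding smooth_fun_def by (blast intro: Ck_Suc_0_has_derivative)

lemma smooth_fun_continuous_grad:
  assumes "smooth_fun \<rho>"
  shows "continuous_on UNIV (grad \<rho>)"
proof -
  have "Ck (Suc 0) \<rho>" using assms unfolding smooth_fun_def by blast
  then show ?thesis unfolding grad_def by (intro continuous_on_vec_lambda) auto
qed

lemma smooth_fun_jet2:
  fixes \<rho> :: "real^'n::finite \<Rightarrow> real"
  assumes "smooth_fun \<rho>"
  obtains A where "jet2 \<rho> (grad \<rho>) A x" "trace_op A = (\<Sum>i\<in>UNIV. pd i (pd i \<rho>) x)"
proof -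
  have 2: "Ck (Suc (Suc 0)) \<rho>" using assms unfolding smooth_fun_def by blast
  let ?A = "\<lambda>h. \<chi> i. grad (pd i \<rho>) x \<bullet> h"
  have "(grad \<rho> has_derivative ?A) (at x)"
  proof (subst has_derivative_componentwise_within, intro ballI)
    fix b :: "real^'n" assume "b \<in> Basis"
    then obtain i where b: "b = axis i 1" by (auto simp: Basis_vec_def)
    have "Ck (Suc 0) (pd i \<rho>)" using 2 by simp
    then have "(pd i \<rho> has_derivative (\<lambda>h. grad (pd i \<rho>) x \<bullet> h)) (at x)" by (rule Ck_Suc_0_has_derivative)
    then show "((\<lambda>x. grad \<rho> x \<bullet> b) has_derivative (\<lambda>h. ?A h \<bullet> b)) (at x)"
      by (simp add: b inner_axis grad_def)
  qed
  then have "jet2 \<rho> (grad \<rho>) ?A x"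
    unfolding jet2_def using smooth_fun_has_derivative[OF assms] by (auto intro: always_eventually)
  moreover have "trace_op ?A = (\<Sum>i\<in>UNIV. pd i (pd i \<rho>) x)"
    by (simp add: trace_op_def inner_axis grad_def)
  ultimately show thesis by (rule that)
qed

text \<open>The normal is a \<open>SOME\<close> choice among defining functions. If two of them had
  different unit gradients n and n' at x, then along n' - n the first would decrease and the second
  increase, so points near x would lie both inside and outside \<Omega>.\<close>

lemma outer_normal_eq:
  assumes "open \<Omega>" and d: "defining_function \<Omega> \<rho>" and x: "x \<in> frontier \<Omega>"
  shows "outer_normal \<Omega> x = (1 / norm (grad \<rho> x)) *\<^sub>R grad \<rho> x"
proof -
  define n where "n \<rho>' = (1 / norm (grad \<rho>' x)) *\<^sub>R grad \<rho>' x" for \<rho>' :: "real^'a \<Rightarrow> real"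
  have "\<exists>\<rho>'. defining_function \<Omega> \<rho>' \<and> outer_normal \<Omega> x = n \<rho>'"
    unfolding outer_normal_def n_def by (rule someI_ex) (use d in blast)
  then obtain \<rho>' where d': "defining_function \<Omega> \<rho>'" and eq: "outer_normal \<Omega> x = n \<rho>'" by blast
  have zero: "\<rho> x = 0" "\<rho>' x = 0" using defining_function_zero_on_frontier[OF assms(1) _ x] d d' by auto
  have nz: "grad \<rho> x \<noteq> 0" "grad \<rho>' x \<noteq> 0" using zero d d' unfolding defining_function_def by auto
  have line: "((\<lambda>t. f (x + t *\<^sub>R h)) has_real_derivative grad f x \<bullet> h) (at 0)"
    if "defining_function \<Omega> f" for f h
  proof -
    have "(f has_derivative (\<lambda>h. grad f x \<bullet> h)) (at (x + 0 *\<^sub>R h))"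
      using that smooth_fun_has_derivative[of f x] unfolding defining_function_def by simp
    then have "((\<lambda>t. f (x + t *\<^sub>R h)) has_derivative (\<lambda>t. grad f x \<bullet> (t *\<^sub>R h))) (at 0)"
      by (rule has_derivative_compose[rotated]) (auto intro!: derivative_eq_intros)
    then show ?thesis by (simp add: has_field_derivative_def mult_commute_abs)
  qed
  have "n \<rho> = n \<rho>'"
  proof (rule ccontr)
    assume ne: "n \<rho> \<noteq> n \<rho>'"
    define h where "h = n \<rho>' - n \<rho>"
    have unit: "n \<rho> \<bullet> n \<rho> = 1" "n \<rho>' \<bullet> n \<rho>' = 1"
      using nz by (simp_all add: n_def power2_norm_eq_inner[symmetric] power2_eq_square)
    have "0 < h \<bullet> h" using ne by (simp add: h_def)
    also have "h \<bullet> h = 2 - 2 * (n \<rho> \<bullet> n \<rho>')"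
      by (simp add: h_def inner_diff_left inner_diff_right unit inner_commute)
    finally have "n \<rho> \<bullet> h < 0" "n \<rho>' \<bullet> h > 0"
      by (simp_all add: h_def inner_diff_right unit inner_commute)
    then have "grad \<rho> x \<bullet> h < 0" "grad \<rho>' x \<bullet> h > 0"
      using nz by (simp_all add: n_def divide_less_0_iff zero_less_divide_iff)
    then obtain d1 d2 where d12: "d1 > 0" "\<forall>t>0. t < d1 \<longrightarrow> \<rho> (x + t *\<^sub>R h) < \<rho> x"
        "d2 > 0" "\<forall>t>0. t < d2 \<longrightarrow> \<rho>' x < \<rho>' (x + t *\<^sub>R h)"
      using DERIV_neg_dec_right[OF line[OF d, of h]] DERIV_pos_inc_right[OF line[OF d', of h]] by auto
    define t where "t = min d1 d2 / 2"
    have "0 < t" "t < d1" "t < d2" using d12 by (auto simp: t_def min_def)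
    then have "\<rho> (x + t *\<^sub>R h) < 0" "0 < \<rho>' (x + t *\<^sub>R h)" using d12 zero by auto
    moreover have "x + t *\<^sub>R h \<in> \<Omega> \<longleftrightarrow> \<rho> (x + t *\<^sub>R h) < 0" "x + t *\<^sub>R h \<in> \<Omega> \<longleftrightarrow> \<rho>' (x + t *\<^sub>R h) < 0"
      using d d' unfolding defining_function_def by blast+
    ultimately show False by simp
  qed
  then show ?thesis using eq by (simp add: n_def)
qed

section \<open>The barrier at the frontier\<close>

text \<open>The maximum of -\<rho> and |grad \<rho>| is positive on the compact closure, hence at
  least some k > 0. Where -\<rho> is at most k/2, the gradient must account for k.\<close>

lemma grad_bounded_below_near_frontier:
  assumes "open \<Omega>" "bounded \<Omega>" "defining_function \<Omega> \<rho>"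
  obtains s \<gamma> where "s > 0" "\<gamma> > 0" "\<And>x. x \<in> closure \<Omega> \<Longrightarrow> \<rho> x \<ge> - s \<Longrightarrow> norm (grad \<rho> x) \<ge> \<gamma>"
proof (cases "closure \<Omega> = {}")
  case True
  then show thesis using that[of 1 1] by simp
next
  case False
  have sm: "smooth_fun \<rho>" using assms(3) by (simp add: defining_function_def)
  let ?k = "\<lambda>x. max (- \<rho> x) (norm (grad \<rho> x))"
  have \<rho>c: "continuous_on (closure \<Omega>) \<rho>"
    using sm Ck_imp_continuous unfolding smooth_fun_def by (blast intro: continuous_on_subset)
  have "continuous_on (closure \<Omega>) ?k"
    by (intro continuous_intros \<rho>c continuous_on_subset[OF smooth_fun_continuous_grad[OF sm]]) auto
  then obtain x where x: "x \<in> closure \<Omega>" "\<And>y. y \<in> closure \<Omega> \<Longrightarrow> ?k x \<le> ?k y"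
    using continuous_attains_inf[of "closure \<Omega>" ?k] False assms(2) by (auto simp: compact_closure)
  have k: "0 < ?k x"
  proof (cases "\<rho> x = 0")
    case True
    then have "grad \<rho> x \<noteq> 0" using assms(3) by (simp add: defining_function_def)
    then show ?thesis by (simp add: less_max_iff_disj)
  next
    case False
    then show ?thesis using defining_function_nonpos_on_closure(1)[OF assms(1,3) x(1)] by (simp add: less_max_iff_disj)
  qed
  define k where "k = ?k x"
  have "k \<le> norm (grad \<rho> y)" if "y \<in> closure \<Omega>" "\<rho> y \<ge> - (k / 2)" for y
    using x(2)[OF that(1)] that(2) k unfolding k_def[symmetric] by linarith
  then show thesis using that[of "k / 2" k] k unfolding k_def[symmetric] by simp
qed

text \<open>The barrier equals m/2 on the inner level set and 0 on the frontier, so w minus the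
  barrier has a reserve of m/2 on the inner side. An interior minimum is excluded by the Laplacian,
  a frontier minimum by slopes: going inward the barrier grows linearly, while the Neumann condition
  makes w flat to first order. No value of w on the frontier enters.\<close>

lemma positivity_reaches_boundary:
  fixes \<Omega> :: "(real^'n::finite) set"
  assumes \<Omega>: "open \<Omega>" "bounded \<Omega>" and df: "defining_function \<Omega> \<rho>"
  shows "\<exists>s0>0. \<forall>s m. 0 < s \<longrightarrow> s \<le> s0 \<longrightarrow> 0 < m \<longrightarrow> (\<exists>e>0. \<forall>w g. C1_closure_grad \<Omega> w g \<longrightarrow>
    (\<forall>x\<in>frontier \<Omega>. g x \<bullet> outer_normal \<Omega> x = 0) \<longrightarrow> lap_le {x\<in>\<Omega>. - s < \<rho> x} w (\<lambda>_. e) \<longrightarrow>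
    (\<forall>x\<in>\<Omega>. \<rho> x = - s \<longrightarrow> m \<le> w x) \<longrightarrow> (\<forall>x\<in>closure \<Omega>. - s \<le> \<rho> x \<longrightarrow> m / 2 \<le> w x))"
proof -
  have sm: "smooth_fun \<rho>" using df by (simp add: defining_function_def)
  have \<rho>c: "continuous_on UNIV \<rho>" using sm Ck_imp_continuous unfolding smooth_fun_def by blast
  have \<rho>o: "\<Omega> = {x. \<rho> x < 0}" using df by (simp add: defining_function_def)
  obtain s0 \<gamma> where s0: "s0 > 0" and \<gamma>: "\<gamma> > 0" "\<And>x. x \<in> closure \<Omega> \<Longrightarrow> \<rho> x \<ge> - s0 \<Longrightarrow> norm (grad \<rho> x) \<ge> \<gamma>"
    using grad_bounded_below_near_frontier[OF \<Omega> df] by blast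
  have cc: "compact (closure \<Omega>)" using \<Omega> by (simp add: compact_closure)
  let ?L = "\<lambda>x. \<Sum>i\<in>UNIV. pd i (pd i \<rho>) x"
  have "Ck (Suc (Suc 0)) \<rho>" using sm unfolding smooth_fun_def by blast
  then have "continuous_on UNIV ?L" by (intro continuous_intros) auto
  then have "compact (?L ` closure \<Omega>)"
    by (intro compact_continuous_image cc) (rule continuous_on_subset, auto)
  then have "bounded (?L ` closure \<Omega>)" by (rule compact_imp_bounded)
  then obtain L where "\<forall>v\<in>?L ` closure \<Omega>. norm v \<le> L" unfolding bounded_iff by blast
  then have L: "\<bar>?L x\<bar> \<le> L" if "x \<in> closure \<Omega>" for x using that by simp
  \<comment> \<open>With this choice \<alpha> |grad \<rho>|^2 exceeds the absolute Laplacian of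
    \<rho> by at least 1 throughout the collar.\<close>
  define L' where "L' = \<bar>L\<bar> + 1"
  define \<alpha> where "\<alpha> = L' / \<gamma>\<^sup>2"
  have \<alpha>: "\<alpha> > 0" using \<gamma> by (simp add: \<alpha>_def L'_def)
  show ?thesis
  proof (rule exI[of _ s0], rule conjI[OF s0], intro allI impI)
    fix s m :: real assume s: "0 < s" "s \<le> s0" and m: "0 < m"
    \<comment> \<open>Normalises the barrier to m/2 on the level set
      \<open>\<rho> = - s\<close>.\<close>
    define \<kappa> where "\<kappa> = m / (2 * (exp (\<alpha> * s) - 1))"
    have E: "exp (\<alpha> * s) - 1 > 0" using \<alpha> s by simp
    have \<kappa>: "\<kappa> > 0" using m E by (simp add: \<kappa>_def)
    define e where "e = \<kappa> * \<alpha> / 2"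
    have e: "e > 0" using \<kappa> \<alpha> by (simp add: e_def)
    show "\<exists>e>0. \<forall>w g. C1_closure_grad \<Omega> w g \<longrightarrow>
    (\<forall>x\<in>frontier \<Omega>. g x \<bullet> outer_normal \<Omega> x = 0) \<longrightarrow> lap_le {x\<in>\<Omega>. - s < \<rho> x} w (\<lambda>_. e) \<longrightarrow>
    (\<forall>x\<in>\<Omega>. \<rho> x = - s \<longrightarrow> m \<le> w x) \<longrightarrow> (\<forall>x\<in>closure \<Omega>. - s \<le> \<rho> x \<longrightarrow> m / 2 \<le> w x)"
    proof (rule exI[of _ e], rule conjI[OF e], intro allI impI ballI)
      fix w g y
      assume C1: "C1_closure_grad \<Omega> w g" and neu: "\<forall>x\<in>frontier \<Omega>. g x \<bullet> outer_normal \<Omega> x = 0"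
        and lap: "lap_le {x\<in>\<Omega>. - s < \<rho> x} w (\<lambda>_. e)" and wm: "\<forall>x\<in>\<Omega>. \<rho> x = - s \<longrightarrow> m \<le> w x"
        and y: "y \<in> closure \<Omega>" "- s \<le> \<rho> y"
      have wc: "continuous_on (closure \<Omega>) w" and gc: "continuous_on (closure \<Omega>) g"
        and wd: "\<And>x. x \<in> \<Omega> \<Longrightarrow> (w has_derivative (\<lambda>h. g x \<bullet> h)) (at x)"
        using C1 by (auto simp: C1_closure_grad_def)
      define \<psi> where "\<psi> x = \<kappa> * (exp (\<alpha> * (-1 * \<rho> x)) - 1)" for x
      define S where "S = closure \<Omega> \<inter> {x. - s \<le> \<rho> x}"
      have cS: "compact S"
        unfolding S_def by (intro compact_Int_closed cc closed_Collect_le continuous_on_const \<rho>c)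
      have yS: "y \<in> S" using y by (simp add: S_def)
      have "continuous_on S (\<lambda>x. w x - \<psi> x)"
        unfolding \<psi>_def S_def
        by (intro continuous_intros continuous_on_subset[OF wc] continuous_on_subset[OF \<rho>c]) auto
      then obtain z where z: "z \<in> S" "\<And>v. v \<in> S \<Longrightarrow> w z - \<psi> z \<le> w v - \<psi> v"
        using continuous_attains_inf[OF cS] yS by blast
      have zc: "z \<in> closure \<Omega>" "- s \<le> \<rho> z" using z(1) by (auto simp: S_def)
      have \<rho>z: "\<rho> z \<le> 0" by (rule defining_function_nonpos_on_closure[OF \<Omega>(1) df zc(1)])
      have G: "norm (grad \<rho> z) \<ge> \<gamma>" using \<gamma>(2)[OF zc(1)] zc(2) s by simp
      have \<psi>_nonneg: "\<psi> x \<ge> 0" if "x \<in> closure \<Omega>" for x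
        using defining_function_nonpos_on_closure(1)[OF \<Omega>(1) df that] \<kappa> \<alpha>
        by (auto simp: \<psi>_def mult_nonneg_nonpos)
      consider "\<rho> z = - s" | "- s < \<rho> z" "\<rho> z < 0" | "\<rho> z = 0" using \<rho>z zc by linarith
      then have "m / 2 \<le> w z - \<psi> z"
      proof cases
        case 1
        then have "z \<in> \<Omega>" using \<rho>o s by auto
        then have "m \<le> w z" using wm 1 by blast
        moreover have "m / (2 * X) * X = m / 2" if "X > 0" for X :: real using that by simp
        then have "\<kappa> * (exp (\<alpha> * s) - 1) = m / 2" unfolding \<kappa>_def using E by blast
        then have "\<psi> z = m / 2" using 1 by (simp add: \<psi>_def)
        ultimately show ?thesis by simp
      next
        case 2
        let ?V = "{x\<in>\<Omega>. - s < \<rho> x}"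
        have zV: "z \<in> ?V" using 2 \<rho>o by auto
        have "open ?V"
        proof -
          have "?V = {x. \<rho> x < 0} \<inter> {x. - s < \<rho> x}" using \<rho>o by auto
          then show ?thesis
            by (simp only:) (intro open_Int open_Collect_less continuous_on_const \<rho>c)
        qed
        then have "\<forall>\<^sub>F v in nhds z. v \<in> ?V" using zV by (rule eventually_nhds_in_open)
        then have touch: "\<forall>\<^sub>F v in nhds z. w z - \<psi> z \<le> w v - \<psi> v"
        proof eventually_elim
          case (elim v)
          then show ?case using closure_subset[of \<Omega>] by (intro z(2)) (auto simp: S_def)
        qed
        obtain A where A: "jet2 \<rho> (grad \<rho>) A z" "trace_op A = ?L z"
          using smooth_fun_jet2[OF sm] by blast
        obtain g' A' where jet: "jet2 \<psi> g' A' z"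
          and tr: "trace_op A' = \<kappa> * \<alpha> * exp (\<alpha> * (-1 * \<rho> z)) *
            (trace_op (\<lambda>h. -1 *\<^sub>R A h) + \<alpha> * ((-1 *\<^sub>R grad \<rho> z) \<bullet> (-1 *\<^sub>R grad \<rho> z)))"
          unfolding \<psi>_def by (rule jet2_exp_barrier[OF jet2_cmult[OF A(1), of "-1"], of \<kappa> \<alpha>])
        have "\<gamma>\<^sup>2 \<le> (norm (grad \<rho> z))\<^sup>2" using G \<gamma> by (intro power_mono) auto
        then have "\<alpha> * \<gamma>\<^sup>2 \<le> \<alpha> * (norm (grad \<rho> z))\<^sup>2" using \<alpha> by simp
        moreover have "\<alpha> * \<gamma>\<^sup>2 = L'" using \<gamma> by (simp add: \<alpha>_def)
        ultimately have "1 \<le> trace_op (\<lambda>h. -1 *\<^sub>R A h) + \<alpha> * ((-1 *\<^sub>R grad \<rho> z) \<bullet> (-1 *\<^sub>R grad \<rho> z))"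
          unfolding trace_op_cmult A(2) using L[OF zc(1)] by (simp add: L'_def power2_norm_eq_inner)
        moreover have "1 \<le> exp (\<alpha> * (-1 * \<rho> z))" using \<alpha> \<rho>z by (simp add: mult_nonneg_nonpos)
        ultimately have "\<kappa> * \<alpha> * 1 * 1 \<le> trace_op A'"
          unfolding tr using \<kappa> \<alpha> by (intro mult_mono mult_left_mono) auto
        moreover have "trace_op A' \<le> e" by (rule lap_leD[OF lap zV jet touch])
        moreover have "2 * e = \<kappa> * \<alpha> * 1 * 1" by (simp add: e_def)
        ultimately have "2 * e \<le> e" by linarith
        then show ?thesis using e by simp
      next
        case 3
        have zf: "z \<in> frontier \<Omega>" using defining_function_nonpos_on_closure(2)[OF \<Omega>(1) df zc(1) 3] .
        define Gz where "Gz = norm (grad \<rho> z)"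
        have Gz: "Gz > 0" using G \<gamma>(1) unfolding Gz_def by linarith
        define n where "n = (1 / Gz) *\<^sub>R grad \<rho> z"
        have n: "outer_normal \<Omega> z = n" unfolding n_def Gz_def by (rule outer_normal_eq[OF \<Omega>(1) df zf])
        have nn: "norm n = 1" using Gz by (simp add: n_def Gz_def)
        have gn: "g z \<bullet> n = 0" using neu zf n by auto
        have Gn: "grad \<rho> z \<bullet> n = Gz" using Gz by (simp add: n_def Gz_def power2_norm_eq_inner[symmetric] power2_eq_square)
        \<comment> \<open>A lower bound for the growth rate of the barrier along the inward normal;
          half of \<open>Gz\<close> is given up to the differentiability error of \<rho>.\<close>
        define p where "p = \<kappa> * \<alpha> * Gz / 2"
        have p: "p > 0" using \<kappa> \<alpha> Gz by (simp add: p_def)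
        have "Gz / 2 > 0" using Gz by simp
        then obtain d1 where d1: "d1 > 0" "\<And>v. norm (v - z) < d1 \<Longrightarrow> norm (\<rho> v - \<rho> z - grad \<rho> z \<bullet> (v - z)) \<le> Gz / 2 * norm (v - z)"
          using smooth_fun_has_derivative[OF sm, of z] unfolding has_derivative_at_alt by blast
        obtain d2 where d2: "d2 > 0" "\<And>v. v \<in> closure \<Omega> \<Longrightarrow> dist v z < d2 \<Longrightarrow> dist (g v) (g z) < p"
          using gc zc(1) p unfolding continuous_on_iff by blast
        have "isCont \<rho> z" using \<rho>c by (simp add: continuous_on_eq_continuous_at)
        then obtain d3 where d3: "d3 > 0" "\<And>v. dist v z < d3 \<Longrightarrow> \<bar>\<rho> v - \<rho> z\<bar> < s"
          using s unfolding continuous_at_eps_delta dist_real_def by blast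
        define t where "t = min d1 (min d2 d3) / 2"
        have t: "0 < t" "t < d1" "t < d2" "t < d3" using d1(1) d2(1) d3(1) by (auto simp: t_def min_def)
        have desc: "\<rho> (z - \<tau> *\<^sub>R n) \<le> - (Gz / 2 * \<tau>)" if "0 \<le> \<tau>" "\<tau> \<le> t" for \<tau>
        proof -
          have "norm (z - \<tau> *\<^sub>R n - z) = \<tau>" using that nn by simp
          then have "\<bar>\<rho> (z - \<tau> *\<^sub>R n) - 0 - grad \<rho> z \<bullet> (z - \<tau> *\<^sub>R n - z)\<bar> \<le> Gz / 2 * \<tau>"
            using d1(2)[of "z - \<tau> *\<^sub>R n"] that t(2) 3 by (simp only: real_norm_def)
          moreover have "grad \<rho> z \<bullet> (z - \<tau> *\<^sub>R n - z) = - \<tau> * Gz" using Gn by simp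
          ultimately have "\<bar>\<rho> (z - \<tau> *\<^sub>R n) - 0 - (- \<tau> * Gz)\<bar> \<le> Gz / 2 * \<tau>" by (simp only:)
          then have "\<rho> (z - \<tau> *\<^sub>R n) - 0 - (- \<tau> * Gz) \<le> Gz / 2 * \<tau>" by (rule abs_le_D1)
          then show ?thesis by (simp add: algebra_simps)
        qed
        have in\<Omega>: "z - \<tau> *\<^sub>R n \<in> \<Omega>" if "0 < \<tau>" "\<tau> \<le> t" for \<tau>
        proof -
          have "Gz / 2 * \<tau> > 0" using Gz that by simp
          then show ?thesis using desc[of \<tau>] that \<rho>o by auto
        qed
        have incl: "z - \<tau> *\<^sub>R n \<in> closure \<Omega>" if "0 \<le> \<tau>" "\<tau> \<le> t" for \<tau>
          using in\<Omega>[of \<tau>] that zc(1) closure_subset[of \<Omega>] by (cases "\<tau> = 0") auto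
        \<comment> \<open>w is differentiable only inside \<Omega>, so the normal slope at z is
          reached by the mean value theorem on the inward segment together with continuity of g up
          to the frontier.\<close>
        define f where "f \<tau> = w (z - \<tau> *\<^sub>R n)" for \<tau>
        have "continuous_on {0..t} f"
          unfolding f_def by (rule continuous_on_compose2[OF wc]) (auto intro!: continuous_intros incl)
        moreover have "(f has_derivative (\<lambda>h. g (z - \<tau> *\<^sub>R n) \<bullet> (- (h *\<^sub>R n)))) (at \<tau>)" if "0 < \<tau>" "\<tau> < t" for \<tau>
          unfolding f_def
          by (rule has_derivative_compose[where f = "\<lambda>\<tau>. z - \<tau> *\<^sub>R n", OF _ wd[OF in\<Omega>]])
            (use that in \<open>auto intro!: derivative_eq_intros\<close>)
        ultimately obtain \<xi> where \<xi>: "0 < \<xi>" "\<xi> < t" "f t - f 0 = g (z - \<xi> *\<^sub>R n) \<bullet> (- ((t - 0) *\<^sub>R n))"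
          using mvt[OF t(1), of f "\<lambda>\<tau> h. g (z - \<tau> *\<^sub>R n) \<bullet> (- (h *\<^sub>R n))"] by blast
        have "dist (g (z - \<xi> *\<^sub>R n)) (g z) < p"
          using \<xi> t nn by (intro d2(2) incl) (auto simp: dist_norm)
        then have "\<bar>(g (z - \<xi> *\<^sub>R n) - g z) \<bullet> n\<bar> < p"
          using Cauchy_Schwarz_ineq2[of "g (z - \<xi> *\<^sub>R n) - g z" n] nn by (simp add: dist_norm)
        then have "- (g (z - \<xi> *\<^sub>R n) \<bullet> n) < p" by (simp add: inner_diff_left gn)
        then have "t * - (g (z - \<xi> *\<^sub>R n) \<bullet> n) < t * p" using t(1) by (intro mult_strict_left_mono)
        then have up: "f t - f 0 < t * p" using \<xi>(3) by simp
        have "dist (z - t *\<^sub>R n) z < d3" using t nn by (simp add: dist_norm)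
        then have "z - t *\<^sub>R n \<in> S" using incl[of t] d3(2)[of "z - t *\<^sub>R n"] t(1) 3 by (auto simp: S_def)
        then have "w z - \<psi> z \<le> w (z - t *\<^sub>R n) - \<psi> (z - t *\<^sub>R n)" by (rule z(2))
        moreover have "\<psi> z = 0" using 3 by (simp add: \<psi>_def)
        ultimately have low: "\<psi> (z - t *\<^sub>R n) \<le> f t - f 0" by (simp add: f_def)
        have "\<alpha> * (-1 * \<rho> (z - t *\<^sub>R n)) \<le> exp (\<alpha> * (-1 * \<rho> (z - t *\<^sub>R n))) - 1"
          using exp_ge_add_one_self[of "\<alpha> * (-1 * \<rho> (z - t *\<^sub>R n))"] by linarith
        moreover have "\<alpha> * (Gz / 2 * t) \<le> \<alpha> * (-1 * \<rho> (z - t *\<^sub>R n))"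
          using desc[of t] t \<alpha> by (intro mult_left_mono) auto
        ultimately have "\<kappa> * (\<alpha> * (Gz / 2 * t)) \<le> \<psi> (z - t *\<^sub>R n)"
          unfolding \<psi>_def using \<kappa> by (intro mult_left_mono) auto
        then show ?thesis using low up by (simp add: p_def algebra_simps)
      qed
      then have "m / 2 \<le> w y - \<psi> y" using z(2)[OF yS] by linarith
      then show "m / 2 \<le> w y" using \<psi>_nonneg[OF y(1)] by linarith
    qed
  qed
qed

section \<open>Positivity on the boundary\<close>

lemma Lp_on_integrable:
  assumes "open \<Omega>" "bounded \<Omega>" "p \<ge> 1" "Lp_on \<Omega> p f"
  shows "set_integrable lebesgue \<Omega> f"
  unfolding set_integrable_def
proof (rule Bochner_Integration.integrable_bound)
  have \<Omega>: "\<Omega> \<in> sets lebesgue" using assms(1) by auto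
  have 1: "integrable lebesgue (\<lambda>x. indicator \<Omega> x :: real)"
    using bounded_set_imp_lmeasurable[OF assms(2) \<Omega>] by (simp add: lmeasurable_iff_integrable)
  have 2: "integrable lebesgue (\<lambda>x. indicator \<Omega> x *\<^sub>R \<bar>f x\<bar> powr p)"
    using assms(4) by (simp add: Lp_on_def set_integrable_def)
  show "integrable lebesgue (\<lambda>x. indicator \<Omega> x + indicator \<Omega> x *\<^sub>R \<bar>f x\<bar> powr p)"
    by (rule Bochner_Integration.integrable_add[OF 1 2])
  show "(\<lambda>x. indicator \<Omega> x *\<^sub>R f x) \<in> borel_measurable lebesgue"
    using assms(4) \<Omega> borel_measurable_restrict_space_iff[of \<Omega> lebesgue f] by (simp add: Lp_on_def)
  have "\<bar>f x\<bar> \<le> 1 + \<bar>f x\<bar> powr p" for x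
  proof (cases "\<bar>f x\<bar> \<le> 1")
    case True
    then show ?thesis by (simp add: add_increasing2)
  next
    case False
    then have "\<bar>f x\<bar> powr 1 \<le> \<bar>f x\<bar> powr p" using assms(3) by (intro powr_mono) auto
    then show ?thesis using False by simp
  qed
  then show "AE x in lebesgue. norm (indicator \<Omega> x *\<^sub>R f x) \<le> norm (indicator \<Omega> x + indicator \<Omega> x *\<^sub>R \<bar>f x\<bar> powr p)"
    by (intro AE_I2) (auto simp: indicator_def abs_of_nonneg add_nonneg_nonneg)
qed

lemma set_integrable_mult_test_fun:
  assumes "set_integrable lebesgue \<Omega> f" "test_fun \<Omega>' \<phi>"
  shows "integrable lebesgue (\<lambda>x. indicator \<Omega> x * (f x * \<phi> x))"
proof -
  have c: "continuous_on UNIV \<phi>" and K: "compact (closure {x. \<phi> x \<noteq> 0})"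
    using assms(2) Ck_imp_continuous unfolding test_fun_def smooth_fun_def by blast+
  obtain B where B: "\<forall>x. \<bar>\<phi> x\<bar> \<le> B"
    using bounded_of_compact_support[OF c _ K] closure_subset[of "{x. \<phi> x \<noteq> 0}"] by auto
  have "\<phi> \<in> borel_measurable lebesgue"
    using borel_measurable_continuous_onI[OF c] by (auto intro: measurable_completion)
  then have "integrable lebesgue (\<lambda>x. (indicator \<Omega> x *\<^sub>R f x) * \<phi> x)"
    using assms(1) B by (intro integrable_mult_bounded[where B = B]) (auto simp: set_integrable_def)
  then show ?thesis by (simp add: mult.assoc)
qed

text \<open>Two integrations by parts, the first tested with a partial derivative of \<phi>, cancel
  each other's sign. F is the trace of the weak Hessian; the equation identifies it only almost
  everywhere.\<close>

lemma solution_weak_lap: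
  assumes \<Omega>: "open \<Omega>" "bounded \<Omega>" and r: "r \<ge> 1" and sol: "nonneg_solution \<Omega> r a q u"
  obtains F where "weak_lap \<Omega> u F" "AE x in lebesgue. x \<in> \<Omega> \<longrightarrow> F x = - (a x * u x powr q)"
proof -
  obtain D D2 where W: "W2p_derivs \<Omega> r u D D2"
    and eq: "AE x in lebesgue. x \<in> \<Omega> \<longrightarrow> - (\<Sum>i\<in>UNIV. D2 i i x) = a x * u x powr q"
    using sol by (auto simp: nonneg_solution_def)
  have uc: "continuous_on \<Omega> u"
    using sol closure_subset[of \<Omega>] unfolding nonneg_solution_def C1_closure_grad_def by (blast intro: continuous_on_subset)
  define F where "F x = (\<Sum>i\<in>UNIV. D2 i i x)" for x
  have ui: "set_integrable lebesgue \<Omega> u" using W Lp_on_integrable[OF \<Omega> r] by (simp add: W2p_derivs_def)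
  have Di: "set_integrable lebesgue \<Omega> (D2 i i)" for i using W Lp_on_integrable[OF \<Omega> r] by (simp add: W2p_derivs_def)
  have Fi: "set_integrable lebesgue \<Omega> F"
    using Di unfolding F_def set_integrable_def scaleR_sum_right by (intro Bochner_Integration.integrable_sum)
  have "(LINT x:\<Omega>|lebesgue. u x * (\<Sum>i\<in>UNIV. pd i (pd i \<phi>) x)) = (LINT x:\<Omega>|lebesgue. F x * \<phi> x)"
    if \<phi>: "test_fun \<Omega> \<phi>" for \<phi>
  proof -
    have each: "(LINT x:\<Omega>|lebesgue. u x * pd i (pd i \<phi>) x) = (LINT x:\<Omega>|lebesgue. D2 i i x * \<phi> x)" for i
    proof -
      have "weak_pd \<Omega> i u (D i)" "weak_pd \<Omega> i (D i) (D2 i i)" using W by (auto simp: W2p_derivs_def)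
      then show ?thesis using \<phi> test_fun_pd[OF \<phi>, of i] unfolding weak_pd_def by simp
    qed
    have "(LINT x:\<Omega>|lebesgue. u x * (\<Sum>i\<in>UNIV. pd i (pd i \<phi>) x)) =
        (\<integral>x. (\<Sum>i\<in>UNIV. indicator \<Omega> x * (u x * pd i (pd i \<phi>) x)) \<partial>lebesgue)"
      by (simp only: set_lebesgue_integral_def sum_distrib_left real_scaleR_def)
    also have "\<dots> = (\<Sum>i\<in>UNIV. \<integral>x. indicator \<Omega> x * (u x * pd i (pd i \<phi>) x) \<partial>lebesgue)"
      by (intro Bochner_Integration.integral_sum set_integrable_mult_test_fun[OF ui test_fun_pd[OF test_fun_pd[OF \<phi>]]])
    also have "\<dots> = (\<Sum>i\<in>UNIV. \<integral>x. indicator \<Omega> x * (D2 i i x * \<phi> x) \<partial>lebesgue)"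
      using each unfolding set_lebesgue_integral_def by simp
    also have "\<dots> = (\<integral>x. (\<Sum>i\<in>UNIV. indicator \<Omega> x * (D2 i i x * \<phi> x)) \<partial>lebesgue)"
      by (intro Bochner_Integration.integral_sum[symmetric] set_integrable_mult_test_fun[OF Di \<phi>])
    also have "\<dots> = (LINT x:\<Omega>|lebesgue. F x * \<phi> x)"
      by (simp only: set_lebesgue_integral_def F_def sum_distrib_left sum_distrib_right real_scaleR_def)
    finally show ?thesis .
  qed
  then have "weak_lap \<Omega> u F" using uc ui Fi by (simp add: weak_lap_def)
  moreover have "AE x in lebesgue. x \<in> \<Omega> \<longrightarrow> F x = - (a x * u x powr q)"
    using eq by eventually_elim (auto simp: F_def)
  ultimately show thesis by (rule that)
qed

lemma weak_lap_minus:
  assumes "weak_lap \<Omega> u F"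
  shows "weak_lap \<Omega> (\<lambda>x. - u x) (\<lambda>x. - F x)"
  using assms unfolding weak_lap_def
  by (auto simp: set_integrable_def set_lebesgue_integral_def intro: continuous_intros)

text \<open>\<open>Omega_plus\<close> and \<open>ess_supp\<close> are built from possibly
  uncountable unions of open sets. The Lindelof property reduces these to countable unions, for
  which the exceptional null sets can be joined.\<close>

lemma AE_Union_open:
  fixes \<U> :: "'a::euclidean_space set set"
  assumes "\<And>U. U \<in> \<U> \<Longrightarrow> open U" "\<And>U. U \<in> \<U> \<Longrightarrow> AE x in lebesgue. x \<in> U \<longrightarrow> Q x"
  shows "AE x in lebesgue. x \<in> \<Union>\<U> \<longrightarrow> Q x"
proof -
  obtain \<V> where \<V>: "\<V> \<subseteq> \<U>" "countable \<V>" "\<Union>\<V> = \<Union>\<U>" using Lindelof[of \<U>] assms(1) by blast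
  have "AE x in lebesgue. \<forall>U\<in>\<V>. x \<in> U \<longrightarrow> Q x"
    using \<V>(1) assms(2) by (subst AE_ball_countable[OF \<V>(2)]) blast
  then show ?thesis
  proof eventually_elim
    case (elim x)
    then show ?case using \<V>(3) by blast
  qed
qed

lemma Omega_plus_props:
  shows "open (Omega_plus \<Omega> a)" "Omega_plus \<Omega> a \<subseteq> \<Omega>" "AE x in lebesgue. x \<in> Omega_plus \<Omega> a \<longrightarrow> a x > 0"
proof -
  show "open (Omega_plus \<Omega> a)" unfolding Omega_plus_def by (rule open_Union) auto
  show "Omega_plus \<Omega> a \<subseteq> \<Omega>" unfolding Omega_plus_def by auto
  show "AE x in lebesgue. x \<in> Omega_plus \<Omega> a \<longrightarrow> a x > 0"
    unfolding Omega_plus_def by (rule AE_Union_open) auto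
qed

lemma AE_outside_ess_supp: "AE x in lebesgue. x \<in> \<Omega> - ess_supp \<Omega> f \<longrightarrow> f x = 0"
proof -
  let ?\<U> = "{U. open U \<and> (AE x in lebesgue. x \<in> U \<inter> \<Omega> \<longrightarrow> f x = 0)}"
  have "AE x in lebesgue. x \<in> \<Union>?\<U> \<longrightarrow> (x \<in> \<Omega> \<longrightarrow> f x = 0)"
    by (rule AE_Union_open) auto
  then show ?thesis by eventually_elim (auto simp: ess_supp_def)
qed

section \<open>Comparison in the domain and near its frontier\<close>

text \<open>Adding a small multiple of |y|^2 makes the function strictly subharmonic, which excludes
  an interior maximum. The multiple adds at most u(x)/2 on the closure, so u is still positive at
  the maximum point, which is therefore off the frontier.\<close>

lemma subharmonic_le_boundary_zero:
  fixes u :: "real^'n::finite \<Rightarrow> real"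
  assumes \<Omega>: "open \<Omega>" "bounded \<Omega>" and uc: "continuous_on (closure \<Omega>) u"
    and lap: "lap_le \<Omega> (\<lambda>x. - u x) (\<lambda>_. 0)" and bd: "\<And>x. x \<in> frontier \<Omega> \<Longrightarrow> u x \<le> 0" and x: "x \<in> \<Omega>"
  shows "u x \<le> 0"
proof (rule ccontr)
  assume "\<not> u x \<le> 0"
  then have ux: "u x > 0" by simp
  have cc: "compact (closure \<Omega>)" using \<Omega> by (simp add: compact_closure)
  obtain B where B: "\<And>y. y \<in> closure \<Omega> \<Longrightarrow> norm y \<le> B" "B > 0"
    using compact_imp_bounded[OF cc] unfolding bounded_pos by auto
  define \<kappa> where "\<kappa> = u x / (2 * B\<^sup>2)"
  have \<kappa>: "\<kappa> > 0" using ux B by (simp add: \<kappa>_def)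
  have xc: "x \<in> closure \<Omega>" using x closure_subset by blast
  define \<psi> where "\<psi> y = 0 + \<kappa> * (norm (y - 0))\<^sup>2" for y :: "real^'n"
  have "continuous_on (closure \<Omega>) (\<lambda>y. u y + \<psi> y)" unfolding \<psi>_def by (intro continuous_intros uc)
  then have "\<exists>z\<in>closure \<Omega>. \<forall>y\<in>closure \<Omega>. u y + \<psi> y \<le> u z + \<psi> z"
    by (rule continuous_attains_sup[OF cc, rotated]) (use xc in auto)
  then obtain z where z: "z \<in> closure \<Omega>" "\<And>y. y \<in> closure \<Omega> \<Longrightarrow> u y + \<psi> y \<le> u z + \<psi> z"
    by blast
  have "(norm z)\<^sup>2 \<le> B\<^sup>2" using B(1)[OF z(1)] by (intro power_mono) auto
  then have "\<psi> z \<le> \<kappa> * B\<^sup>2" using \<kappa> by (simp add: \<psi>_def)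
  also have "\<dots> < u x" using ux B by (simp add: \<kappa>_def)
  also have "u x \<le> u x + \<psi> x" using \<kappa> by (simp add: \<psi>_def)
  also have "\<dots> \<le> u z + \<psi> z" by (rule z(2)[OF xc])
  finally have "u z > 0" by simp
  then have "z \<notin> frontier \<Omega>" using bd[of z] by auto
  then have z\<Omega>: "z \<in> \<Omega>" using z(1) \<Omega>(1) by (auto simp: frontier_def interior_open)
  have "\<forall>\<^sub>F y in nhds z. y \<in> \<Omega>" using \<Omega>(1) z\<Omega> by (rule eventually_nhds_in_open)
  then have touch: "\<forall>\<^sub>F y in nhds z. - u z - \<psi> z \<le> - u y - \<psi> y"
  proof eventually_elim
    case (elim y)
    then show ?case using z(2)[of y] closure_subset[of \<Omega>] by auto
  qed
  have "jet2 \<psi> (\<lambda>y. (2 * \<kappa>) *\<^sub>R (y - 0)) (\<lambda>h. (2 * \<kappa>) *\<^sub>R h) z" unfolding \<psi>_def by (rule jet2_sqnorm)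
  from lap_leD[OF lap z\<Omega> this touch] have "2 * \<kappa> * real CARD('n) \<le> 0" by (simp only: trace_op_id)
  then show False using \<kappa> by (simp add: mult_le_0_iff)
qed

text \<open>The tubular neighbourhood is measured by distance, the barrier by level sets of \<rho>.
  Compactness compares the two: at distance at least \<sigma> from the frontier \<rho> has a
  negative maximum.\<close>

lemma collar_near_frontier:
  assumes "open \<Omega>" "bounded \<Omega>" "defining_function \<Omega> \<rho>" "\<sigma> > 0"
  obtains s where "s > 0" "\<And>x. x \<in> closure \<Omega> \<Longrightarrow> \<rho> x \<ge> - s \<Longrightarrow> infdist x (frontier \<Omega>) < \<sigma>"
proof -
  let ?K = "closure \<Omega> \<inter> {x. \<sigma> \<le> infdist x (frontier \<Omega>)}"
  have cK: "compact ?K"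
    using assms(2) by (intro compact_Int_closed closed_Collect_le continuous_intros) (auto simp: compact_closure)
  have \<rho>c: "continuous_on ?K \<rho>"
    using assms(3) Ck_imp_continuous unfolding defining_function_def smooth_fun_def by (blast intro: continuous_on_subset)
  show thesis
  proof (cases "?K = {}")
    case True
    then have "infdist x (frontier \<Omega>) < \<sigma>" if "x \<in> closure \<Omega>" for x using that by force
    then show thesis using that[of 1] by simp
  next
    case False
    then obtain z where z: "z \<in> ?K" "\<And>y. y \<in> ?K \<Longrightarrow> \<rho> y \<le> \<rho> z"
      using continuous_attains_sup[OF cK _ \<rho>c] by blast
    have "z \<notin> frontier \<Omega>" using z(1) assms(4) by auto
    then have neg: "\<rho> z < 0" using defining_function_nonpos_on_closure[OF assms(1,3), of z] z(1) by fastforce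
    show thesis
    proof (rule that[of "- \<rho> z / 2"])
      show "- \<rho> z / 2 > 0" using neg by simp
      fix x assume x: "x \<in> closure \<Omega>" "\<rho> x \<ge> - (- \<rho> z / 2)"
      show "infdist x (frontier \<Omega>) < \<sigma>"
      proof (rule ccontr)
        assume "\<not> ?thesis"
        then have "\<rho> x \<le> \<rho> z" using x(1) by (intro z(2)) auto
        then show False using x(2) neg by simp
      qed
    qed
  qed
qed

text \<open>\<open>H1'\<close> enters twice: connectedness lets positivity spread through
  \<open>Omega_plus\<close>, and the null set condition makes a nonpositive almost everywhere
  outside it, which is what rules out u = 0 on all of \<open>Omega_plus\<close>.\<close>

lemma solution_positive_on_frontier:
  fixes \<Omega> :: "(real^'n::finite) set"
  assumes dom: "smooth_bounded_domain \<Omega>" and r: "r \<ge> 1" and H: "H1' \<Omega> a" and \<sigma>: "\<sigma> > 0"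
    and tub: "\<Omega> - closure (inner_set \<Omega> \<sigma>) \<subseteq> Omega_plus \<Omega> a"
    and sol: "nonneg_solution \<Omega> r a q u" and nt: "nontrivial \<Omega> u"
  shows "\<forall>x\<in>frontier \<Omega>. u x > 0"
proof -
  have \<Omega>: "open \<Omega>" "bounded \<Omega>" using dom by (auto simp: smooth_bounded_domain_def)
  obtain \<rho> where df: "defining_function \<Omega> \<rho>" using dom by (auto simp: smooth_bounded_domain_def)
  define P where "P = Omega_plus \<Omega> a"
  note P = Omega_plus_props[of \<Omega> a, folded P_def]
  have Pc: "connected P" using H by (simp add: H1'_def P_def)
  obtain g where g: "C1_closure_grad \<Omega> u g" "\<forall>x\<in>frontier \<Omega>. g x \<bullet> outer_normal \<Omega> x = 0"
    and u0: "\<forall>x\<in>closure \<Omega>. u x \<ge> 0"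
    using sol by (auto simp: nonneg_solution_def)
  have uc: "continuous_on (closure \<Omega>) u" using g by (simp add: C1_closure_grad_def)
  have sub: "\<Omega> \<subseteq> closure \<Omega>" by (rule closure_subset)
  have ucP: "continuous_on P u" using uc P(2) sub by (meson continuous_on_subset order_trans)
  obtain F where F: "weak_lap \<Omega> u F" "AE x in lebesgue. x \<in> \<Omega> \<longrightarrow> F x = - (a x * u x powr q)"
    using solution_weak_lap[OF \<Omega> r sol] by blast
  have near: "x \<in> P" if "x \<in> \<Omega>" "infdist x (frontier \<Omega>) < \<sigma>" for x
  proof -
    have "closed {x. \<sigma> \<le> infdist x (frontier \<Omega>)}"
      by (intro closed_Collect_le continuous_intros)
    then have "closure (inner_set \<Omega> \<sigma>) \<subseteq> {x. \<sigma> \<le> infdist x (frontier \<Omega>)}"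
      by (rule closure_minimal[rotated]) (auto simp: inner_set_def)
    then show ?thesis using that tub by (force simp: P_def)
  qed
  have lapP: "lap_le P u (\<lambda>_. 0)"
  proof (rule lap_le_of_weak_lap[OF \<Omega>(1) F(1) P(1,2) continuous_on_const])
    show "AE x in lebesgue. x \<in> P \<longrightarrow> F x \<le> 0"
      using F(2) P(3) by eventually_elim (use P(2) in auto)
  qed
  have "\<exists>x\<in>P. u x > 0"
  proof (rule ccontr)
    assume "\<not> (\<exists>x\<in>P. u x > 0)"
    then have uP: "u x = 0" if "x \<in> P" for x
    proof -
      have "x \<in> closure \<Omega>" using that P(2) sub by blast
      then show ?thesis using u0 that \<open>\<not> (\<exists>x\<in>P. u x > 0)\<close> by force
    qed
    have null: "AE x in lebesgue. x \<notin> ess_supp \<Omega> (\<lambda>x. max (a x) 0) - P"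
      by (rule AE_not_in) (use H in \<open>simp add: H1'_def P_def\<close>)
    \<comment> \<open>Where u = 0 the source vanishes whatever a is, because
      \<open>0 powr q = 0\<close>; elsewhere a is at most 0 up to a null set.\<close>
    have "lap_le \<Omega> (\<lambda>x. - u x) (\<lambda>_. 0)"
    proof (rule lap_le_of_weak_lap[OF \<Omega>(1) weak_lap_minus[OF F(1)] \<Omega>(1) subset_refl continuous_on_const])
      show "AE x in lebesgue. x \<in> \<Omega> \<longrightarrow> - F x \<le> 0"
        using F(2) null AE_outside_ess_supp[of \<Omega> "\<lambda>x. max (a x) 0"]
      proof eventually_elim
        case (elim x)
        show ?case
        proof
          assume x: "x \<in> \<Omega>"
          show "- F x \<le> 0"
          proof (cases "x \<in> P")
            case True
            then show ?thesis using elim(1) x uP by simp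
          next
            case False
            then have "max (a x) 0 = 0" using elim(2,3) x by auto
            then have "a x \<le> 0" by (simp add: max_def split: if_splits)
            then show ?thesis using elim(1) x by (simp add: mult_nonpos_nonneg)
          qed
        qed
      qed
    qed
    \<comment> \<open>Points of \<Omega> near x lie in \<open>Omega_plus\<close>, where u vanishes
      by assumption, so continuity forces the boundary value.\<close>
    moreover have "u x \<le> 0" if x: "x \<in> frontier \<Omega>" for x
    proof (rule ccontr)
      assume "\<not> u x \<le> 0"
      then have ux: "u x > 0" by simp
      have xc: "x \<in> closure \<Omega>" using x by (simp add: frontier_def)
      then obtain d where d: "d > 0" "\<And>y. y \<in> closure \<Omega> \<Longrightarrow> dist y x < d \<Longrightarrow> dist (u y) (u x) < u x"
        using uc ux unfolding continuous_on_iff by blast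
      obtain y where y: "y \<in> \<Omega>" "dist y x < min d \<sigma>"
        using xc d(1) \<sigma> unfolding closure_approachable by (meson min_less_iff_conj)
      have "infdist y (frontier \<Omega>) \<le> dist y x" by (rule infdist_le[OF x])
      then have "u y = 0" using y by (intro uP near) auto
      moreover have "dist (u y) (u x) < u x" using y sub by (intro d(2)) auto
      ultimately show False using ux by (simp add: dist_real_def)
    qed
    ultimately have "u x \<le> 0" if "x \<in> \<Omega>" for x
      using subharmonic_le_boundary_zero[OF \<Omega> uc] that by blast
    then show False using nt u0 sub unfolding nontrivial_def by (meson dual_order.antisym subsetD)
  qed
  then obtain xp where xp: "xp \<in> P" "u xp > 0" by blast
  have pos: "u x > 0" if x: "x \<in> P" for x
  proof -
    obtain d where d: "d > 0" "\<And>y. y \<in> P \<Longrightarrow> dist y xp < d \<Longrightarrow> dist (u y) (u xp) < u xp / 2"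
      using ucP xp unfolding continuous_on_iff by (meson half_gt_zero)
    obtain c e where "c > 0" "e > 0" "\<forall>w. continuous_on P w \<longrightarrow> (\<forall>y\<in>P. 0 \<le> w y) \<longrightarrow> lap_le P w (\<lambda>_. e) \<longrightarrow>
      (\<forall>y\<in>ball xp d \<inter> P. u xp / 2 \<le> w y) \<longrightarrow> (\<forall>y\<in>{x}. c \<le> w y)"
      using positivity_spreads[OF P(1) Pc xp(1) d(1), of "u xp / 2" "{x}"] xp(2) x by auto
    moreover have "\<forall>y\<in>P. 0 \<le> u y" using u0 P(2) sub by blast
    moreover have "lap_le P u (\<lambda>_. e)" using lapP by (rule lap_le_mono) (use \<open>e > 0\<close> in auto)
    moreover have "\<forall>y\<in>ball xp d \<inter> P. u xp / 2 \<le> u y"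
    proof
      fix y assume "y \<in> ball xp d \<inter> P"
      then have "dist (u y) (u xp) < u xp / 2" by (intro d(2)) (auto simp: dist_commute)
      then have "\<bar>u y - u xp\<bar> < u xp / 2" by (simp only: dist_real_def)
      then show "u xp / 2 \<le> u y" unfolding abs_less_iff by linarith
    qed
    ultimately have "c \<le> u x" using ucP by blast
    then show ?thesis using \<open>c > 0\<close> by simp
  qed
  obtain s0 where s0: "s0 > 0" "\<forall>s m. 0 < s \<longrightarrow> s \<le> s0 \<longrightarrow> 0 < m \<longrightarrow> (\<exists>e>0. \<forall>w g. C1_closure_grad \<Omega> w g \<longrightarrow>
    (\<forall>x\<in>frontier \<Omega>. g x \<bullet> outer_normal \<Omega> x = 0) \<longrightarrow> lap_le {x\<in>\<Omega>. - s < \<rho> x} w (\<lambda>_. e) \<longrightarrow>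
    (\<forall>x\<in>\<Omega>. \<rho> x = - s \<longrightarrow> m \<le> w x) \<longrightarrow> (\<forall>x\<in>closure \<Omega>. - s \<le> \<rho> x \<longrightarrow> m / 2 \<le> w x))"
    using positivity_reaches_boundary[OF \<Omega> df] by blast
  obtain s1 where s1: "s1 > 0" "\<And>x. x \<in> closure \<Omega> \<Longrightarrow> \<rho> x \<ge> - s1 \<Longrightarrow> infdist x (frontier \<Omega>) < \<sigma>"
    using collar_near_frontier[OF \<Omega> df \<sigma>] by blast
  \<comment> \<open>\<open>s0\<close> makes the barrier available, \<open>s1\<close> keeps the
    collar inside \<open>Omega_plus\<close>.\<close>
  define s where "s = min s0 s1"
  have s: "0 < s" "s \<le> s0" "s \<le> s1" using s0(1) s1(1) by (auto simp: s_def)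
  have collar: "x \<in> P" if "x \<in> \<Omega>" "- s \<le> \<rho> x" for x
    using that s sub by (intro near s1(2)) auto
  obtain m where m: "m > 0" "\<forall>x\<in>\<Omega>. \<rho> x = - s \<longrightarrow> m \<le> u x"
  proof -
    let ?K = "closure \<Omega> \<inter> {x. \<rho> x = - s}"
    have \<rho>c: "continuous_on UNIV \<rho>"
      using df Ck_imp_continuous unfolding defining_function_def smooth_fun_def by blast
    have cK: "compact ?K"
      using \<Omega>(2) by (intro compact_Int_closed closed_Collect_eq \<rho>c continuous_on_const) (auto simp: compact_closure)
    show thesis
    proof (cases "?K = {}")
      case True
      then show thesis using that[of 1] sub by auto
    next
      case False
      then obtain z where z: "z \<in> ?K" "\<And>y. y \<in> ?K \<Longrightarrow> u z \<le> u y"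
        using continuous_attains_inf[OF cK _ continuous_on_subset[OF uc]] by auto
      then have "z \<in> \<Omega>" using defining_function_nonpos_on_closure(3)[OF \<Omega>(1) df, of z] s by auto
      then have "u z > 0" using z(1) by (intro pos collar) auto
      then show thesis using that[of "u z"] z(2) sub by auto
    qed
  qed
  obtain e where e: "e > 0" "\<forall>w g. C1_closure_grad \<Omega> w g \<longrightarrow>
    (\<forall>x\<in>frontier \<Omega>. g x \<bullet> outer_normal \<Omega> x = 0) \<longrightarrow> lap_le {x\<in>\<Omega>. - s < \<rho> x} w (\<lambda>_. e) \<longrightarrow>
    (\<forall>x\<in>\<Omega>. \<rho> x = - s \<longrightarrow> m \<le> w x) \<longrightarrow> (\<forall>x\<in>closure \<Omega>. - s \<le> \<rho> x \<longrightarrow> m / 2 \<le> w x)"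
    using s0(2) s m(1) by blast
  have "lap_le {x\<in>\<Omega>. - s < \<rho> x} u (\<lambda>_. e)"
    using lapP by (rule lap_le_mono) (use e(1) collar in auto)
  then have "\<forall>x\<in>closure \<Omega>. - s \<le> \<rho> x \<longrightarrow> m / 2 \<le> u x" using e(2) g m(2) by blast
  moreover have "x \<in> closure \<Omega>" "- s \<le> \<rho> x" if "x \<in> frontier \<Omega>" for x
    using that defining_function_zero_on_frontier[OF \<Omega>(1) df that] s by (auto simp: frontier_def)
  ultimately show ?thesis using m(1) by (meson half_gt_zero less_le_trans)
qed

section \<open>Dead cores\<close>

text \<open>The exponent satisfies \<gamma> q = \<gamma> - 1, so the q-th power of C |y -
  x1|^(2\<gamma>) and its Laplacian are multiples of the same power of the distance. Being a
  supersolution thus reduces to the inequality \<open>large\<close> between constants. The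
  comparison function dominates u on the sphere and is 0 at the centre.\<close>

lemma vanishes_at_center:
  fixes u :: "real^'n::finite \<Rightarrow> real"
  assumes R: "R > 0" and q: "0 < q" "q < 1" and M: "M > 0" and k: "k > 0"
    and uc: "continuous_on (cball x1 R) u" and u: "\<And>x. x \<in> cball x1 R \<Longrightarrow> 0 \<le> u x \<and> u x \<le> M"
    and lap: "lap_le (ball x1 R) (\<lambda>x. - u x) (\<lambda>x. - k * u x powr q)"
    and \<gamma>: "\<gamma> = 1 / (1 - q)"
    and large: "M powr (1 - q) * (\<gamma> * (2 * real CARD('n) + 4 * \<gamma>)) \<le> k * R\<^sup>2"
  shows "u x1 = 0"
proof -
  define N where "N = real CARD('n)"
  have N: "N > 0" by (simp add: N_def)
  have \<gamma>1: "\<gamma> > 1" using q by (simp add: \<gamma>)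
  have \<gamma>q: "\<gamma> - 1 = \<gamma> * q" "\<gamma> * (1 - q) = 1" using q by (simp_all add: \<gamma> field_simps)
  \<comment> \<open>Makes the comparison function equal to M on the sphere of radius R.\<close>
  define C where "C = M / (R\<^sup>2) powr \<gamma>"
  have C: "C > 0" using M R by (simp add: C_def)
  define s where "s y = 0 + 1 * (norm (y - x1))\<^sup>2" for y
  have s0: "s y \<ge> 0" for y by (simp add: s_def)
  define \<psi> where "\<psi> y = C * s y powr \<gamma>" for y
  have x1: "x1 \<in> cball x1 R" using R by simp
  have sc: "continuous_on S s" for S unfolding s_def by (intro continuous_intros)
  have "continuous_on (cball x1 R) (\<lambda>y. - u y + \<psi> y)"
    unfolding \<psi>_def using \<gamma>1 s0 by (intro continuous_intros uc continuous_on_powr' sc) auto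
  then obtain z where z: "z \<in> cball x1 R" "\<And>y. y \<in> cball x1 R \<Longrightarrow> - u z + \<psi> z \<le> - u y + \<psi> y"
    using continuous_attains_inf[OF compact_cball, of x1 R] x1 by blast
  have "\<not> \<psi> z < u z"
  proof
    assume less: "\<psi> z < u z"
    have \<psi>z: "\<psi> z \<ge> 0" using C by (simp add: \<psi>_def)
    have "dist x1 z \<noteq> R"
    proof
      assume "dist x1 z = R"
      then have "s z = R\<^sup>2" by (simp add: s_def dist_norm norm_minus_commute)
      then have "\<psi> z = M" using R by (simp add: \<psi>_def C_def)
      then show False using less u[OF z(1)] by simp
    qed
    then have zb: "z \<in> ball x1 R" using z(1) by simp
    have ev: "\<forall>\<^sub>F y in nhds z. y \<in> ball x1 R" by (rule eventually_nhds_in_open[OF open_ball zb])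
    have up: "u z powr q > 0" using less \<psi>z by simp
    show False
    proof (cases "z = x1")
      case True
      define \<kappa> where "\<kappa> = k * u z powr q / (4 * N)"
      have \<kappa>: "\<kappa> > 0" using k up N by (simp add: \<kappa>_def)
      define \<epsilon> where "\<epsilon> = (\<kappa> / C) powr (1 / (\<gamma> - 1))"
      have \<epsilon>: "\<epsilon> > 0" using \<kappa> C by (simp add: \<epsilon>_def)
      have "isCont s z" using sc[of UNIV] by (simp add: continuous_on_eq_continuous_at)
      moreover have "s z = 0" using True by (simp add: s_def)
      ultimately obtain d where d: "d > 0" "\<And>y. dist y z < d \<Longrightarrow> \<bar>s y\<bar> < \<epsilon>"
        using \<epsilon> unfolding continuous_at_eps_delta dist_real_def by (metis diff_zero)
      have small: "\<psi> y \<le> \<kappa> * s y" if "dist y z < d" for y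
      proof (cases "s y = 0")
        case False
        then have sp: "s y > 0" using s0[of y] by simp
        have "s y powr (\<gamma> - 1) \<le> \<epsilon> powr (\<gamma> - 1)" using d(2)[OF that] sp \<gamma>1 by (intro powr_mono2) auto
        also have "\<dots> = \<kappa> / C" using \<kappa> C \<gamma>1 by (simp add: \<epsilon>_def powr_powr)
        finally have "C * s y powr (\<gamma> - 1) \<le> \<kappa>" using C by (simp add: field_simps)
        then have "C * s y powr (\<gamma> - 1) * s y \<le> \<kappa> * s y" using sp by (intro mult_right_mono) auto
        moreover have "s y powr \<gamma> = s y powr (\<gamma> - 1) * s y"
          using sp powr_add[of "s y" "\<gamma> - 1" 1] by simp
        ultimately show ?thesis by (simp add: \<psi>_def mult.assoc)
      qed (simp add: \<psi>_def)
      have jet: "jet2 (\<lambda>y. 0 + (- \<kappa>) * (norm (y - x1))\<^sup>2) (\<lambda>y. (2 * (- \<kappa>)) *\<^sub>R (y - x1)) (\<lambda>h. (2 * (- \<kappa>)) *\<^sub>R h) z"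
        by (rule jet2_sqnorm)
      have "\<forall>\<^sub>F y in nhds z. dist y z < d" using d(1) by (auto simp: eventually_nhds_metric)
      with ev have "\<forall>\<^sub>F y in nhds z. - u z - (0 + (- \<kappa>) * (norm (z - x1))\<^sup>2) \<le> - u y - (0 + (- \<kappa>) * (norm (y - x1))\<^sup>2)"
      proof eventually_elim
        case (elim y)
        have "- u z + \<psi> z \<le> - u y + \<psi> y" using elim(1) by (intro z(2)) simp
        moreover have "\<psi> y \<le> \<kappa> * (norm (y - x1))\<^sup>2" using small[OF elim(2)] by (simp add: s_def)
        ultimately show ?case using True \<psi>z by simp
      qed
      from lap_leD[OF lap zb jet this] have "2 * (- \<kappa>) * N \<le> - k * u z powr q" unfolding trace_op_id N_def .
      moreover have "2 * (- \<kappa>) * N = - (k * u z powr q) / 2" using N by (simp add: \<kappa>_def)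
      moreover have "- k * u z powr q = - (k * u z powr q)" by simp
      ultimately show False using mult_pos_pos[OF k up] by linarith
    next
      case False
      then have sp: "s z > 0" by (simp add: s_def)
      have ev0: "\<forall>\<^sub>F t in nhds (s z). t > 0" using eventually_nhds_in_open[OF open_greaterThan, of "s z" 0] sp by simp
      have D1: "\<forall>\<^sub>F t in nhds (s z). ((\<lambda>t. - C * t powr \<gamma>) has_real_derivative (- C * \<gamma>) * t powr (\<gamma> - 1)) (at t)"
        using ev0 by eventually_elim (auto intro!: derivative_eq_intros)
      have D2: "((\<lambda>t. (- C * \<gamma>) * t powr (\<gamma> - 1)) has_real_derivative (- C * \<gamma>) * ((\<gamma> - 1) * s z powr (\<gamma> - 1 - 1))) (at (s z))"
        using sp by (auto intro!: derivative_eq_intros)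
      have js: "jet2 s (\<lambda>y. (2 * 1) *\<^sub>R (y - x1)) (\<lambda>h. (2 * 1) *\<^sub>R h) z" unfolding s_def by (rule jet2_sqnorm)
      note jet = jet2_chain[OF js D1 D2]
      have "\<forall>\<^sub>F y in nhds z. - u z - (- C * s z powr \<gamma>) \<le> - u y - (- C * s y powr \<gamma>)"
        using ev
      proof eventually_elim
        case (elim y)
        then have "- u z + \<psi> z \<le> - u y + \<psi> y" by (intro z(2)) simp
        then show ?case by (simp add: \<psi>_def)
      qed
      from lap_leD[OF lap zb jet this]
      have "(- C * \<gamma>) * s z powr (\<gamma> - 1) * (2 * 1 * N) +
          (- C * \<gamma>) * ((\<gamma> - 1) * s z powr (\<gamma> - 1 - 1)) * (((2 * 1) *\<^sub>R (z - x1)) \<bullet> ((2 * 1) *\<^sub>R (z - x1))) \<le> - k * u z powr q"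
        unfolding trace_op_chain trace_op_id N_def .
      moreover have "((2 * 1) *\<^sub>R (z - x1)) \<bullet> ((2 * 1) *\<^sub>R (z - x1)) = 4 * s z"
        by (simp add: s_def power2_norm_eq_inner)
      moreover have "s z powr (\<gamma> - 1) = s z powr (\<gamma> - 1 - 1) * s z"
        using sp powr_add[of "s z" "\<gamma> - 1 - 1" 1] by simp
      ultimately have "(- C * \<gamma>) * (s z powr (\<gamma> - 1 - 1) * s z) * (2 * 1 * N) +
          (- C * \<gamma>) * ((\<gamma> - 1) * s z powr (\<gamma> - 1 - 1)) * (4 * s z) \<le> - k * u z powr q"
        and "s z powr (\<gamma> - 1) = s z powr (\<gamma> - 1 - 1) * s z" by (simp_all only:)
      then have ineq: "k * u z powr q \<le> C * (\<gamma> * (2 * N + 4 * (\<gamma> - 1))) * s z powr (\<gamma> - 1)"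
        by (simp add: algebra_simps)
      have "\<psi> z powr q < u z powr q" using less \<psi>z q by (intro powr_less_mono2) auto
      \<comment> \<open>By \<gamma> q = \<gamma> - 1 both sides carry the same power of
        \<open>s z\<close>, which then cancels.\<close>
      moreover have "\<psi> z powr q = C powr q * s z powr (\<gamma> - 1)"
        using C sp by (simp add: \<psi>_def powr_mult powr_powr \<gamma>q)
      ultimately have "k * (C powr q * s z powr (\<gamma> - 1)) < k * u z powr q" using k by simp
      with ineq have "(k * C powr q) * s z powr (\<gamma> - 1) < (C * (\<gamma> * (2 * N + 4 * (\<gamma> - 1)))) * s z powr (\<gamma> - 1)"
        by (simp add: mult.assoc)
      then have "k * C powr q < C * (\<gamma> * (2 * N + 4 * (\<gamma> - 1)))" using sp by (simp add: mult_less_cancel_right)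
      moreover have "C = C powr q * C powr (1 - q)" using C powr_add[of C q "1 - q"] by simp
      ultimately have "C powr q * k < C powr q * (C powr (1 - q) * (\<gamma> * (2 * N + 4 * (\<gamma> - 1))))"
        by (metis mult.assoc mult.commute)
      then have kl: "k < C powr (1 - q) * (\<gamma> * (2 * N + 4 * (\<gamma> - 1)))" using C by simp
      \<comment> \<open>Since \<gamma> (1 - q) = 1, the radius enters exactly as R^2.\<close>
      have "C powr (1 - q) = M powr (1 - q) / (R\<^sup>2)"
        using M R by (simp add: C_def powr_divide powr_powr \<gamma>q)
      then have CM: "C powr (1 - q) * R\<^sup>2 = M powr (1 - q)" using R by simp
      have "k * R\<^sup>2 < C powr (1 - q) * (\<gamma> * (2 * N + 4 * (\<gamma> - 1))) * R\<^sup>2"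
        using kl R by (intro mult_strict_right_mono) auto
      also have "\<dots> = C powr (1 - q) * R\<^sup>2 * (\<gamma> * (2 * N + 4 * (\<gamma> - 1)))" by (simp only: mult_ac)
      also have "\<dots> = M powr (1 - q) * (\<gamma> * (2 * N + 4 * (\<gamma> - 1)))" unfolding CM ..
      also have "\<dots> \<le> M powr (1 - q) * (\<gamma> * (2 * N + 4 * \<gamma>))"
        using \<gamma>1 by (intro mult_left_mono) auto
      finally show False using large by (simp add: N_def)
    qed
  qed
  then have "- u x1 + \<psi> x1 \<ge> 0" using z(2)[OF x1] by linarith
  moreover have "\<psi> x1 = 0" by (simp add: \<psi>_def s_def)
  ultimately show ?thesis using u[OF x1] by simp
qed

text \<open>
  This replaces an a priori bound for \<open>max u\<close>: the scale-invariant quantity \<open>\<delta> M\<^bsup>q-1\<^esup>\<close> is all that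
  the barrier in the dead core needs.
\<close>
lemma coefficient_bound:
  fixes \<Omega> :: "(real^'n::finite) set"
  assumes dom: "smooth_bounded_domain \<Omega>" and r: "r \<ge> 1"
    and R: "R > 0" "cball x1 R \<subseteq> \<Omega>" and c: "c > 0" and B: "B \<ge> 0" and K: "K > 0"
    and b1: "AE x in lebesgue. x \<in> \<Omega> \<longrightarrow> b1 x \<le> B" "AE x in lebesgue. x \<in> ball x1 R \<longrightarrow> b1 x = 0"
    and b2: "\<And>x. x \<in> \<Omega> \<Longrightarrow> 0 \<le> b2 x" "\<And>x. x \<in> ball x1 R \<Longrightarrow> c \<le> b2 x"
  shows "\<exists>\<delta>0>0. \<forall>\<delta> q u M. \<delta>0 \<le> \<delta> \<longrightarrow> 0 < q \<longrightarrow> q < 1 \<longrightarrow> nonneg_solution \<Omega> r (\<lambda>x. b1 x - \<delta> * b2 x) q u \<longrightarrow>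
    0 < M \<longrightarrow> (\<forall>x\<in>closure \<Omega>. u x \<le> M) \<longrightarrow> (\<exists>x\<in>closure \<Omega>. u x = M) \<longrightarrow> K \<le> \<delta> * M powr (q - 1)"
proof -
  have \<Omega>: "open \<Omega>" "bounded \<Omega>" "connected \<Omega>" using dom by (auto simp: smooth_bounded_domain_def)
  obtain \<rho> where df: "defining_function \<Omega> \<rho>" using dom by (auto simp: smooth_bounded_domain_def)
  have sub: "\<Omega> \<subseteq> closure \<Omega>" by (rule closure_subset)
  define N where "N = real CARD('n)"
  have N: "N > 0" by (simp add: N_def)
  \<comment> \<open>The first bound keeps 2Nt below c/2, the strength of the absorption where u
    \<ge> M/2; the second ensures u \<ge> M/2 at a contact point whenever \<mu> < K.\<close>
  define t where "t = min (c / (8 * N)) (1 / (2 * R\<^sup>2 * K))"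
  have t: "t > 0" using c N R K by (simp add: t_def)
  have t1: "2 * N * t \<le> c / 4"
  proof -
    have "2 * N * t \<le> 2 * N * (c / (8 * N))" using N by (intro mult_left_mono) (auto simp: t_def)
    then show ?thesis using N by simp
  qed
  have t2: "t * R\<^sup>2 * K \<le> 1 / 2"
  proof -
    have "t * (R\<^sup>2 * K) \<le> 1 / (2 * R\<^sup>2 * K) * (R\<^sup>2 * K)" using R K by (intro mult_right_mono) (auto simp: t_def)
    then show ?thesis using R K by (simp add: mult.assoc)
  qed
  \<comment> \<open>The value of the paraboloid \<tau> at distance R/2 from
    \<open>x1\<close>.\<close>
  define m where "m = t * (3 / 4 * R\<^sup>2)"
  have m: "m > 0" using t R by (simp add: m_def)
  obtain s where s: "s > 0" "\<forall>s' m. 0 < s' \<longrightarrow> s' \<le> s \<longrightarrow> 0 < m \<longrightarrow> (\<exists>e>0. \<forall>w g. C1_closure_grad \<Omega> w g \<longrightarrow>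
    (\<forall>x\<in>frontier \<Omega>. g x \<bullet> outer_normal \<Omega> x = 0) \<longrightarrow> lap_le {x\<in>\<Omega>. - s' < \<rho> x} w (\<lambda>_. e) \<longrightarrow>
    (\<forall>x\<in>\<Omega>. \<rho> x = - s' \<longrightarrow> m \<le> w x) \<longrightarrow> (\<forall>x\<in>closure \<Omega>. - s' \<le> \<rho> x \<longrightarrow> m / 2 \<le> w x))"
    using positivity_reaches_boundary[OF \<Omega>(1,2) df] by blast
  define K' where "K' = closure \<Omega> \<inter> {x. \<rho> x \<le> - s}"
  have \<rho>c: "continuous_on UNIV \<rho>"
    using df Ck_imp_continuous unfolding defining_function_def smooth_fun_def by blast
  have K'c: "compact K'"
    unfolding K'_def using \<Omega>(2) by (intro compact_Int_closed closed_Collect_le \<rho>c continuous_on_const) (auto simp: compact_closure)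
  have K'\<Omega>: "K' \<subseteq> \<Omega>"
    using defining_function_nonpos_on_closure(3)[OF \<Omega>(1) df] s(1) by (fastforce simp: K'_def)
  have x1: "x1 \<in> \<Omega>" using R by auto
  obtain c1 e1 where c1: "c1 > 0" and e1: "e1 > 0" "\<forall>w. continuous_on \<Omega> w \<longrightarrow> (\<forall>y\<in>\<Omega>. 0 \<le> w y) \<longrightarrow> lap_le \<Omega> w (\<lambda>_. e1) \<longrightarrow>
    (\<forall>y\<in>ball x1 (R / 2) \<inter> \<Omega>. m \<le> w y) \<longrightarrow> (\<forall>y\<in>K'. c1 \<le> w y)"
    using positivity_spreads[OF \<Omega>(1,3) x1 _ m K'c K'\<Omega>, of "R / 2"] R by auto
  obtain e2 where e2: "e2 > 0" "\<forall>w g. C1_closure_grad \<Omega> w g \<longrightarrow>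
    (\<forall>x\<in>frontier \<Omega>. g x \<bullet> outer_normal \<Omega> x = 0) \<longrightarrow> lap_le {x\<in>\<Omega>. - s < \<rho> x} w (\<lambda>_. e2) \<longrightarrow>
    (\<forall>x\<in>\<Omega>. \<rho> x = - s \<longrightarrow> c1 \<le> w x) \<longrightarrow> (\<forall>x\<in>closure \<Omega>. - s \<le> \<rho> x \<longrightarrow> c1 / 2 \<le> w x)"
    using s c1 by blast
  define e where "e = min e1 e2"
  have e: "e > 0" "e \<le> e1" "e \<le> e2" using e1 e2 by (auto simp: e_def)
  \<comment> \<open>Gives B/\<delta> \<le> e, below the tolerances of both spreading results and
    independent of q and M.\<close>
  define \<delta>0 where "\<delta>0 = B / e + 1"
  have \<delta>0: "\<delta>0 > 0" using B e by (simp add: \<delta>0_def add_nonneg_pos)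
  show ?thesis
  proof (rule exI[of _ \<delta>0], rule conjI[OF \<delta>0], intro allI impI)
    fix \<delta> q M :: real and u
    assume \<delta>: "\<delta>0 \<le> \<delta>" and q: "0 < q" "q < 1" and sol: "nonneg_solution \<Omega> r (\<lambda>x. b1 x - \<delta> * b2 x) q u"
      and M: "0 < M" and uM: "\<forall>x\<in>closure \<Omega>. u x \<le> M" and attained: "\<exists>x\<in>closure \<Omega>. u x = M"
    define \<mu> where "\<mu> = \<delta> * M powr (q - 1)"
    have \<delta>p: "\<delta> > 0" using \<delta> \<delta>0 by simp
    have \<mu>: "\<mu> > 0" using \<delta>p M by (simp add: \<mu>_def)
    obtain g where g: "C1_closure_grad \<Omega> u g" "\<forall>x\<in>frontier \<Omega>. g x \<bullet> outer_normal \<Omega> x = 0"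
      and u0: "\<forall>x\<in>closure \<Omega>. u x \<ge> 0"
      using sol by (auto simp: nonneg_solution_def)
    have uc: "continuous_on (closure \<Omega>) u" using g by (simp add: C1_closure_grad_def)
    have ucq: "continuous_on S (\<lambda>x. u x powr q)" if "S \<subseteq> closure \<Omega>" for S
      using that u0 q by (intro continuous_on_powr' continuous_on_subset[OF uc] continuous_on_const) auto
    obtain F where F: "weak_lap \<Omega> u F" "AE x in lebesgue. x \<in> \<Omega> \<longrightarrow> F x = - ((b1 x - \<delta> * b2 x) * u x powr q)"
      using solution_weak_lap[OF \<Omega>(1,2) r sol] by blast
    have lap1: "lap_le \<Omega> (\<lambda>x. - u x) (\<lambda>_. B * M powr q)"
    proof (rule lap_le_of_weak_lap[OF \<Omega>(1) weak_lap_minus[OF F(1)] \<Omega>(1) subset_refl continuous_on_const])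
      show "AE x in lebesgue. x \<in> \<Omega> \<longrightarrow> - F x \<le> B * M powr q"
        using F(2) b1(1)
      proof eventually_elim
        case (elim x)
        show ?case
        proof
          assume x: "x \<in> \<Omega>"
          have "b1 x - \<delta> * b2 x \<le> B" using elim(2) x b2(1)[OF x] \<delta>p by (smt (verit) mult_nonneg_nonneg)
          then have "(b1 x - \<delta> * b2 x) * u x powr q \<le> B * u x powr q" by (intro mult_right_mono) auto
          also have "\<dots> \<le> B * M powr q"
            using x sub uM u0 q B by (intro mult_left_mono powr_mono2) auto
          finally show "- F x \<le> B * M powr q" using elim(1) x by simp
        qed
      qed
    qed
    have lap2: "lap_le (ball x1 R) (\<lambda>x. - u x) (\<lambda>x. - (\<delta> * c) * u x powr q)"
    proof (rule lap_le_of_weak_lap[OF \<Omega>(1) weak_lap_minus[OF F(1)] open_ball])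
      show b\<Omega>: "ball x1 R \<subseteq> \<Omega>" using R(2) by auto
      show "continuous_on (ball x1 R) (\<lambda>x. - (\<delta> * c) * u x powr q)"
        using b\<Omega> sub by (intro continuous_intros ucq) auto
      show "AE x in lebesgue. x \<in> ball x1 R \<longrightarrow> - F x \<le> - (\<delta> * c) * u x powr q"
        using F(2) b1(2)
      proof eventually_elim
        case (elim x)
        show ?case
        proof
          assume x: "x \<in> ball x1 R"
          then have "- F x = - (\<delta> * b2 x) * u x powr q" using elim b\<Omega> by auto
          also have "\<dots> \<le> - (\<delta> * c) * u x powr q" using b2(2)[OF x] \<delta>p by (intro mult_right_mono) auto
          finally show "- F x \<le> - (\<delta> * c) * u x powr q" .
        qed
      qed
    qed
    \<comment> \<open>The factor that turns M - u into (1 - u/M)/\<mu>.\<close>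
    define \<alpha> where "\<alpha> = 1 / (M * \<mu>)"
    have \<alpha>: "\<alpha> > 0" using M \<mu> by (simp add: \<alpha>_def)
    have Mq: "M powr q = M * M powr (q - 1)" using M powr_add[of M 1 "q - 1"] by simp
    have \<alpha>M: "\<alpha> * M powr q = 1 / \<delta>" using M \<delta>p by (simp add: \<alpha>_def \<mu>_def Mq)
    define w where "w x = \<alpha> * - u x + 1 / \<mu>" for x
    have w_alt: "w x = \<alpha> * (M - u x)" for x using M \<mu> by (simp add: w_def \<alpha>_def field_simps)
    have wlap: "lap_le \<Omega> w (\<lambda>_. e)"
    proof (rule lap_le_mono)
      show "lap_le \<Omega> w (\<lambda>_. \<alpha> * (B * M powr q))" unfolding w_def by (rule lap_le_affine[OF lap1 \<alpha>])
      have "\<alpha> * (B * M powr q) = B / \<delta>" using \<alpha>M by (simp add: mult.left_commute)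
      also have "\<dots> \<le> e"
      proof -
        have "B / e \<le> \<delta>" using \<delta> by (simp add: \<delta>0_def)
        then show ?thesis using e(1) \<delta>p by (simp add: field_simps)
      qed
      finally show "\<alpha> * (B * M powr q) \<le> e" .
    qed simp
    have wc: "continuous_on (closure \<Omega>) w" unfolding w_def by (intro continuous_intros uc)
    have w0: "w x \<ge> 0" if "x \<in> closure \<Omega>" for x using uM \<alpha> that by (simp add: w_alt)
    show "K \<le> \<delta> * M powr (q - 1)"
    proof (rule ccontr)
      assume "\<not> ?thesis"
      then have \<mu>K: "\<mu> < K" by (simp add: \<mu>_def)
      have wlap2: "lap_le (ball x1 R) w (\<lambda>x. \<alpha> * (- (\<delta> * c) * u x powr q))"
        unfolding w_def by (rule lap_le_affine[OF lap2 \<alpha>])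
      \<comment> \<open>Vanishes on the sphere, where nonnegativity of w is then enough for the
        comparison.\<close>
      define \<tau> where "\<tau> y = t * R\<^sup>2 + (- t) * (norm (y - x1))\<^sup>2" for y
      have cb: "cball x1 R \<subseteq> closure \<Omega>" using R(2) sub by blast
      have low: "\<tau> y \<le> w y" if y: "y \<in> cball x1 R" for y
      proof -
        have "continuous_on (cball x1 R) (\<lambda>y. w y - \<tau> y)"
          unfolding \<tau>_def by (intro continuous_intros continuous_on_subset[OF wc cb])
        then obtain z where z: "z \<in> cball x1 R" "\<And>v. v \<in> cball x1 R \<Longrightarrow> w z - \<tau> z \<le> w v - \<tau> v"
          using continuous_attains_inf[OF compact_cball, of x1 R] y by blast
        have "\<not> w z < \<tau> z"
        proof
          assume less: "w z < \<tau> z"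
          have wz: "w z \<ge> 0" using w0 z(1) cb by blast
          have "dist x1 z \<noteq> R"
          proof
            assume "dist x1 z = R"
            then have "\<tau> z = 0" by (simp add: \<tau>_def dist_norm norm_minus_commute)
            then show False using less wz by simp
          qed
          then have zb: "z \<in> ball x1 R" using z(1) by simp
          have "\<forall>\<^sub>F v in nhds z. v \<in> ball x1 R" by (rule eventually_nhds_in_open[OF open_ball zb])
          then have touch: "\<forall>\<^sub>F v in nhds z. w z - \<tau> z \<le> w v - \<tau> v"
            by eventually_elim (rule z(2), simp)
          have "jet2 \<tau> (\<lambda>y. (2 * (- t)) *\<^sub>R (y - x1)) (\<lambda>h. (2 * (- t)) *\<^sub>R h) z" unfolding \<tau>_def by (rule jet2_sqnorm)
          from lap_leD[OF wlap2 zb this touch]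
          have tr: "2 * (- t) * N \<le> \<alpha> * (- (\<delta> * c) * u z powr q)" unfolding trace_op_id N_def .
          have "\<tau> z \<le> t * R\<^sup>2" using t by (simp add: \<tau>_def)
          \<comment> \<open>\<open>w z * \<mu>\<close> equals 1 - u/M; bounding it by 1/2 keeps u at
            least M/2 at the contact point, where the absorption is therefore not
            degenerate.\<close>
          then have "w z * \<mu> \<le> t * R\<^sup>2 * K" using less \<mu>K \<mu> wz by (intro mult_mono) auto
          then have "w z * \<mu> \<le> 1 / 2" using t2 by linarith
          moreover have "w z * \<mu> = 1 - u z / M" using M \<mu> by (simp add: w_alt \<alpha>_def field_simps)
          ultimately have "1 / 2 \<le> u z / M" by linarith
          then have half: "1 / 2 * M \<le> u z" using M by (simp add: field_simps)
          \<comment> \<open>For q < 1 one has (1/2)^q \<ge> 1/2, which makes the constant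
            independent of q.\<close>
          have "1 / 2 * M powr q \<le> (1 / 2) powr q * M powr q"
            using q powr_mono'[of q 1 "1 / 2 :: real"] by (intro mult_right_mono) auto
          also have "\<dots> = (1 / 2 * M) powr q" using M by (subst powr_mult) auto
          also have "\<dots> \<le> u z powr q" using half M q by (intro powr_mono2) auto
          finally have "(\<alpha> * \<delta> * c) * (1 / 2 * M powr q) \<le> (\<alpha> * \<delta> * c) * u z powr q"
            using \<alpha> \<delta>p c by (intro mult_left_mono) auto
          moreover have "(\<alpha> * \<delta> * c) * (1 / 2 * M powr q) = c / 2"
          proof -
            have "(\<alpha> * \<delta> * c) * (1 / 2 * M powr q) = (\<alpha> * M powr q) * \<delta> * c / 2" by simp
            then show ?thesis using \<alpha>M \<delta>p by simp
          qed
          moreover have "\<alpha> * (- (\<delta> * c) * u z powr q) = - ((\<alpha> * \<delta> * c) * u z powr q)" "2 * (- t) * N = - (2 * N * t)"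
            by simp_all
          ultimately have "c / 2 \<le> 2 * N * t" using tr by linarith
          then show False using t1 c by simp
        qed
        then show ?thesis using z(2)[OF y] by linarith
      qed
      have wm: "m \<le> w y" if "y \<in> ball x1 (R / 2)" for y
      proof -
        have "(norm (y - x1))\<^sup>2 \<le> (R / 2)\<^sup>2" using that by (intro power_mono) (auto simp: dist_norm norm_minus_commute)
        then have "t * (norm (y - x1))\<^sup>2 \<le> t * (R / 2)\<^sup>2" using t by simp
        then have "m \<le> \<tau> y" by (simp add: m_def \<tau>_def power_divide algebra_simps)
        also have "\<dots> \<le> w y" using that R by (intro low) auto
        finally show ?thesis .
      qed
      have "lap_le \<Omega> w (\<lambda>_. e1)" using wlap by (rule lap_le_mono) (use e in auto)
      then have wK': "\<forall>y\<in>K'. c1 \<le> w y"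
        using e1(2) wm w0 sub continuous_on_subset[OF wc sub] by blast
      have "C1_closure_grad \<Omega> w (\<lambda>x. (- \<alpha>) *\<^sub>R g x)"
        unfolding C1_closure_grad_def
      proof (intro conjI ballI wc)
        show "continuous_on (closure \<Omega>) (\<lambda>x. (- \<alpha>) *\<^sub>R g x)"
          using g(1) by (intro continuous_intros) (simp add: C1_closure_grad_def)
        fix x assume "x \<in> \<Omega>"
        then have "(u has_derivative (\<lambda>h. g x \<bullet> h)) (at x)" using g(1) by (simp add: C1_closure_grad_def)
        then show "(w has_derivative (\<lambda>h. (- \<alpha>) *\<^sub>R g x \<bullet> h)) (at x)"
          unfolding w_def by (auto intro!: derivative_eq_intros)
      qed
      moreover have "\<forall>x\<in>frontier \<Omega>. ((- \<alpha>) *\<^sub>R g x) \<bullet> outer_normal \<Omega> x = 0" using g(2) by simp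
      moreover have "lap_le {x\<in>\<Omega>. - s < \<rho> x} w (\<lambda>_. e2)" using wlap by (rule lap_le_mono) (use e in auto)
      moreover have "\<forall>x\<in>\<Omega>. \<rho> x = - s \<longrightarrow> c1 \<le> w x" using wK' sub by (auto simp: K'_def)
      ultimately have collar: "\<forall>x\<in>closure \<Omega>. - s \<le> \<rho> x \<longrightarrow> c1 / 2 \<le> w x" using e2(2) by blast
      \<comment> \<open>The lower bounds on \<open>K'\<close> and on the collar together cover the
        closure, so w cannot vanish where u attains M.\<close>
      obtain xm where xm: "xm \<in> closure \<Omega>" "u xm = M" using attained by blast
      then have "w xm = 0" by (simp add: w_alt)
      moreover have "w xm > 0"
      proof (cases "- s \<le> \<rho> xm")
        case True
        then show ?thesis using collar xm(1) c1 by (meson half_gt_zero less_le_trans)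
      next
        case False
        then have "xm \<in> K'" using xm(1) by (simp add: K'_def)
        then show ?thesis using wK' c1 by (meson less_le_trans)
      qed
      ultimately show False by simp
    qed
  qed
qed

section \<open>Uniform vanishing in the inner set\<close>

text \<open>A ball is connected, so leaving G it would meet the frontier within \<sigma>/2 of
  x.\<close>

lemma cball_subset_inner:
  assumes "x \<in> inner_set G \<sigma>" "y \<in> cball x (\<sigma> / 2)"
  shows "y \<in> G" "\<sigma> / 2 \<le> infdist y (frontier G)"
proof -
  have x: "x \<in> G" "\<sigma> < infdist x (frontier G)" using assms(1) by (auto simp: inner_set_def)
  have xy: "dist x y \<le> \<sigma> / 2" using assms(2) by simp
  then have \<sigma>: "\<sigma> \<ge> 0" using zero_le_dist[of x y] by linarith
  show "y \<in> G"
  proof (rule ccontr)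
    assume "y \<notin> G"
    then have "cball x (\<sigma> / 2) - G \<noteq> {}" using assms(2) by blast
    moreover have "x \<in> cball x (\<sigma> / 2)" using \<sigma> by simp
    then have "cball x (\<sigma> / 2) \<inter> G \<noteq> {}" using x(1) by blast
    ultimately have "cball x (\<sigma> / 2) \<inter> frontier G \<noteq> {}"
      by (intro connected_Int_frontier convex_connected convex_cball)
    then obtain z where "z \<in> frontier G" "dist x z \<le> \<sigma> / 2" by auto
    then show False using infdist_le[of z "frontier G" x] x(2) \<sigma> by linarith
  qed
  show "\<sigma> / 2 \<le> infdist y (frontier G)"
    using infdist_triangle[of x "frontier G" y] x(2) xy by linarith
qed

text \<open>One threshold serves all q up to \<open>qbar\<close> because \<gamma> (2N + 4\<gamma>)
  increases with q and is therefore bounded by its value X at \<open>qbar\<close>.\<close>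

lemma solution_vanishes_in_inner_set:
  fixes \<Omega> :: "(real^'n::finite) set"
  assumes dom: "smooth_bounded_domain \<Omega>" and r: "r \<ge> 1"
    and b1: "Linf_on \<Omega> b1" and b2: "continuous_on (closure \<Omega>) b2" "\<forall>x\<in>closure \<Omega>. b2 x \<ge> 0"
    and disj: "ess_supp \<Omega> b1 \<inter> {x\<in>\<Omega>. b2 x > 0} = {}"
    and qbar: "0 < qbar" "qbar < 1" and \<sigma>: "\<sigma> > 0"
  shows "\<exists>\<delta>0>0. \<forall>\<delta> q. \<delta> \<ge> \<delta>0 \<and> 0 < q \<and> q \<le> qbar \<longrightarrow>
    (\<forall>u. nonneg_solution \<Omega> r (\<lambda>x. b1 x - \<delta> * b2 x) q u \<and> nontrivial \<Omega> u \<longrightarrow>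
      (\<forall>x\<in>inner_set {x\<in>\<Omega>. b2 x > 0} \<sigma>. u x = 0))"
proof -
  have \<Omega>: "open \<Omega>" "bounded \<Omega>" using dom by (auto simp: smooth_bounded_domain_def)
  have sub: "\<Omega> \<subseteq> closure \<Omega>" by (rule closure_subset)
  define G where "G = {x\<in>\<Omega>. b2 x > 0}"
  have G\<Omega>: "G \<subseteq> \<Omega>" by (auto simp: G_def)
  have oG: "open G"
  proof -
    have "open (b2 -` {0<..} \<inter> \<Omega>)"
      using continuous_on_open_vimage[OF \<Omega>(1), of b2] continuous_on_subset[OF b2(1) sub] by auto
    moreover have "b2 -` {0<..} \<inter> \<Omega> = G" by (auto simp: G_def)
    ultimately show ?thesis by simp
  qed
  show ?thesis
  proof (cases "inner_set G \<sigma> = {}")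
    case True
    \<comment> \<open>There is no point to treat and no centre for a comparison ball; the threshold
      1 is arbitrary.\<close>
    then show ?thesis by (auto simp: G_def intro: exI[of _ 1])
  next
    case False
    then obtain p where p: "p \<in> inner_set G \<sigma>" by blast
    define R where "R = \<sigma> / 2"
    have R: "R > 0" using \<sigma> by (simp add: R_def)
    \<comment> \<open>A compact part of G that contains every ball of radius R centred in the inner
      set; it yields one positive lower bound for \<open>b2\<close> on all of them.\<close>
    define S where "S = closure G \<inter> {x. R \<le> infdist x (frontier G)}"
    have S: "compact S"
      unfolding S_def using bounded_subset[OF \<Omega>(2) G\<Omega>]
      by (intro compact_Int_closed closed_Collect_le continuous_intros) (auto simp: compact_closure)
    have SG: "S \<subseteq> G"
    proof
      fix x assume x: "x \<in> S"
      then have "x \<notin> frontier G" using R by (auto simp: S_def)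
      then show "x \<in> G" using x oG by (auto simp: S_def frontier_def interior_open)
    qed
    have inS: "cball x R \<subseteq> S" if "x \<in> inner_set G \<sigma>" for x
      using cball_subset_inner[OF that] closure_subset[of G] by (auto simp: S_def R_def)
    have "p \<in> S" using inS[OF p] R by auto
    moreover have "continuous_on S b2" using b2(1) SG G\<Omega> sub by (meson continuous_on_subset order_trans)
    ultimately obtain z where z: "z \<in> S" "\<forall>y\<in>S. b2 z \<le> b2 y"
      using continuous_attains_inf[OF S] by blast
    define c where "c = b2 z"
    have c: "c > 0" using z(1) SG by (auto simp: c_def G_def)
    obtain B where B: "AE x in lebesgue. x \<in> \<Omega> \<longrightarrow> \<bar>b1 x\<bar> \<le> B" using b1 by (auto simp: Linf_on_def)
    have B': "AE x in lebesgue. x \<in> \<Omega> \<longrightarrow> b1 x \<le> max 0 B"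
      using B by eventually_elim auto
    have b1G: "AE x in lebesgue. x \<in> G \<longrightarrow> b1 x = 0"
      using AE_outside_ess_supp[of \<Omega> b1] by eventually_elim (use disj in \<open>auto simp: G_def\<close>)
    define \<gamma>b where "\<gamma>b = 1 / (1 - qbar)"
    define X where "X = \<gamma>b * (2 * real CARD('n) + 4 * \<gamma>b)"
    have \<gamma>b: "\<gamma>b > 0" using qbar by (simp add: \<gamma>b_def)
    then have X: "X > 0" by (simp add: X_def add_nonneg_pos)
    \<comment> \<open>Chosen for \<open>vanishes_at_center\<close>: K \<le> \<delta> M^(q-1) gives
      M^(1-q) X \<le> \<delta> c R^2.\<close>
    define K where "K = X / (c * R\<^sup>2)"
    have K: "K > 0" using X c R by (simp add: K_def)
    have pR: "cball p R \<subseteq> \<Omega>" using inS[OF p] SG G\<Omega> by blast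
    have pb1: "AE x in lebesgue. x \<in> ball p R \<longrightarrow> b1 x = 0"
    proof -
      have "ball p R \<subseteq> G" using ball_subset_cball inS[OF p] SG by blast
      then show ?thesis using b1G by (intro eventually_mono[OF b1G]) blast
    qed
    have b2\<Omega>: "0 \<le> b2 x" if "x \<in> \<Omega>" for x using that b2(2) sub by blast
    have b2S: "c \<le> b2 x" if "x \<in> S" for x using z(2) that by (simp add: c_def)
    have b2p: "c \<le> b2 x" if "x \<in> ball p R" for x using inS[OF p] that by (intro b2S) auto
    obtain \<delta>0 where \<delta>0: "\<delta>0 > 0" and bound: "\<forall>\<delta> q u M. \<delta>0 \<le> \<delta> \<longrightarrow> 0 < q \<longrightarrow> q < 1 \<longrightarrow> nonneg_solution \<Omega> r (\<lambda>x. b1 x - \<delta> * b2 x) q u \<longrightarrow>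
      0 < M \<longrightarrow> (\<forall>x\<in>closure \<Omega>. u x \<le> M) \<longrightarrow> (\<exists>x\<in>closure \<Omega>. u x = M) \<longrightarrow> K \<le> \<delta> * M powr (q - 1)"
      using coefficient_bound[where ?b2.0 = b2, OF dom r R pR c max.cobounded1 K B' pb1 b2\<Omega> b2p] by blast
    show ?thesis
      unfolding G_def[symmetric]
    proof (rule exI[of _ \<delta>0], rule conjI[OF \<delta>0], intro allI impI ballI)
      fix \<delta> q :: real and u x
      assume \<delta>q: "\<delta> \<ge> \<delta>0 \<and> 0 < q \<and> q \<le> qbar"
        and sn: "nonneg_solution \<Omega> r (\<lambda>x. b1 x - \<delta> * b2 x) q u \<and> nontrivial \<Omega> u" and x: "x \<in> inner_set G \<sigma>"
      have sol: "nonneg_solution \<Omega> r (\<lambda>x. b1 x - \<delta> * b2 x) q u" and nt: "nontrivial \<Omega> u" using sn by auto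
      have q: "0 < q" "q < 1" using \<delta>q qbar by auto
      have \<delta>: "\<delta> > 0" using \<delta>q \<delta>0 by linarith
      have u0: "\<forall>x\<in>closure \<Omega>. u x \<ge> 0" and uc: "continuous_on (closure \<Omega>) u"
        using sol by (auto simp: nonneg_solution_def C1_closure_grad_def)
      have "compact (closure \<Omega>)" using \<Omega>(2) by (simp add: compact_closure)
      moreover have "closure \<Omega> \<noteq> {}" using pR R by auto
      ultimately obtain xm where xm: "xm \<in> closure \<Omega>" "\<forall>y\<in>closure \<Omega>. u y \<le> u xm"
        using continuous_attains_sup uc by blast
      define M where "M = u xm"
      have M: "M > 0"
      proof -
        obtain y where y: "y \<in> \<Omega>" "u y \<noteq> 0" using nt by (auto simp: nontrivial_def)
        then have "u y > 0" using u0 sub by (force simp: less_le)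
        then show ?thesis using xm(2) y(1) sub by (force simp: M_def)
      qed
      have KM: "K \<le> \<delta> * M powr (q - 1)"
      proof (rule bound[rule_format, OF _ q sol M])
        show "\<delta>0 \<le> \<delta>" using \<delta>q by simp
        show "u y \<le> M" if "y \<in> closure \<Omega>" for y using that xm(2) by (simp add: M_def)
        show "\<exists>y\<in>closure \<Omega>. u y = M" using xm(1) by (auto simp: M_def)
      qed
      define \<gamma> where "\<gamma> = 1 / (1 - q)"
      have \<gamma>: "0 < \<gamma>" "\<gamma> \<le> \<gamma>b" using \<delta>q q qbar by (auto simp: \<gamma>_def \<gamma>b_def intro!: divide_left_mono)
      have "\<gamma> * (2 * real CARD('n) + 4 * \<gamma>) \<le> X"
        unfolding X_def using \<gamma> by (intro mult_mono) auto
      also have "X = K * (c * R\<^sup>2)" using c R by (simp add: K_def)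
      also have "\<dots> \<le> \<delta> * M powr (q - 1) * (c * R\<^sup>2)" using KM c R by (intro mult_right_mono) auto
      finally have "M powr (1 - q) * (\<gamma> * (2 * real CARD('n) + 4 * \<gamma>)) \<le> M powr (1 - q) * (\<delta> * M powr (q - 1) * (c * R\<^sup>2))"
        by (intro mult_left_mono) auto
      also have "\<dots> = (M powr (1 - q) * M powr (q - 1)) * (\<delta> * c * R\<^sup>2)" by (simp add: mult_ac)
      also have "M powr (1 - q) * M powr (q - 1) = 1" using M by (simp add: powr_add[symmetric])
      finally have large: "M powr (1 - q) * (\<gamma> * (2 * real CARD('n) + 4 * \<gamma>)) \<le> (\<delta> * c) * R\<^sup>2" by simp
      obtain F where F: "weak_lap \<Omega> u F" "AE x in lebesgue. x \<in> \<Omega> \<longrightarrow> F x = - ((b1 x - \<delta> * b2 x) * u x powr q)"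
        using solution_weak_lap[OF \<Omega> r sol] by blast
      have cbS: "cball x R \<subseteq> S" by (rule inS[OF x])
      have cbc: "cball x R \<subseteq> closure \<Omega>" using cbS SG G\<Omega> sub by blast
      have lap: "lap_le (ball x R) (\<lambda>y. - u y) (\<lambda>y. - (\<delta> * c) * u y powr q)"
      proof (rule lap_le_of_weak_lap[OF \<Omega>(1) weak_lap_minus[OF F(1)] open_ball])
        have bS: "ball x R \<subseteq> S" using cbS by auto
        then show "ball x R \<subseteq> \<Omega>" using SG G\<Omega> by blast
        have "continuous_on (ball x R) u" using uc cbc by (meson ball_subset_cball continuous_on_subset)
        moreover have "0 \<le> u y" if "y \<in> ball x R" for y
          using that u0 cbc ball_subset_cball[of x R] by blast
        ultimately show "continuous_on (ball x R) (\<lambda>y. - (\<delta> * c) * u y powr q)"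
          using q by (intro continuous_intros continuous_on_powr') auto
        show "AE y in lebesgue. y \<in> ball x R \<longrightarrow> - F y \<le> - (\<delta> * c) * u y powr q"
          using F(2) b1G
        proof eventually_elim
          case (elim y)
          show ?case
          proof
            assume y: "y \<in> ball x R"
            then have "y \<in> G" using bS SG by blast
            then have "- F y = - (\<delta> * b2 y) * u y powr q" using elim G\<Omega> by auto
            also have "\<dots> \<le> - (\<delta> * c) * u y powr q" using b2S[of y] bS y \<delta> by (intro mult_right_mono) auto
            finally show "- F y \<le> - (\<delta> * c) * u y powr q" .
          qed
        qed
      qed
      show "u x = 0"
      proof (rule vanishes_at_center[OF R q M _ _ _ lap \<gamma>_def large])
        show "\<delta> * c > 0" using \<delta> c by simp
        show "continuous_on (cball x R) u" by (rule continuous_on_subset[OF uc cbc])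
        show "0 \<le> u y \<and> u y \<le> M" if "y \<in> cball x R" for y using that subsetD[OF cbc that] u0 xm(2) by (simp add: M_def)
      qed
    qed
  qed
qed

theorem theorem1p5:
  fixes \<Omega> :: "(real^'n::finite) set" and r :: real
  assumes "smooth_bounded_domain \<Omega>" and "r > real CARD('n)"
  shows
   "(\<forall>(a::real^'n \<Rightarrow> real) q \<sigma>. 0 < q \<and> q < 1 \<and> Lp_on \<Omega> r a \<and> H0 \<Omega> a \<and> H1' \<Omega> a \<and>
        \<sigma> > 0 \<and> \<Omega> - closure (inner_set \<Omega> \<sigma>) \<subseteq> Omega_plus \<Omega> a \<longrightarrow>
        (\<forall>u. nonneg_solution \<Omega> r a q u \<and> nontrivial \<Omega> u \<longrightarrow>
           (\<forall>x\<in>frontier \<Omega>. u x > 0) \<and>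
           (P_interior \<Omega> u \<or> {x\<in>\<Omega>. u x = 0} \<noteq> {})))
    \<and>
    (\<forall>b1 b2 :: real^'n \<Rightarrow> real.
        Linf_on \<Omega> b1 \<and> continuous_on (closure \<Omega>) b2 \<and>
        (AE x in lebesgue. x \<in> \<Omega> \<longrightarrow> b1 x \<ge> 0) \<and> (\<forall>x\<in>closure \<Omega>. b2 x \<ge> 0) \<and>
        \<not> (AE x in lebesgue. x \<in> \<Omega> \<longrightarrow> b1 x = 0) \<and> (\<exists>x\<in>closure \<Omega>. b2 x \<noteq> 0) \<and>
        ess_supp \<Omega> b1 \<inter> {x\<in>\<Omega>. b2 x > 0} = {} \<longrightarrow>
        (\<forall>qbar \<sigma>. 0 < qbar \<and> qbar < 1 \<and> \<sigma> > 0 \<longrightarrow>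
           (\<exists>\<delta>0>0. \<forall>\<delta> q. \<delta> \<ge> \<delta>0 \<and> 0 < q \<and> q \<le> qbar \<longrightarrow>
              (\<forall>u. nonneg_solution \<Omega> r (\<lambda>x. b1 x - \<delta> * b2 x) q u \<and> nontrivial \<Omega> u \<longrightarrow>
                 (\<forall>x\<in>inner_set {x\<in>\<Omega>. b2 x > 0} \<sigma>. u x = 0)))))"
proof (rule conjI; intro allI impI)
  have r: "r \<ge> 1"
  proof -
    have "real CARD('n) \<ge> 1" using zero_less_card_finite[where 'a = 'n] by linarith
    then show ?thesis using assms(2) by linarith
  qed
  {
    fix a :: "real^'n \<Rightarrow> real" and q \<sigma> u
    assume "0 < q \<and> q < 1 \<and> Lp_on \<Omega> r a \<and> H0 \<Omega> a \<and> H1' \<Omega> a \<and>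
        \<sigma> > 0 \<and> \<Omega> - closure (inner_set \<Omega> \<sigma>) \<subseteq> Omega_plus \<Omega> a"
      and u: "nonneg_solution \<Omega> r a q u \<and> nontrivial \<Omega> u"
    then have pos: "\<forall>x\<in>frontier \<Omega>. u x > 0"
      using solution_positive_on_frontier[OF assms(1) r] by blast
    have "P_interior \<Omega> u" if "{x\<in>\<Omega>. u x = 0} = {}"
      unfolding P_interior_def
    proof (intro conjI ballI)
      show "\<exists>g. C1_closure_grad \<Omega> u g" using u by (auto simp: nonneg_solution_def)
      fix x assume x: "x \<in> closure \<Omega>"
      then have "u x \<ge> 0" using u by (simp add: nonneg_solution_def)
      moreover have "u x \<noteq> 0"
        using x that pos closure_Un_frontier[of \<Omega>] by (metis (mono_tags, lifting) Un_iff empty_Collect_eq less_irrefl)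
      ultimately show "u x > 0" by simp
    qed
    with pos show "(\<forall>x\<in>frontier \<Omega>. u x > 0) \<and> (P_interior \<Omega> u \<or> {x\<in>\<Omega>. u x = 0} \<noteq> {})" by blast
  next
    fix b1 b2 :: "real^'n \<Rightarrow> real" and qbar \<sigma> :: real
    assume b: "Linf_on \<Omega> b1 \<and> continuous_on (closure \<Omega>) b2 \<and>
        (AE x in lebesgue. x \<in> \<Omega> \<longrightarrow> b1 x \<ge> 0) \<and> (\<forall>x\<in>closure \<Omega>. b2 x \<ge> 0) \<and>
        \<not> (AE x in lebesgue. x \<in> \<Omega> \<longrightarrow> b1 x = 0) \<and> (\<exists>x\<in>closure \<Omega>. b2 x \<noteq> 0) \<and>
        ess_supp \<Omega> b1 \<inter> {x\<in>\<Omega>. b2 x > 0} = {}"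
      and q: "0 < qbar \<and> qbar < 1 \<and> \<sigma> > 0"
    show "\<exists>\<delta>0>0. \<forall>\<delta> q. \<delta> \<ge> \<delta>0 \<and> 0 < q \<and> q \<le> qbar \<longrightarrow>
              (\<forall>u. nonneg_solution \<Omega> r (\<lambda>x. b1 x - \<delta> * b2 x) q u \<and> nontrivial \<Omega> u \<longrightarrow>
                 (\<forall>x\<in>inner_set {x\<in>\<Omega>. b2 x > 0} \<sigma>. u x = 0))"
      by (rule solution_vanishes_in_inner_set[OF assms(1) r]) (use b q in auto)
  }
qed

end
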